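(* Let $R>0$, let $k\ge2$ be an integer, $\lambda_k=R\sqrt{k^2-1}$, and let $\mathscr C_k^{\rm reg}$ be a connected component of $\mathcal Z_{\rm reg}$ containing one of the nontrivial local solutions bifurcating from $(\lambda_k,0)$, or one of its phase translates. Then $p=1$ and $q=k$ on $\mathscr C_k^{\rm reg}$. Moreover, one of the following alternatives holds: (i) $\mathscr C_k^{\rm reg}$ is relatively compact in $\mathcal Z_{\rm reg}\cup\{(\lambda_k,0)\}$; (ii) there exists a sequence $\{(\lambda_n,\mathbf u_n)\}_{n\in\mathbb N}\subset\mathscr C_k^{\rm reg}$ such that $\lambda_n\to+\infty$; (iii) there exist a sequence $\{(\lambda_n,\mathbf u_n)\}_{n\in\mathbb N}\subset\mathscr C_k^{\rm reg}$ and a point $(\lambda,\mathbf u)\in\partial_{\rm ext}\mathcal Z_{\rm reg}\setminus\{(\lambda_k,0)\}$ such that $$\lim_{n\to+\infty}(\lambda_n,\mathbf u_n)=(\lambda,\mathbf u)\quad\text{in }[0,+\infty)\times H^2(\mathbb T,\mathbb R^3).$$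
   Context: Fix $R>0$; $\mathbb T=\mathbb R/2\pi\mathbb Z$, $e_3=(0,0,1)$, $\mathbf x_0(\eta)=(R\cos\eta,R\sin\eta,0)$. Zero set. For $\lambda>0$ and $\mathbf u\in H^2(\mathbb T,\mathbb R^3)$ put $\mathcal F(\lambda,\mathbf u)=\mathbf x_0\times\mathbf u''+\mathbf u\times\mathbf x_0''+\mathbf u\times\mathbf u''-\lambda e_3\times\mathbf u+\lambda\mathbf u'\in L^2(\mathbb T,\mathbb R^3)$, $\mathcal C(\mathbf u)=\mathbf x_0\cdot\mathbf u+\frac12\|\mathbf u\|^2\in H^2(\mathbb T)$, $\mathcal G=(\mathcal F,\mathcal C)$, and $\mathcal Z=\{(\lambda,\mathbf u)\in(0,+\infty)\times H^2(\mathbb T,\mathbb R^3):\mathcal G(\lambda,\mathbf u)=(0,0)\}$. Equivalently, $\mathbf x=\mathbf x_0+\mathbf u$ is a $2\pi$-periodic solution of $\mathbf x\times\mathbf x''-\lambda e_3\times\mathbf x+\lambda\mathbf x'=0$, $\|\mathbf x\|\equiv R$. Vertical polynomial. For $(\lambda,\mathbf u)\in\mathcal Z$, $\mathbf x=\mathbf x_0+\mathbf u$, the quantities $C=(\mathbf x\times\mathbf x')_3+\lambda x_3$ and $E=\frac\lambda2\|\mathbf x'\|^2+\lambda(x_2x_1'-x_1x_2')$ are constant in $\eta$, and $u=x_3$ satisfies $(u')^2=P(u)$ where $P(s)=a_3s^3-a_2s^2+a_1s+a_0$ with $a_0=\frac{2ER^2-\lambda C^2+2\lambda CR^2}{\lambda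 R^2}$, $a_1=\frac{2\lambda C-2\lambda R^2}{R^2}$, $a_2=\frac{2E+\lambda^3+2\lambda C}{\lambda R^2}$, $a_3=\frac{2\lambda}{R^2}$. Regular class. $\mathcal Z_{\rm reg}\subset\mathcal Z$ is the set of $(\lambda,\mathbf u)$ such that, with $u=x_3$: (1) $-R<u(\eta)<R$ for all $\eta$; (2) $u$ is not constant; (3) with $e_1=\min_{\mathbb T}u$, $e_2=\max_{\mathbb T}u$, the polynomial $P$ has a third real root $e_3$ (a number, not the vector) with $-R<e_1<e_2<R$, $e_2<e_3$, and $P(s)=\frac{2\lambda}{R^2}(s-e_1)(s-e_2)(s-e_3)$. Discrete invariants. On $\mathcal Z_{\rm reg}$, the horizontal degree is $p=\frac1{2\pi}\int_0^{2\pi}\frac{x_1x_2'-x_2x_1'}{x_1^2+x_2^2}\,d\eta\in\mathbb Z$, and the vertical nodal number $q\in\mathbb N$ is the number of full oscillations of $x_3$ on $[0,2\pi]$, i.e. the minimal period of $x_3$ is $2\pi/q$. Extended boundary. $\partial_{\rm ext}\mathcal Z_{\rm reg}$ is the closure of $\mathcal Z_{\rm reg}$ in $[0,+\infty)\times H^2(\mathbb T,\mathbb R^3)$ minus $\mathcal Z_{\rm reg}$. Relative compactness in $\mathcal Z_{\rm reg}\cup\{(\lambda_k,0)\}$ means that the closure of the component in this set, with the topology induced by $[0,+\infty)\times H^2(\mathbb T,\mathbb R^3)$, is compact. Local solutions. Let $S=\mathrm{diag}(1,-1,1)$, $Y_{\rm rev}=\{\mathbf u\in H^2(\mathbb T,\mathbb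 R^3): S\mathbf u(-\eta)=\mathbf u(\eta)\}$, and $\mathbf v_k(\eta)=\sin(k\eta)(-\sin\eta,\cos\eta,0)-\frac{k}{\sqrt{k^2-1}}\cos(k\eta)\,e_3$. In a neighbourhood of $(\lambda_k,0)$ in $(0,\infty)\times Y_{\rm rev}$ the zeros of $\mathcal G$ are the trivial ones $(\lambda,0)$ together with a smooth curve $t\mapsto(\Lambda_k(t),\mathbf u_k(t))$, $|t|<\delta$, with $\Lambda_k(0)=\lambda_k$, $\mathbf u_k(t)=t(\mathbf v_k+\Gamma_k(t))$, $\Gamma_k(0)=0$, $\Gamma_k(t)$ being $H^2$-orthogonal to $\mathbf v_k$. The nontrivial local solutions bifurcating from $(\lambda_k,0)$ are the points of this curve with $t\ne0$, $|t|$ sufficiently small. The phase translates of $(\lambda,\mathbf u)$ are $(\lambda,\rho_\varphi\mathbf u)$, $(\rho_\varphi\mathbf u)(\eta)=R_\varphi\mathbf u(\eta-\varphi)$, with $R_\varphi$ the rotation of angle $\varphi$ about the $x_3$-axis. *)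

theory Defs
  imports "HOL-Analysis.Analysis"
begin

unbundle no cross3_syntax
unbundle set_product_syntax

text \<open>An element of the Sobolev space is represented by its continuous representative, a
  \<open>2\<pi>\<close>-periodic function on the real line. In dimension one, such a function belongs to the
  Sobolev space iff it is continuously differentiable with an absolutely continuous derivative
  whose a.e. derivative is square integrable; absolute continuity is expressed by saying that the
  first derivative is the indefinite Lebesgue integral of a square integrable \<open>g\<close>, which is then
  the second weak derivative.\<close>

definition L2_2pi :: "(real \<Rightarrow> real^3) \<Rightarrow> bool" where
  "L2_2pi g \<longleftrightarrow> g \<in> borel_measurable borel \<and>
     set_integrable lborel {0..2*pi} (\<lambda>t. (norm (g t))\<^sup>2)"

definition weak_second_deriv :: "(real \<Rightarrow> real^3) \<Rightarrow> (real \<Rightarrow> real^3) \<Rightarrow> bool" where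
  "weak_second_deriv f g \<longleftrightarrow> L2_2pi g \<and>
     (\<exists>f'. (\<forall>t. (f has_vector_derivative f' t) (at t)) \<and>
           (\<forall>t\<in>{0..2*pi}. f' t = f' 0 + (LBINT s:{0..t}. g s)))"

definition H2_fun :: "(real \<Rightarrow> real^3) \<Rightarrow> bool" where
  "H2_fun f \<longleftrightarrow> (\<forall>t. f (t + 2*pi) = f t) \<and> (\<exists>g. weak_second_deriv f g)"

lemma L2_2pi_zero: "L2_2pi (\<lambda>t. 0)"
  by (simp add: L2_2pi_def set_integrable_def)

lemma L2_2pi_scaleR: "L2_2pi g \<Longrightarrow> L2_2pi (\<lambda>t. c *\<^sub>R g t)"
  by (auto simp: L2_2pi_def power_mult_distrib)

lemma L2_2pi_inner_integrable:
  assumes "L2_2pi g" "L2_2pi h"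
  shows "set_integrable lborel {0..2*pi} (\<lambda>t. g t \<bullet> h t)"
proof -
  have [measurable]: "g \<in> borel_measurable borel" "h \<in> borel_measurable borel"
    using assms by (auto simp: L2_2pi_def)
  have *: "set_integrable lborel {0..2*pi} (\<lambda>t. (norm (g t))\<^sup>2 + (norm (h t))\<^sup>2)"
    using assms by (auto simp: L2_2pi_def)
  show ?thesis
  proof (rule set_integrable_bound[OF *])
    show "set_borel_measurable lborel {0..2*pi} (\<lambda>t. g t \<bullet> h t)"
      unfolding set_borel_measurable_def by measurable
    have "norm (a \<bullet> b) \<le> norm ((norm a)\<^sup>2 + (norm b)\<^sup>2)" for a b :: "real^3"
    proof -
      have "\<bar>a \<bullet> b\<bar> \<le> norm a * norm b" by (rule Cauchy_Schwarz_ineq2)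
      moreover have "2 * (norm a * norm b) \<le> (norm a)\<^sup>2 + (norm b)\<^sup>2"
        using sum_squares_bound[of "norm a" "norm b"] by simp
      moreover have "0 \<le> norm a * norm b" by simp
      ultimately show ?thesis by simp
    qed
    then show "AE x in lborel. x \<in> {0..2*pi} \<longrightarrow>
        norm (g x \<bullet> h x) \<le> norm ((norm (g x))\<^sup>2 + (norm (h x))\<^sup>2)"
      by auto
  qed
qed

lemma L2_2pi_add:
  assumes "L2_2pi g" "L2_2pi h"
  shows "L2_2pi (\<lambda>t. g t + h t)"
proof -
  have m: "g \<in> borel_measurable borel" "h \<in> borel_measurable borel"
    using assms by (auto simp: L2_2pi_def)
  have eq: "(norm (g t + h t))\<^sup>2 = (norm (g t))\<^sup>2 + 2 * (g t \<bullet> h t) + (norm (h t))\<^sup>2" for t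
    by (simp add: power2_norm_eq_inner inner_add_left inner_add_right inner_commute)
  show ?thesis
    unfolding L2_2pi_def eq using m assms L2_2pi_inner_integrable[OF assms]
    by (auto simp: L2_2pi_def)
qed

lemma L2_2pi_set_integrable:
  assumes "L2_2pi g" "t \<le> 2*pi"
  shows "set_integrable lborel {0..t} g"
proof -
  have [measurable]: "g \<in> borel_measurable borel" using assms by (auto simp: L2_2pi_def)
  have c: "set_integrable lborel {0..2*pi} (\<lambda>t. 1 + (norm (g t))\<^sup>2)"
  proof (rule set_integral_add(1))
    show "set_integrable lborel {0..2*pi} (\<lambda>t. 1 :: real)"
      by (intro borel_integrable_atLeastAtMost' continuous_intros)
  qed (use assms in \<open>simp add: L2_2pi_def\<close>)
  have "set_integrable lborel {0..2*pi} g"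
  proof (rule set_integrable_bound[OF c])
    show "set_borel_measurable lborel {0..2*pi} g"
      unfolding set_borel_measurable_def by measurable
    have "norm a \<le> norm (1 + (norm a)\<^sup>2)" for a :: "real^3"
      using sum_squares_bound[of 1 "norm a"] by (simp add: power2_eq_square)
        (smt (verit) norm_ge_zero)
    then show "AE x in lborel. x \<in> {0..2*pi} \<longrightarrow> norm (g x) \<le> norm (1 + (norm (g x))\<^sup>2)"
      by auto
  qed
  then show ?thesis
    by (rule set_integrable_subset) (use assms in auto)
qed

lemma weak_second_deriv_zero: "weak_second_deriv (\<lambda>t. 0) (\<lambda>t. 0)"
  unfolding weak_second_deriv_def set_lebesgue_integral_def
  by (auto intro!: L2_2pi_zero exI[of _ "\<lambda>t. 0"])

lemma weak_second_deriv_scaleR: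
  assumes "weak_second_deriv f g"
  shows "weak_second_deriv (\<lambda>t. c *\<^sub>R f t) (\<lambda>t. c *\<^sub>R g t)"
proof -
  from assms obtain f' where f': "\<And>t. (f has_vector_derivative f' t) (at t)"
      "\<And>t. t \<in> {0..2*pi} \<Longrightarrow> f' t = f' 0 + (LBINT s:{0..t}. g s)" and g: "L2_2pi g"
    unfolding weak_second_deriv_def by blast
  show ?thesis
    unfolding weak_second_deriv_def
  proof (intro conjI exI[of _ "\<lambda>t. c *\<^sub>R f' t"] allI ballI)
    show "L2_2pi (\<lambda>t. c *\<^sub>R g t)" using g by (rule L2_2pi_scaleR)
    fix t
    show "((\<lambda>t. c *\<^sub>R f t) has_vector_derivative c *\<^sub>R f' t) (at t)"
      using f'(1)[of t] by (auto intro!: derivative_eq_intros)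
  next
    fix t assume "t \<in> {0..2*pi}"
    then show "c *\<^sub>R f' t = c *\<^sub>R f' 0 + (LBINT s:{0..t}. c *\<^sub>R g s)"
      by (simp add: f'(2)[of t] scaleR_add_right)
  qed
qed

lemma weak_second_deriv_add:
  assumes "weak_second_deriv f1 g1" "weak_second_deriv f2 g2"
  shows "weak_second_deriv (\<lambda>t. f1 t + f2 t) (\<lambda>t. g1 t + g2 t)"
proof -
  from assms(1) obtain d1 where 1: "\<And>t. (f1 has_vector_derivative d1 t) (at t)"
      "\<And>t. t \<in> {0..2*pi} \<Longrightarrow> d1 t = d1 0 + (LBINT s:{0..t}. g1 s)" "L2_2pi g1"
    unfolding weak_second_deriv_def by blast
  from assms(2) obtain d2 where 2: "\<And>t. (f2 has_vector_derivative d2 t) (at t)"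
      "\<And>t. t \<in> {0..2*pi} \<Longrightarrow> d2 t = d2 0 + (LBINT s:{0..t}. g2 s)" "L2_2pi g2"
    unfolding weak_second_deriv_def by blast
  show ?thesis
    unfolding weak_second_deriv_def
  proof (intro conjI exI[of _ "\<lambda>t. d1 t + d2 t"] allI ballI)
    show "L2_2pi (\<lambda>t. g1 t + g2 t)" using 1 2 by (intro L2_2pi_add)
    fix t
    show "((\<lambda>t. f1 t + f2 t) has_vector_derivative d1 t + d2 t) (at t)"
      using 1(1)[of t] 2(1)[of t] by (rule has_vector_derivative_add)
  next
    fix t assume t: "t \<in> {0..2*pi}"
    have "(LBINT s:{0..t}. g1 s + g2 s) = (LBINT s:{0..t}. g1 s) + (LBINT s:{0..t}. g2 s)"
      using 1 2 t by (intro set_integral_add L2_2pi_set_integrable) auto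
    then show "d1 t + d2 t = d1 0 + d2 0 + (LBINT s:{0..t}. g1 s + g2 s)"
      using 1(2)[OF t] 2(2)[OF t] by simp
  qed
qed

lemma weak_second_deriv_unique:
  assumes "weak_second_deriv f g" "weak_second_deriv f h"
  shows "AE t in lborel. t \<in> {0..2*pi} \<longrightarrow> g t = h t"
proof -
  have wk: "weak_second_deriv (\<lambda>t. 0) (\<lambda>t. g t + (-1) *\<^sub>R h t)"
    using weak_second_deriv_add[OF assms(1) weak_second_deriv_scaleR[OF assms(2), of "-1"]] by simp
  define k where "k = (\<lambda>t. g t + (-1) *\<^sub>R h t)"
  obtain d where d: "\<And>t. ((\<lambda>t. 0::real^3) has_vector_derivative d t) (at t)"
      "\<And>t. t \<in> {0..2*pi} \<Longrightarrow> d t = d 0 + (LBINT s:{0..t}. k s)" and k: "L2_2pi k"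
    using wk unfolding weak_second_deriv_def k_def by blast
  have "d t = 0" for t
    using vector_derivative_unique_at[OF d(1)[of t] has_vector_derivative_const] by simp
  then have zero: "(LBINT s:{0..t}. k s) = 0" if "t \<in> {0..2*pi}" for t
    using d(2)[OF that] by simp
  define K where "K = (\<lambda>s. indicator {0..2*pi} s *\<^sub>R k s)"
  have K: "integrable lborel K"
    using L2_2pi_set_integrable[OF k order_refl] by (simp add: K_def set_integrable_def)
  have Kt: "(LBINT s:{..t}. K s) = 0" for t
  proof -
    have "(\<lambda>s. indicator {..t} s *\<^sub>R K s) = (\<lambda>s. indicator {0..min t (2*pi)} s *\<^sub>R k s)"
      by (auto simp: K_def indicator_def fun_eq_iff)
    then have "(LBINT s:{..t}. K s) = (LBINT s:{0..min t (2*pi)}. k s)"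
      by (simp add: set_lebesgue_integral_def)
    also have "\<dots> = 0"
    proof (cases "0 \<le> t")
      case True then show ?thesis by (intro zero) auto
    next
      case False
      then have "{0..min t (2*pi)} = {}" by auto
      then show ?thesis by (simp add: set_lebesgue_integral_def)
    qed
    finally show ?thesis .
  qed
  have Kint: "set_integrable lborel A K" if "A \<in> sets borel" for A
    using that K by (simp add: set_integrable_def integrable_mult_indicator)
  have tot: "(LBINT s. K s) = 0"
    using Kt[of "2*pi"] zero[of "2*pi"] unfolding K_def set_lebesgue_integral_def by simp
  have gen: "sets borel = sigma_sets UNIV (range (\<lambda>t::real. {..t}))"
    by (subst borel_eq_atMost) (rule sets_measure_of, auto)
  have all: "(LBINT s:A. K s) = 0" if "A \<in> sigma_sets UNIV (range (\<lambda>t::real. {..t}))" for A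
  proof (rule sigma_sets_induct_disjoint[OF _ _ that])
    show "Int_stable (range (\<lambda>t::real. {..t}))"
      by (auto simp: Int_stable_def)
    show "range (\<lambda>t::real. {..t}) \<subseteq> Pow UNIV" by auto
    show "(LBINT s:A. K s) = 0" if "A \<in> range (\<lambda>t. {..t})" for A
      using that Kt by auto
    show "(LBINT s:{}. K s) = 0" by (simp add: set_lebesgue_integral_def)
    fix A assume "A \<in> sigma_sets UNIV (range (\<lambda>t::real. {..t}))" and A0: "(LBINT s:A. K s) = 0"
    then have A: "A \<in> sets borel" by (simp add: gen)
    have "(LBINT s:A \<union> (UNIV - A). K s) = (LBINT s:A. K s) + (LBINT s:UNIV - A. K s)"
      using A by (intro set_integral_Un Kint) auto
    then show "(LBINT s:UNIV - A. K s) = 0"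
      using A0 tot by (simp add: set_lebesgue_integral_def)
  next
    fix A :: "nat \<Rightarrow> real set"
    assume dis: "disjoint_family A"
      and *: "range A \<subseteq> sigma_sets UNIV (range (\<lambda>t::real. {..t}))"
      and 0: "\<And>i. (LBINT s:A i. K s) = 0"
    then have A: "A i \<in> sets borel" for i by (auto simp: gen)
    have "(LBINT s:(\<Union>i. A i). K s) = (\<Sum>i. LBINT s:A i. K s)"
      using A dis by (intro lebesgue_integral_countable_add Kint) (auto simp: disjoint_family_on_def)
    then show "(LBINT s:(\<Union>i. A i). K s) = 0" by (simp add: 0)
  qed
  have "AE s in lborel. K s \<bullet> b = 0" for b
  proof (rule density_unique_real)
    show "integrable lborel (\<lambda>s. K s \<bullet> b)" "integrable lborel (\<lambda>s. 0::real)"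
      using K by auto
    fix A assume A: "A \<in> sets (lborel :: real measure)"
    then have "integrable lborel (\<lambda>s. indicator A s *\<^sub>R K s)"
      using Kint[of A] by (simp add: set_integrable_def)
    then have "(LBINT s:A. K s \<bullet> b) = (LBINT s:A. K s) \<bullet> b"
      unfolding set_lebesgue_integral_def by (subst integral_inner_left[symmetric]) auto
    then show "(LBINT s:A. K s \<bullet> b) = (LBINT s:A. 0)"
      using all[of A] A by (simp add: gen set_lebesgue_integral_def)
  qed
  then have "AE s in lborel. \<forall>b\<in>Basis. K s \<bullet> b = 0"
    by (intro AE_finite_allI) auto
  then have "AE s in lborel. K s = 0"
    by eventually_elim (auto intro: euclidean_eqI)
  then show ?thesis
    by eventually_elim (auto simp: K_def k_def indicator_def)
qed

lemma H2_fun_zero: "H2_fun (\<lambda>t. 0)"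
  using weak_second_deriv_zero by (auto simp: H2_fun_def)

lemma H2_fun_scaleR: "H2_fun f \<Longrightarrow> H2_fun (\<lambda>t. c *\<^sub>R f t)"
  unfolding H2_fun_def by (metis weak_second_deriv_scaleR)

lemma H2_fun_add: "H2_fun f \<Longrightarrow> H2_fun g \<Longrightarrow> H2_fun (\<lambda>t. f t + g t)"
  unfolding H2_fun_def by (metis weak_second_deriv_add)

lemma H2_fun_uminus: "H2_fun f \<Longrightarrow> H2_fun (\<lambda>t. - f t)"
  using H2_fun_scaleR[of f "-1"] by simp

lemma H2_fun_diff: "H2_fun f \<Longrightarrow> H2_fun g \<Longrightarrow> H2_fun (\<lambda>t. f t - g t)"
  using H2_fun_add[of f "\<lambda>t. - g t"] H2_fun_uminus[of g] by simp

lemma H2_fun_C2: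
  assumes "\<And>t. f (t + 2*pi) = f t"
    and "\<And>t. (f has_vector_derivative f' t) (at t)"
    and "\<And>t. (f' has_vector_derivative f'' t) (at t)"
    and "continuous_on UNIV f''"
  shows "H2_fun f"
proof -
  have L2: "L2_2pi f''"
    unfolding L2_2pi_def
  proof
    show "f'' \<in> borel_measurable borel"
      using assms(4) by (rule borel_measurable_continuous_onI)
    show "set_integrable lborel {0..2*pi} (\<lambda>t. (norm (f'' t))\<^sup>2)"
      by (intro borel_integrable_atLeastAtMost' continuous_intros
            continuous_on_subset[OF assms(4)]) auto
  qed
  have "f' t = f' 0 + (LBINT s:{0..t}. f'' s)" if "t \<in> {0..2*pi}" for t
  proof -
    have "(LBINT s:{0..t}. f'' s) = f' t - f' 0"
      unfolding set_lebesgue_integral_def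
    proof (rule integral_FTC_atLeastAtMost)
      show "continuous_on {0..t} f''"
        using assms(4) by (rule continuous_on_subset) simp
    qed (use that assms(3) in \<open>auto intro: has_vector_derivative_at_within\<close>)
    then show ?thesis by simp
  qed
  with L2 have "weak_second_deriv f f''"
    unfolding weak_second_deriv_def using assms(2) by blast
  with assms(1) show ?thesis unfolding H2_fun_def by blast
qed

typedef H2 = "{f. H2_fun f}" morphisms rep_H2 Abs_H2
  by (rule exI[of _ "\<lambda>t. 0"]) (simp add: H2_fun_zero)

setup_lifting type_definition_H2

lemma H2_fun_rep: "H2_fun (rep_H2 u)"
  using rep_H2 by simp

definition D1 :: "H2 \<Rightarrow> real \<Rightarrow> real^3" where
  "D1 u t = vector_derivative (rep_H2 u) (at t)"

text \<open>A chosen representative, unique almost everywhere on \<open>[0,2\<pi>]\<close>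
  by \<open>weak_second_deriv_unique\<close> and meaningful only there.\<close>

definition D2 :: "H2 \<Rightarrow> real \<Rightarrow> real^3" where
  "D2 u = (SOME g. weak_second_deriv (rep_H2 u) g)"

lemma weak_second_deriv_D2: "weak_second_deriv (rep_H2 u) (D2 u)"
proof -
  have "\<exists>g. weak_second_deriv (rep_H2 u) g"
    using H2_fun_rep[of u] by (simp add: H2_fun_def)
  then show ?thesis unfolding D2_def by (rule someI_ex)
qed

lemma L2_2pi_D2: "L2_2pi (D2 u)"
  using weak_second_deriv_D2 by (simp add: weak_second_deriv_def)

lemma has_vector_derivative_D1: "(rep_H2 u has_vector_derivative D1 u t) (at t)"
proof -
  obtain f' where f': "(rep_H2 u has_vector_derivative f' t) (at t)"
    using weak_second_deriv_D2[of u] unfolding weak_second_deriv_def by blast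
  from vector_derivative_at[OF f'] f' show ?thesis by (simp add: D1_def)
qed

lemma D1_eq_integral_D2:
  assumes "t \<in> {0..2*pi}"
  shows "D1 u t = D1 u 0 + (LBINT s:{0..t}. D2 u s)"
proof -
  from weak_second_deriv_D2[of u] obtain d where
    d: "\<And>t. (rep_H2 u has_vector_derivative d t) (at t)"
       "\<And>t. t \<in> {0..2*pi} \<Longrightarrow> d t = d 0 + (LBINT s:{0..t}. D2 u s)"
    unfolding weak_second_deriv_def by blast
  have "d t = D1 u t" for t
    by (rule vector_derivative_unique_at[OF d(1) has_vector_derivative_D1])
  then show ?thesis using d(2)[OF assms] by simp
qed

lemma continuous_on_rep_H2: "continuous_on S (rep_H2 u)"
proof (rule continuous_at_imp_continuous_on, rule ballI)
  show "isCont (rep_H2 u) t" for t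
    by (rule has_vector_derivative_continuous[OF has_vector_derivative_D1])
qed

lemma continuous_on_D1: "continuous_on {0..2*pi} (D1 u)"
proof -
  have "set_integrable lborel {0..2*pi} (D2 u)"
    by (rule L2_2pi_set_integrable[OF L2_2pi_D2 order_refl])
  then have i: "D2 u integrable_on {0..2*pi}"
    by (rule set_borel_integral_eq_integral)
  have eq: "D1 u t = D1 u 0 + integral {0..t} (D2 u)" if "t \<in> {0..2*pi}" for t
  proof -
    have "set_integrable lborel {0..t} (D2 u)"
      using that by (intro L2_2pi_set_integrable[OF L2_2pi_D2]) auto
    then show ?thesis
      using D1_eq_integral_D2[OF that] set_borel_integral_eq_integral(2)[of "{0..t}" "D2 u"] by simp
  qed
  have "continuous_on {0..2*pi} (\<lambda>t. D1 u 0 + integral {0..t} (D2 u))"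
    by (intro continuous_intros indefinite_integral_continuous_1 i)
  then show ?thesis by (rule continuous_on_eq) (rule eq[symmetric])
qed

instantiation H2 :: real_vector
begin

lift_definition zero_H2 :: H2 is "\<lambda>t. 0" by (rule H2_fun_zero)
lift_definition plus_H2 :: "H2 \<Rightarrow> H2 \<Rightarrow> H2" is "\<lambda>f g t. f t + g t" by (rule H2_fun_add)
lift_definition minus_H2 :: "H2 \<Rightarrow> H2 \<Rightarrow> H2" is "\<lambda>f g t. f t - g t" by (rule H2_fun_diff)
lift_definition uminus_H2 :: "H2 \<Rightarrow> H2" is "\<lambda>f t. - f t" by (rule H2_fun_uminus)
lift_definition scaleR_H2 :: "real \<Rightarrow> H2 \<Rightarrow> H2" is "\<lambda>c f t. c *\<^sub>R f t" by (rule H2_fun_scaleR)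

instance
proof
  fix x y z :: H2 and a b :: real
  show "x + y + z = x + (y + z)" by transfer (simp add: add.assoc)
  show "x + y = y + x" by transfer (simp add: add.commute)
  show "0 + x = x" by transfer simp
  show "- x + x = 0" by transfer simp
  show "x - y = x + - y" by transfer simp
  show "a *\<^sub>R (x + y) = a *\<^sub>R x + a *\<^sub>R y" by transfer (simp add: scaleR_add_right)
  show "(a + b) *\<^sub>R x = a *\<^sub>R x + b *\<^sub>R x" by transfer (simp add: scaleR_add_left)
  show "a *\<^sub>R b *\<^sub>R x = (a * b) *\<^sub>R x" by transfer simp
  show "1 *\<^sub>R x = x" by transfer simp
qed

end

lemma D1_add: "D1 (u + v) t = D1 u t + D1 v t"
  unfolding D1_def[of "u + v"] plus_H2.rep_eq
  by (intro vector_derivative_at has_vector_derivative_add has_vector_derivative_D1)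

lemma D1_scaleR: "D1 (c *\<^sub>R u) t = c *\<^sub>R D1 u t"
proof -
  have "((\<lambda>t. c *\<^sub>R rep_H2 u t) has_vector_derivative c *\<^sub>R D1 u t) (at t)"
    using has_vector_derivative_D1[of u t] by (auto intro!: derivative_eq_intros)
  then show ?thesis
    unfolding D1_def[of "c *\<^sub>R u"] by (simp add: scaleR_H2.rep_eq vector_derivative_at)
qed

lemma D2_add: "AE t in lborel. t \<in> {0..2*pi} \<longrightarrow> D2 (u + v) t = D2 u t + D2 v t"
proof (rule weak_second_deriv_unique)
  show "weak_second_deriv (rep_H2 (u + v)) (D2 (u + v))" by (rule weak_second_deriv_D2)
  show "weak_second_deriv (rep_H2 (u + v)) (\<lambda>t. D2 u t + D2 v t)"
    unfolding plus_H2.rep_eq by (intro weak_second_deriv_add weak_second_deriv_D2)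
qed

lemma D2_scaleR: "AE t in lborel. t \<in> {0..2*pi} \<longrightarrow> D2 (c *\<^sub>R u) t = c *\<^sub>R D2 u t"
proof (rule weak_second_deriv_unique)
  show "weak_second_deriv (rep_H2 (c *\<^sub>R u)) (D2 (c *\<^sub>R u))" by (rule weak_second_deriv_D2)
  show "weak_second_deriv (rep_H2 (c *\<^sub>R u)) (\<lambda>t. c *\<^sub>R D2 u t)"
    unfolding scaleR_H2.rep_eq by (intro weak_second_deriv_scaleR weak_second_deriv_D2)
qed

lemma H2_inner_integrable:
  "set_integrable lborel {0..2*pi}
     (\<lambda>t. rep_H2 u t \<bullet> rep_H2 v t + D1 u t \<bullet> D1 v t + D2 u t \<bullet> D2 v t)"
  by (intro set_integral_add L2_2pi_inner_integrable L2_2pi_D2 borel_integrable_atLeastAtMost'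
      continuous_intros continuous_on_rep_H2 continuous_on_D1)

lemma set_integral_eq_AE:
  fixes f g :: "real \<Rightarrow> real"
  assumes "set_integrable lborel A f" "set_integrable lborel A g"
    and "AE t in lborel. t \<in> A \<longrightarrow> f t = g t"
  shows "(LBINT t:A. f t) = (LBINT t:A. g t)"
  unfolding set_lebesgue_integral_def
proof (rule integral_cong_AE)
  show "AE t in lborel. indicator A t *\<^sub>R f t = indicator A t *\<^sub>R g t"
    using assms(3) by eventually_elim (auto simp: indicator_def)
qed (use assms in \<open>simp_all add: set_integrable_def borel_measurable_integrable del: real_scaleR_def\<close>)

instantiation H2 :: real_inner
begin

definition inner_H2 :: "H2 \<Rightarrow> H2 \<Rightarrow> real" where
  "inner_H2 u v = (LBINT t:{0..2*pi}. rep_H2 u t \<bullet> rep_H2 v t + D1 u t \<bullet> D1 v t + D2 u t \<bullet> D2 v t)"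

definition norm_H2 :: "H2 \<Rightarrow> real" where "norm_H2 u = sqrt (u \<bullet> u)"
definition sgn_H2 :: "H2 \<Rightarrow> H2" where "sgn_H2 u = u /\<^sub>R norm u"
definition dist_H2 :: "H2 \<Rightarrow> H2 \<Rightarrow> real" where "dist_H2 u v = norm (u - v)"
definition uniformity_H2 :: "(H2 \<times> H2) filter" where
  "uniformity_H2 = (INF e\<in>{0 <..}. principal {(x, y). dist x y < e})"
definition open_H2 :: "H2 set \<Rightarrow> bool" where
  "open_H2 U \<longleftrightarrow> (\<forall>x\<in>U. eventually (\<lambda>(x', y). x' = x \<longrightarrow> y \<in> U) uniformity)"

instance
proof
  note int = H2_inner_integrable
  fix x y z :: H2 and a b :: real
  show "dist x y = norm (x - y)" by (rule dist_H2_def)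
  show "sgn x = x /\<^sub>R norm x" by (rule sgn_H2_def)
  show "uniformity = (INF e\<in>{0<..}. principal {(x, y). dist (x::H2) y < e})"
    by (rule uniformity_H2_def)
  show "open U \<longleftrightarrow> (\<forall>x\<in>U. \<forall>\<^sub>F (x', y) in uniformity. x' = x \<longrightarrow> y \<in> U)" for U :: "H2 set"
    by (rule open_H2_def)
  show "norm x = sqrt (x \<bullet> x)" by (rule norm_H2_def)
  show "x \<bullet> y = y \<bullet> x" by (simp add: inner_H2_def inner_commute)
  have "(x + y) \<bullet> z = (LBINT t:{0..2*pi}.
      (rep_H2 x t \<bullet> rep_H2 z t + D1 x t \<bullet> D1 z t + D2 x t \<bullet> D2 z t) +
      (rep_H2 y t \<bullet> rep_H2 z t + D1 y t \<bullet> D1 z t + D2 y t \<bullet> D2 z t))"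
    unfolding inner_H2_def
  proof (rule set_integral_eq_AE)
    show "AE t in lborel. t \<in> {0..2*pi} \<longrightarrow>
       rep_H2 (x + y) t \<bullet> rep_H2 z t + D1 (x + y) t \<bullet> D1 z t + D2 (x + y) t \<bullet> D2 z t =
       (rep_H2 x t \<bullet> rep_H2 z t + D1 x t \<bullet> D1 z t + D2 x t \<bullet> D2 z t) +
       (rep_H2 y t \<bullet> rep_H2 z t + D1 y t \<bullet> D1 z t + D2 y t \<bullet> D2 z t)"
      using D2_add[of x y]
      by eventually_elim (auto simp: plus_H2.rep_eq D1_add inner_add_left)
  qed (intro int set_integral_add)+
  then show "(x + y) \<bullet> z = x \<bullet> z + y \<bullet> z"
    by (simp add: inner_H2_def set_integral_add(2)[OF int int])
  have sc: "(a *\<^sub>R x) \<bullet> y = a * (x \<bullet> y)" for a and x y :: H2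
  proof -
  have "(a *\<^sub>R x) \<bullet> y = (LBINT t:{0..2*pi}.
      a * (rep_H2 x t \<bullet> rep_H2 y t + D1 x t \<bullet> D1 y t + D2 x t \<bullet> D2 y t))"
    unfolding inner_H2_def
  proof (rule set_integral_eq_AE)
    show "AE t in lborel. t \<in> {0..2*pi} \<longrightarrow>
       rep_H2 (a *\<^sub>R x) t \<bullet> rep_H2 y t + D1 (a *\<^sub>R x) t \<bullet> D1 y t + D2 (a *\<^sub>R x) t \<bullet> D2 y t =
       a * (rep_H2 x t \<bullet> rep_H2 y t + D1 x t \<bullet> D1 y t + D2 x t \<bullet> D2 y t)"
      using D2_scaleR[of a x]
      by eventually_elim (auto simp: scaleR_H2.rep_eq D1_scaleR algebra_simps)
  qed (auto intro!: int set_integrable_mult_right)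
  then show ?thesis
    by (simp add: inner_H2_def)
  qed
  show "a *\<^sub>R x \<bullet> y = a * (x \<bullet> y)" by (rule sc)
  show nn: "0 \<le> x \<bullet> x"
    unfolding inner_H2_def set_lebesgue_integral_def by (intro integral_nonneg_AE) auto
  show "x \<bullet> x = 0 \<longleftrightarrow> x = 0"
  proof
    assume "x \<bullet> x = 0"
    have c: "continuous_on {0..2*pi} (\<lambda>t. rep_H2 x t \<bullet> rep_H2 x t)"
      by (intro continuous_intros continuous_on_rep_H2)
    have "(LBINT t:{0..2*pi}. rep_H2 x t \<bullet> rep_H2 x t) \<le> x \<bullet> x"
      unfolding inner_H2_def
      by (intro set_integral_mono int borel_integrable_atLeastAtMost' c) auto
    moreover have "0 \<le> (LBINT t:{0..2*pi}. rep_H2 x t \<bullet> rep_H2 x t)"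
      unfolding set_lebesgue_integral_def by (intro integral_nonneg_AE) auto
    ultimately have "(LBINT t:{0..2*pi}. rep_H2 x t \<bullet> rep_H2 x t) = 0"
      using \<open>x \<bullet> x = 0\<close> by simp
    then have "((\<lambda>t. rep_H2 x t \<bullet> rep_H2 x t) has_integral 0) (cbox 0 (2*pi))"
      using set_borel_integral_eq_integral[OF borel_integrable_atLeastAtMost'[OF c]]
      by (simp add: has_integral_integral)
    then have z: "rep_H2 x t \<bullet> rep_H2 x t = 0" if "t \<in> {0..2*pi}" for t
      using that c
      by (intro has_integral_0_cbox_imp_0[of 0 "2*pi" "\<lambda>t. rep_H2 x t \<bullet> rep_H2 x t"])
        (auto simp: not_le)
    have per: "rep_H2 x (s + 2*pi) = rep_H2 x s" for s
      using H2_fun_rep[of x] by (simp add: H2_fun_def)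
    interpret periodic_fun_simple "rep_H2 x" "2*pi"
      by standard (rule per)
    have "rep_H2 x s = 0" for s
    proof -
      define n where "n = \<lfloor>s / (2*pi)\<rfloor>"
      have "real_of_int n \<le> s / (2*pi)" "s / (2*pi) < real_of_int n + 1"
        unfolding n_def by linarith+
      then have "s - real_of_int n * (2*pi) \<in> {0..2*pi}"
        by (auto simp: field_simps)
      moreover have "rep_H2 x (s - real_of_int n * (2*pi)) = rep_H2 x s"
        by (rule minus_of_int)
      ultimately show ?thesis using z by fastforce
    qed
    then show "x = 0" by transfer auto
  next
    assume "x = 0"
    then show "x \<bullet> x = 0" using sc[of 0 x x] by simp
  qed
qed

end

definition e3 :: "real^3" where
  "e3 = vector [0, 0, 1]"

definition x0 :: "real \<Rightarrow> real \<Rightarrow> real^3" where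
  "x0 R \<eta> = vector [R * cos \<eta>, R * sin \<eta>, 0]"

definition x0'' :: "real \<Rightarrow> real \<Rightarrow> real^3" where
  "x0'' R \<eta> = vector_derivative (\<lambda>s. vector_derivative (x0 R) (at s)) (at \<eta>)"

lemma vector_3_scaleR:
  "vector [a, b, c] = a *\<^sub>R axis 1 1 + b *\<^sub>R axis 2 1 + (c *\<^sub>R axis 3 1 :: real^3)"
  by (simp add: vec_eq_iff forall_3 axis_def)

lemma has_vector_derivative_vector_3:
  assumes "(a has_real_derivative a') (at t)" "(b has_real_derivative b') (at t)"
    "(c has_real_derivative c') (at t)"
  shows "((\<lambda>s. vector [a s, b s, c s] :: real^3) has_vector_derivative vector [a', b', c']) (at t)"
proof -
  have "((\<lambda>s. f s *\<^sub>R (v :: real^3)) has_vector_derivative f' *\<^sub>R v) (at t)"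
    if "(f has_real_derivative f') (at t)" for f f' v
    using has_vector_derivative_scaleR[OF that has_vector_derivative_const[of v]] by simp
  then show ?thesis
    unfolding vector_3_scaleR using assms by (intro has_vector_derivative_add) blast+
qed

lemma x0''_eq: "x0'' R \<eta> = - x0 R \<eta>"
proof -
  have 1: "(x0 R has_vector_derivative vector [- (R * sin s), R * cos s, 0]) (at s)" for s
    unfolding x0_def[abs_def]
    by (rule has_vector_derivative_vector_3) (auto intro!: derivative_eq_intros)
  have "((\<lambda>s. vector [- (R * sin s), R * cos s, 0] :: real^3) has_vector_derivative
      vector [- (R * cos \<eta>), - (R * sin \<eta>), 0]) (at \<eta>)"
    by (rule has_vector_derivative_vector_3) (auto intro!: derivative_eq_intros)
  then show ?thesis
    unfolding x0''_def vector_derivative_at[OF 1]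
    by (simp add: vector_derivative_at x0_def vec_eq_iff forall_3)
qed

definition F_map :: "real \<Rightarrow> real \<Rightarrow> H2 \<Rightarrow> real \<Rightarrow> real^3" where
  "F_map R lam u \<eta> = cross3 (x0 R \<eta>) (D2 u \<eta>) + cross3 (rep_H2 u \<eta>) (x0'' R \<eta>)
     + cross3 (rep_H2 u \<eta>) (D2 u \<eta>) - lam *\<^sub>R cross3 e3 (rep_H2 u \<eta>) + lam *\<^sub>R D1 u \<eta>"

definition C_map :: "real \<Rightarrow> H2 \<Rightarrow> real \<Rightarrow> real" where
  "C_map R u \<eta> = x0 R \<eta> \<bullet> rep_H2 u \<eta> + (norm (rep_H2 u \<eta>))\<^sup>2 / 2"

text \<open>\<open>F_map\<close> vanishes as an element of $L^2(\mathbb T,\mathbb R^3)$, hence the almost everywhere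
  quantifier; \<open>C_map\<close> is continuous.\<close>

definition zero_set :: "real \<Rightarrow> (real \<times> H2) set" where
  "zero_set R = {(lam, u). 0 < lam \<and>
     (AE \<eta> in lborel. \<eta> \<in> {0..2*pi} \<longrightarrow> F_map R lam u \<eta> = 0) \<and> (\<forall>\<eta>. C_map R u \<eta> = 0)}"

definition orbit :: "real \<Rightarrow> H2 \<Rightarrow> real \<Rightarrow> real^3" where
  "orbit R u \<eta> = x0 R \<eta> + rep_H2 u \<eta>"

definition orbit' :: "real \<Rightarrow> H2 \<Rightarrow> real \<Rightarrow> real^3" where
  "orbit' R u \<eta> = vector_derivative (orbit R u) (at \<eta>)"

definition conserved_C :: "real \<Rightarrow> real \<Rightarrow> H2 \<Rightarrow> real \<Rightarrow> real" where
  "conserved_C R lam u \<eta> = cross3 (orbit R u \<eta>) (orbit' R u \<eta>) $ 3 + lam * orbit R u \<eta> $ 3"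

definition conserved_E :: "real \<Rightarrow> real \<Rightarrow> H2 \<Rightarrow> real \<Rightarrow> real" where
  "conserved_E R lam u \<eta> = lam / 2 * (norm (orbit' R u \<eta>))\<^sup>2
     + lam * (orbit R u \<eta> $ 2 * orbit' R u \<eta> $ 1 - orbit R u \<eta> $ 1 * orbit' R u \<eta> $ 2)"

text \<open>On \<open>zero_set R\<close> the two quantities do not depend on \<open>\<eta>\<close>, so they are evaluated at \<open>0\<close>.\<close>

definition vertical_poly :: "real \<Rightarrow> real \<Rightarrow> H2 \<Rightarrow> real \<Rightarrow> real" where
  "vertical_poly R lam u s =
     (let C = conserved_C R lam u 0;
          E = conserved_E R lam u 0;
          a0 = (2 * E * R\<^sup>2 - lam * C\<^sup>2 + 2 * lam * C * R\<^sup>2) / (lam * R\<^sup>2);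
          a1 = (2 * lam * C - 2 * lam * R\<^sup>2) / R\<^sup>2;
          a2 = (2 * E + lam^3 + 2 * lam * C) / (lam * R\<^sup>2);
          a3 = 2 * lam / R\<^sup>2
      in a3 * s^3 - a2 * s\<^sup>2 + a1 * s + a0)"

definition is_minimum :: "(real \<Rightarrow> real) \<Rightarrow> real \<Rightarrow> bool" where
  "is_minimum f m \<longleftrightarrow> m \<in> range f \<and> (\<forall>\<eta>. m \<le> f \<eta>)"

definition is_maximum :: "(real \<Rightarrow> real) \<Rightarrow> real \<Rightarrow> bool" where
  "is_maximum f m \<longleftrightarrow> m \<in> range f \<and> (\<forall>\<eta>. f \<eta> \<le> m)"

definition x3 :: "real \<Rightarrow> H2 \<Rightarrow> real \<Rightarrow> real" where
  "x3 R u \<eta> = orbit R u \<eta> $ 3"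

definition Z_reg :: "real \<Rightarrow> (real \<times> H2) set" where
  "Z_reg R = {(lam, u) \<in> zero_set R.
     (\<forall>\<eta>. - R < x3 R u \<eta> \<and> x3 R u \<eta> < R) \<and>
     \<not> (\<exists>c. \<forall>\<eta>. x3 R u \<eta> = c) \<and>
     (\<exists>r1 r2 r3. is_minimum (x3 R u) r1 \<and> is_maximum (x3 R u) r2 \<and>
        - R < r1 \<and> r1 < r2 \<and> r2 < R \<and> r2 < r3 \<and>
        (\<forall>s. vertical_poly R lam u s = 2 * lam / R\<^sup>2 * (s - r1) * (s - r2) * (s - r3)))}"

definition horizontal_degree :: "real \<Rightarrow> H2 \<Rightarrow> real" where
  "horizontal_degree R u = 1 / (2*pi) *
     (LBINT \<eta>:{0..2*pi}.
        (orbit R u \<eta> $ 1 * orbit' R u \<eta> $ 2 - orbit R u \<eta> $ 2 * orbit' R u \<eta> $ 1)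
        / ((orbit R u \<eta> $ 1)\<^sup>2 + (orbit R u \<eta> $ 2)\<^sup>2))"

definition minimal_period :: "(real \<Rightarrow> real) \<Rightarrow> real \<Rightarrow> bool" where
  "minimal_period f T \<longleftrightarrow> 0 < T \<and> (\<forall>\<eta>. f (\<eta> + T) = f \<eta>) \<and>
     (\<forall>T'. 0 < T' \<and> (\<forall>\<eta>. f (\<eta> + T') = f \<eta>) \<longrightarrow> T \<le> T')"

text \<open>\<open>vertical_nodal_number R u q\<close> reads ``\<open>q\<close> is the vertical nodal number''; a relation is used
  because the number exists only for nonconstant \<open>x3\<close>.\<close>

definition vertical_nodal_number :: "real \<Rightarrow> H2 \<Rightarrow> nat \<Rightarrow> bool" where
  "vertical_nodal_number R u q \<longleftrightarrow> q \<ge> 1 \<and> minimal_period (x3 R u) (2*pi / real q)"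

definition ext_boundary :: "real \<Rightarrow> (real \<times> H2) set" where
  "ext_boundary R = (top_of_set ({0..} \<times> UNIV)) closure_of (Z_reg R) - Z_reg R"

definition relatively_compact_in :: "'a::topological_space set \<Rightarrow> 'a set \<Rightarrow> bool" where
  "relatively_compact_in A M \<longleftrightarrow> compactin (top_of_set M) ((top_of_set M) closure_of A)"

definition bif_value :: "real \<Rightarrow> nat \<Rightarrow> real" where
  "bif_value R k = R * sqrt ((real k)\<^sup>2 - 1)"

definition Y_rev :: "H2 set" where
  "Y_rev = {u. \<forall>\<eta>. vector [rep_H2 u (-\<eta>) $ 1, - rep_H2 u (-\<eta>) $ 2, rep_H2 u (-\<eta>) $ 3]
      = rep_H2 u \<eta>}"

lift_definition kernel_mode :: "nat \<Rightarrow> H2" is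
  "\<lambda>k \<eta>. sin (real k * \<eta>) *\<^sub>R vector [- sin \<eta>, cos \<eta>, 0]
     - (real k / sqrt ((real k)\<^sup>2 - 1) * cos (real k * \<eta>)) *\<^sub>R e3"
proof -
  fix k :: nat
  define n where "n = real k"
  define c where "c = real k / sqrt ((real k)\<^sup>2 - 1)"
  define f where "f = (\<lambda>\<eta>. vector [- (sin (n * \<eta>) * sin \<eta>), sin (n * \<eta>) * cos \<eta>,
    - (c * cos (n * \<eta>))] :: real^3)"
  define f' where "f' = (\<lambda>\<eta>. vector [- (n * cos (n * \<eta>) * sin \<eta> + sin (n * \<eta>) * cos \<eta>),
    n * cos (n * \<eta>) * cos \<eta> - sin (n * \<eta>) * sin \<eta>, c * n * sin (n * \<eta>)] :: real^3)"
  define f'' where "f'' = (\<lambda>\<eta>. vector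
    [n * n * sin (n * \<eta>) * sin \<eta> - 2 * n * cos (n * \<eta>) * cos \<eta> + sin (n * \<eta>) * sin \<eta>,
     - (n * n * sin (n * \<eta>) * cos \<eta>) - 2 * n * cos (n * \<eta>) * sin \<eta> - sin (n * \<eta>) * cos \<eta>,
     c * n * n * cos (n * \<eta>)] :: real^3)"
  have "H2_fun f"
  proof (rule H2_fun_C2)
    fix t
    have "n * (t + 2 * pi) = n * t + 2 * real k * pi" by (simp add: n_def algebra_simps)
    then show "f (t + 2*pi) = f t"
      by (simp add: f_def sin_add cos_add sin_2npi cos_2npi)
    show "(f has_vector_derivative f' t) (at t)"
      unfolding f_def f'_def
      by (rule has_vector_derivative_vector_3) (auto intro!: derivative_eq_intros)
    show "(f' has_vector_derivative f'' t) (at t)"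
      unfolding f'_def f''_def
      by (rule has_vector_derivative_vector_3)
        (auto intro!: derivative_eq_intros simp: algebra_simps)
  next
    show "continuous_on UNIV f''"
      unfolding f''_def vector_3_scaleR by (intro continuous_intros)
  qed
  also have "f = (\<lambda>\<eta>. sin (real k * \<eta>) *\<^sub>R vector [- sin \<eta>, cos \<eta>, 0]
     - (real k / sqrt ((real k)\<^sup>2 - 1) * cos (real k * \<eta>)) *\<^sub>R e3)"
    by (simp add: f_def fun_eq_iff vec_eq_iff forall_3 e3_def n_def c_def)
  finally show "H2_fun (\<lambda>\<eta>. sin (real k * \<eta>) *\<^sub>R vector [- sin \<eta>, cos \<eta>, 0]
     - (real k / sqrt ((real k)\<^sup>2 - 1) * cos (real k * \<eta>)) *\<^sub>R e3)" .
qed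

definition smooth_curve_on :: "real set \<Rightarrow> (real \<Rightarrow> 'a::real_normed_vector) \<Rightarrow> bool" where
  "smooth_curve_on I f \<longleftrightarrow> (\<exists>D. D 0 = f \<and>
     (\<forall>n. \<forall>t\<in>I. (D n has_vector_derivative D (Suc n) t) (at t)))"

definition branch :: "nat \<Rightarrow> (real \<Rightarrow> H2) \<Rightarrow> real \<Rightarrow> H2" where
  "branch k \<Gamma> t = t *\<^sub>R (kernel_mode k + \<Gamma> t)"

text \<open>The curve of nontrivial reversible zeros emanating from \<open>(bif_value R k, 0)\<close>, given by its
  data \<open>\<delta>\<close>, \<open>\<Lambda>\<close>, \<open>\<Gamma>\<close>. The set identity says that in a neighbourhood \<open>U\<close> the reversible zeros are
  exactly the trivial ones and those on the curve; orthogonality is that of $H^2$.\<close>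

definition local_branch ::
    "real \<Rightarrow> nat \<Rightarrow> real \<Rightarrow> (real \<Rightarrow> real) \<Rightarrow> (real \<Rightarrow> H2) \<Rightarrow> bool" where
  "local_branch R k \<delta> \<Lambda> \<Gamma> \<longleftrightarrow> 0 < \<delta> \<and>
     smooth_curve_on {-\<delta><..<\<delta>} \<Lambda> \<and> smooth_curve_on {-\<delta><..<\<delta>} \<Gamma> \<and>
     \<Lambda> 0 = bif_value R k \<and> \<Gamma> 0 = 0 \<and>
     (\<forall>t\<in>{-\<delta><..<\<delta>}. 0 < \<Lambda> t \<and> branch k \<Gamma> t \<in> Y_rev \<and> \<Gamma> t \<bullet> kernel_mode k = 0) \<and>
     (\<exists>U. open U \<and> (bif_value R k, 0) \<in> U \<and>
        U \<inter> zero_set R \<inter> (UNIV \<times> Y_rev) =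
        U \<inter> ({0<..} \<times> {0} \<union> (\<lambda>t. (\<Lambda> t, branch k \<Gamma> t)) ` {-\<delta><..<\<delta>}))"

definition rot3 :: "real \<Rightarrow> real^3 \<Rightarrow> real^3" where
  "rot3 \<phi> v = vector [cos \<phi> * v $ 1 - sin \<phi> * v $ 2, sin \<phi> * v $ 1 + cos \<phi> * v $ 2, v $ 3]"

definition phase_translate :: "real \<Rightarrow> H2 \<Rightarrow> H2 \<Rightarrow> bool" where
  "phase_translate \<phi> u w \<longleftrightarrow> (\<forall>\<eta>. rep_H2 w \<eta> = rot3 \<phi> (rep_H2 u (\<eta> - \<phi>)))"

end

theory Submission
  imports Defs "HOL-Complex_Analysis.Great_Picard"
begin

text \<open>On the zero set the equation can be solved for the second derivative, so zeros are classical
  solutions with bounded data: \<open>C\<close>, \<open>E\<close> and the cubic for \<open>u = x3\<close> follow. On the regular class the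
  pair \<open>(u - m, u' / h)\<close>, where \<open>m\<close> is the midpoint of the two lower roots and \<open>h\<close> the square root of
  the remaining linear factor of the cubic, runs on a circle with angular speed \<open>h\<close>. Hence \<open>q\<close> is
  the mean of \<open>h\<close>, as \<open>p\<close> is the mean of the angular speed of the horizontal projection. Both means
  are continuous in the \<open>C\<^sup>1\<close> topology, up to the point \<open>(bif_value R k, 0)\<close>, where they equal \<open>k\<close> and \<open>1\<close>.
  Being integers, they are constant on components.

  A bound on \<open>lam\<close> together with \<open>q = k\<close> bounds the coefficient of \<open>u\<^sup>2\<close> in the cubic, hence the
  speed; Arzela-Ascoli and the differential equation then give precompactness of the component in
  \<open>H2\<close>. If it is not relatively compact as in (i), either \<open>lam\<close> is unbounded or the closure leaves
  the regular class at another point.\<close>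

section \<open>Periodic functions\<close>

text \<open>The equation sees \<open>x''\<close> only through \<open>x \<times> x''\<close>, and
  only almost everywhere. This is enough to differentiate \<open>x \<times> x'\<close> at every
  point, and \<open>x' = (x \<times> x') \<times> x / R^2\<close> transfers the regularity to
  \<open>x'\<close>. From then on the chosen representative \<open>D2\<close> no longer matters.

  The limit at \<open>(bif_value R k, 0)\<close> is degenerate: \<open>x3\<close> is constant there,
  so it has no minimal period and the point is outside the regular class. The third root is
  therefore eliminated by Vieta: the sum of the roots is read off the quadratic coefficient, and the
  two lower roots are the minimum and maximum of \<open>x3\<close>. The resulting integral makes
  sense on the whole zero set. At a trivial solution its integrand is
  \<open>sqrt (1 + lam^2 / R^2)\<close>, which equals \<open>k\<close> exactly when
  \<open>lam = bif_value R k\<close>.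

  Compactness must allow \<open>lam\<close> to tend to \<open>0\<close>, where the limit is no
  longer in \<open>zero_set\<close>; hence limits are built in the ambient space and only then
  compared with the extended boundary.\<close>

lemma periodic_shift_int:
  fixes f :: "real \<Rightarrow> 'a"
  assumes "\<And>t. f (t + 2*pi) = f t"
  shows "f (t + 2*pi * of_int n) = f t"
proof -
  interpret periodic_fun_simple f "2*pi" by standard (rule assms)
  show ?thesis using plus_of_int[of t n] by (simp add: mult.commute)
qed

lemma shift_into_period:
  obtains n :: int where "t + 2*pi * of_int n \<in> {0..2*pi}"
proof
  define n where "n = \<lfloor>t / (2*pi)\<rfloor>"
  have "real_of_int n \<le> t / (2*pi)" "t / (2*pi) < real_of_int n + 1"
    unfolding n_def by linarith+
  then show "t + 2*pi * of_int (- n) \<in> {0..2*pi}" by (auto simp: field_simps)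
qed

lemma has_vector_derivative_shift_const:
  fixes f :: "real \<Rightarrow> 'a::real_normed_vector"
  assumes "(f has_vector_derivative d) (at (t + c) within (\<lambda>s. s + c) ` S)"
  shows "((\<lambda>s. f (s + c)) has_vector_derivative d) (at t within S)"
proof -
  have "((\<lambda>s. s + c) has_vector_derivative 1) (at t within S)"
    by (auto intro!: derivative_eq_intros)
  from vector_diff_chain_within[OF this assms] show ?thesis by (simp add: o_def)
qed

text \<open>The quotient form turns one-sided derivatives into limits, which can be glued over a
  union of sets, and it allows product rules to be proved by limits of products.\<close>

lemma has_vector_derivative_quotient:
  fixes f :: "real \<Rightarrow> 'a::real_normed_vector"
  shows "(f has_vector_derivative d) (at t within S) \<longleftrightarrow>
     ((\<lambda>y. (f y - f t) /\<^sub>R (y - t)) \<longlongrightarrow> d) (at t within S)"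
proof -
  have "((\<lambda>y. norm (f y - f t - (y - t) *\<^sub>R d) / norm (y - t)) \<longlongrightarrow> 0) (at t within S) \<longleftrightarrow>
        ((\<lambda>y. norm ((f y - f t) /\<^sub>R (y - t) - d)) \<longlongrightarrow> 0) (at t within S)"
  proof (rule Lim_cong_within)
    fix y :: real assume "y \<noteq> t"
    then have "(f y - f t) /\<^sub>R (y - t) - d = (f y - f t - (y - t) *\<^sub>R d) /\<^sub>R (y - t)"
      by (simp add: scaleR_diff_right)
    then show "norm (f y - f t - (y - t) *\<^sub>R d) / norm (y - t) = norm ((f y - f t) /\<^sub>R (y - t) - d)"
      by (simp add: divide_inverse mult.commute)
  qed auto
  also have "\<dots> \<longleftrightarrow> ((\<lambda>y. (f y - f t) /\<^sub>R (y - t)) \<longlongrightarrow> d) (at t within S)"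
    by (simp add: tendsto_norm_zero_iff LIM_zero_iff)
  finally show ?thesis
    by (simp add: has_vector_derivative_def has_derivative_iff_norm bounded_linear_scaleR_left)
qed

text \<open>Only the endpoints are delicate, since one-sided derivatives are all that is given
  there. The left derivative at \<open>2*pi\<close>, moved by one period, is a left derivative at
  \<open>0\<close> and is glued to the right derivative at \<open>0\<close>.\<close>

lemma has_vector_derivative_periodic:
  fixes f g :: "real \<Rightarrow> 'a::real_normed_vector"
  assumes f: "\<And>t. f (t + 2*pi) = f t" and g: "\<And>t. g (t + 2*pi) = g t"
    and d: "\<And>t. t \<in> {0..2*pi} \<Longrightarrow> (f has_vector_derivative g t) (at t within {0..2*pi})"
  shows "(f has_vector_derivative g t) (at t)"
proof -
  have zero: "(f has_vector_derivative g 0) (at 0)"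
  proof -
    have right: "(f has_vector_derivative g 0) (at 0 within {0..2*pi})"
      using d[of 0] by simp
    have im: "(\<lambda>s. s + 2*pi) ` {-2*pi..0} = {0..2*pi}"
      by (simp add: image_add_atLeastAtMost')
    have "(f has_vector_derivative g 0) (at (0 + 2*pi) within (\<lambda>s. s + 2*pi) ` {-2*pi..0})"
      using d[of "2*pi"] g[of 0] unfolding im by simp
    from has_vector_derivative_shift_const[OF this]
    have left: "(f has_vector_derivative g 0) (at 0 within {-2*pi..0})" by (simp add: f)
    have "(f has_vector_derivative g 0) (at 0 within {-2*pi..0} \<union> {0..2*pi})"
      using left right unfolding has_vector_derivative_quotient Lim_within_Un by blast
    moreover have "{-2*pi..0} \<union> {0..2*pi} = {-2*pi..2*pi}" using pi_gt_zero by auto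
    moreover have "at (0::real) within {-2*pi..2*pi} = at 0"
      by (rule at_within_interior) (simp add: interior_atLeastAtMost_real)
    ultimately show ?thesis by simp
  qed
  have inner: "(f has_vector_derivative g s) (at s)" if "s \<in> {0..2*pi}" for s
  proof -
    consider "s = 0" | "s = 2*pi" | "s \<in> {0<..<2*pi}" using \<open>s \<in> {0..2*pi}\<close> by fastforce
    then show ?thesis
    proof cases
      case 1
      with zero show ?thesis by simp
    next
      case 2
      have p: "f (x - 2*pi) = f x" for x using f[of "x - 2*pi"] by simp
      have "((\<lambda>x. f (x + - (2*pi))) has_vector_derivative g 0) (at (2*pi))"
        by (rule has_vector_derivative_shift_const) (use has_vector_derivative_at_within[OF zero] in simp)
      then show ?thesis using 2 p g[of 0] by simp
    next
      case 3
      with d[of s] show ?thesis by (simp add: at_within_Icc_at)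
    qed
  qed
  obtain n where n: "t + 2*pi * of_int n \<in> {0..2*pi}" by (rule shift_into_period)
  have "((\<lambda>x. f (x + 2*pi * of_int n)) has_vector_derivative g (t + 2*pi * of_int n)) (at t)"
    by (rule has_vector_derivative_shift_const)
      (rule has_vector_derivative_at_within[OF inner[OF n]])
  then show ?thesis by (simp add: periodic_shift_int[of f, OF f] periodic_shift_int[of g, OF g])
qed

lemma rep_H2_periodic: "rep_H2 u (t + 2*pi) = rep_H2 u t"
  using H2_fun_rep[of u] by (simp add: H2_fun_def)

lemma D1_periodic: "D1 u (t + 2*pi) = D1 u t"
proof -
  have "((\<lambda>s. rep_H2 u (s + 2*pi)) has_vector_derivative D1 u (t + 2*pi)) (at t)"
    by (rule has_vector_derivative_shift_const)
      (rule has_vector_derivative_at_within[OF has_vector_derivative_D1])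
  then have "(rep_H2 u has_vector_derivative D1 u (t + 2*pi)) (at t)"
    by (simp add: rep_H2_periodic)
  then show ?thesis using has_vector_derivative_D1 vector_derivative_unique_at by blast
qed

section \<open>The Sobolev embedding\<close>

lemma D2_integrable_on: "D2 u integrable_on {0..2*pi}" "(\<lambda>t. norm (D2 u t)) integrable_on {0..2*pi}"
proof -
  have i: "set_integrable lborel {0..2*pi} (D2 u)"
    by (rule L2_2pi_set_integrable[OF L2_2pi_D2 order_refl])
  then show "D2 u integrable_on {0..2*pi}" by (rule set_borel_integral_eq_integral)
  show "(\<lambda>t. norm (D2 u t)) integrable_on {0..2*pi}"
    by (rule set_borel_integral_eq_integral) (rule set_integrable_norm[OF i])
qed

lemma D1_eq_Henstock_integral:
  assumes "t \<in> {0..2*pi}"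
  shows "D1 u t = D1 u 0 + integral {0..t} (D2 u)"
proof -
  have "set_integrable lborel {0..t} (D2 u)"
    using assms by (intro L2_2pi_set_integrable[OF L2_2pi_D2]) auto
  then show ?thesis
    using D1_eq_integral_D2[OF assms] set_borel_integral_eq_integral(2)[of "{0..t}" "D2 u"] by simp
qed

text \<open>From \<open>norm g \<le> 1 + (norm g)^2\<close> the function \<open>F\<close> differs
  from \<open>F 0\<close> by at most \<open>B = 2*pi + 1\<close>. If \<open>norm (F 0)\<close>
  exceeded \<open>1 + B\<close>, then \<open>norm F\<close> would be at least \<open>1\<close>
  everywhere and the integral of its square at least \<open>2*pi\<close>, which is too large. The
  bound is thus \<open>1 + 2 * B\<close>.\<close>

lemma norm_le_of_L2_bounds:
  fixes F g :: "real \<Rightarrow> real^3"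
  assumes c: "continuous_on {0..2*pi} F"
    and F: "\<And>t. t \<in> {0..2*pi} \<Longrightarrow> F t = F 0 + integral {0..t} g"
    and g: "g integrable_on {0..2*pi}" "(\<lambda>t. norm (g t)) integrable_on {0..2*pi}"
    and g2: "(\<lambda>t. (norm (g t))\<^sup>2) integrable_on {0..2*pi}" "integral {0..2*pi} (\<lambda>t. (norm (g t))\<^sup>2) \<le> 1"
    and F2: "integral {0..2*pi} (\<lambda>t. (norm (F t))\<^sup>2) \<le> 1"
    and t: "t \<in> {0..2*pi}"
  shows "norm (F t) \<le> 1 + 4*pi + 2"
proof -
  define B where "B = 2*pi + (1::real)"
  have gB: "integral {0..2*pi} (\<lambda>t. norm (g t)) \<le> B"
  proof -
    have "integral {0..2*pi} (\<lambda>t. norm (g t)) \<le> integral {0..2*pi} (\<lambda>t. 1 + (norm (g t))\<^sup>2)"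
    proof (rule integral_le)
      show "norm (g t) \<le> 1 + (norm (g t))\<^sup>2" for t
        using sum_squares_bound[of 1 "norm (g t)"] by simp (smt (verit) norm_ge_zero)
    qed (intro integrable_add g2 g integrable_const_ivl)+
    also have "\<dots> = 2*pi + integral {0..2*pi} (\<lambda>t. (norm (g t))\<^sup>2)"
      by (subst integral_add) (use g2 in auto)
    finally show ?thesis using g2(2) by (simp add: B_def)
  qed
  have osc: "norm (F s - F 0) \<le> B" if "s \<in> {0..2*pi}" for s
  proof -
    have sub: "{0..s} \<subseteq> {0..2*pi}" using that by auto
    have "norm (integral {0..s} g) \<le> integral {0..s} (\<lambda>t. norm (g t))"
      by (intro integral_norm_bound_integral integrable_on_subinterval[OF g(1) sub]
          integrable_on_subinterval[OF g(2) sub]) auto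
    also have "\<dots> \<le> integral {0..2*pi} (\<lambda>t. norm (g t))"
      by (intro integral_subset_le sub g integrable_on_subinterval[OF g(2) sub]) auto
    finally show ?thesis using F[OF that] gB by simp
  qed
  have "norm (F 0) \<le> 1 + B"
  proof (rule ccontr)
    assume "\<not> norm (F 0) \<le> 1 + B"
    then have "1 \<le> norm (F s)" if "s \<in> {0..2*pi}" for s
      using osc[OF that] norm_triangle_ineq2[of "F 0" "F s"] by (simp add: norm_minus_commute)
    then have "1 \<le> (norm (F s))\<^sup>2" if "s \<in> {0..2*pi}" for s
      using that by (simp add: one_le_power)
    then have "integral {0..2*pi} (\<lambda>s. 1::real) \<le> integral {0..2*pi} (\<lambda>s. (norm (F s))\<^sup>2)"
      by (intro integral_le integrable_continuous_real continuous_intros c) auto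
    then show False using F2 pi_gt3 by simp
  qed
  then show ?thesis
    using osc[OF t] norm_triangle_ineq2[of "F t" "F 0"] by (simp add: B_def)
qed

lemma H2_L2_norms_le:
  "integral {0..2*pi} (\<lambda>t. (norm (rep_H2 u t))\<^sup>2) \<le> (norm u)\<^sup>2"
  "integral {0..2*pi} (\<lambda>t. (norm (D1 u t))\<^sup>2) \<le> (norm u)\<^sup>2"
  "integral {0..2*pi} (\<lambda>t. (norm (D2 u t))\<^sup>2) \<le> (norm u)\<^sup>2"
  "(\<lambda>t. (norm (D2 u t))\<^sup>2) integrable_on {0..2*pi}"
proof -
  let ?f = "\<lambda>t. (norm (rep_H2 u t))\<^sup>2 + (norm (D1 u t))\<^sup>2 + (norm (D2 u t))\<^sup>2"
  have i2: "set_integrable lborel {0..2*pi} (\<lambda>t. (norm (D2 u t))\<^sup>2)"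
    using L2_2pi_D2[of u] by (simp add: L2_2pi_def)
  have int: "set_integrable lborel {0..2*pi} ?f"
    using H2_inner_integrable[of u u] by (simp add: power2_norm_eq_inner)
  have n: "(norm u)\<^sup>2 = integral {0..2*pi} ?f"
    using set_borel_integral_eq_integral(2)[OF int]
    by (simp add: power2_norm_eq_inner inner_H2_def)
  note I = set_borel_integral_eq_integral(1)
  show d2: "(\<lambda>t. (norm (D2 u t))\<^sup>2) integrable_on {0..2*pi}" by (rule I[OF i2])
  have c: "(\<lambda>t. (norm (rep_H2 u t))\<^sup>2) integrable_on {0..2*pi}"
    "(\<lambda>t. (norm (D1 u t))\<^sup>2) integrable_on {0..2*pi}"
    by (intro integrable_continuous_real continuous_intros continuous_on_rep_H2 continuous_on_D1)+
  show "integral {0..2*pi} (\<lambda>t. (norm (rep_H2 u t))\<^sup>2) \<le> (norm u)\<^sup>2"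
    unfolding n by (rule integral_le[OF c(1) I[OF int]]) simp
  show "integral {0..2*pi} (\<lambda>t. (norm (D1 u t))\<^sup>2) \<le> (norm u)\<^sup>2"
    unfolding n by (rule integral_le[OF c(2) I[OF int]]) simp
  show "integral {0..2*pi} (\<lambda>t. (norm (D2 u t))\<^sup>2) \<le> (norm u)\<^sup>2"
    unfolding n by (rule integral_le[OF d2 I[OF int]]) simp
qed

lemma rep_H2_eq_integral_D1:
  assumes "t \<in> {0..2*pi}"
  shows "rep_H2 u t = rep_H2 u 0 + integral {0..t} (D1 u)"
proof -
  have "(D1 u has_integral (rep_H2 u t - rep_H2 u 0)) {0..t}"
    using assms
    by (intro fundamental_theorem_of_calculus) (auto intro: has_vector_derivative_at_within[OF has_vector_derivative_D1])
  then show ?thesis by (simp add: integral_unique)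
qed

text \<open>Homogeneity reduces the claim to unit vectors, for which the previous estimate is
  applied twice: to \<open>u\<close> with derivative \<open>D1 u\<close>, and to \<open>D1 u\<close>
  with derivative \<open>D2 u\<close>.\<close>

lemma H2_sup_bound:
  obtains K where "K > 0" "\<And>u t. norm (rep_H2 u t) \<le> K * norm u" "\<And>u t. norm (D1 u t) \<le> K * norm u"
proof
  define K where "K = 1 + 4*pi + (2::real)"
  show K: "K > 0" using pi_gt_zero unfolding K_def by linarith
  have unit: "norm (rep_H2 u t) \<le> K" "norm (D1 u t) \<le> K" if u: "norm u = 1" and t: "t \<in> {0..2*pi}" for u t
  proof -
    have cD: "continuous_on {0..2*pi} (\<lambda>t. norm (D1 u t))" "continuous_on {0..2*pi} (\<lambda>t. (norm (D1 u t))\<^sup>2)"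
      by (intro continuous_intros continuous_on_D1)+
    show "norm (rep_H2 u t) \<le> K"
      unfolding K_def
      by (rule norm_le_of_L2_bounds[OF continuous_on_rep_H2 rep_H2_eq_integral_D1
            integrable_continuous_real[OF continuous_on_D1] integrable_continuous_real[OF cD(1)]
            integrable_continuous_real[OF cD(2)]])
        (use H2_L2_norms_le[of u] u t in auto)
    show "norm (D1 u t) \<le> K"
      unfolding K_def
      by (rule norm_le_of_L2_bounds[OF continuous_on_D1 D1_eq_Henstock_integral D2_integrable_on[of u]])
        (use H2_L2_norms_le[of u] u t in auto)
  qed
  have key: "norm (rep_H2 u t) \<le> K * norm u \<and> norm (D1 u t) \<le> K * norm u" for u t
  proof -
    obtain n where n: "t + 2*pi * of_int n \<in> {0..2*pi}" by (rule shift_into_period)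
    define s where "s = t + 2*pi * of_int n"
    have s: "rep_H2 u t = rep_H2 u s" "D1 u t = D1 u s" "s \<in> {0..2*pi}"
      using n periodic_shift_int[of "rep_H2 u"] periodic_shift_int[of "D1 u"] rep_H2_periodic D1_periodic
      by (auto simp: s_def)
    show ?thesis
    proof (cases "u = 0")
      case True
      then show ?thesis using D1_scaleR[of 0 u t] by (simp add: zero_H2.rep_eq)
    next
      case False
      define v where "v = u /\<^sub>R norm u"
      have v: "norm v = 1" "u = norm u *\<^sub>R v" using False by (simp_all add: v_def)
      have "rep_H2 u s = norm u *\<^sub>R rep_H2 v s" by (subst v(2)) (simp add: scaleR_H2.rep_eq)
      moreover have "D1 u s = norm u *\<^sub>R D1 v s" by (subst v(2)) (simp add: D1_scaleR)
      ultimately show ?thesis using unit[OF v(1) s(3)] s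
        by (simp add: mult.commute[of K] mult_left_mono)
    qed
  qed
  then show "norm (rep_H2 u t) \<le> K * norm u" "norm (D1 u t) \<le> K * norm u" for u t by blast+
qed

lemma D1_minus: "D1 (u - v) t = D1 u t - D1 v t"
  using D1_add[of "u - v" v t] by simp

lemma H2_tendsto_uniform:
  assumes "(f \<longlongrightarrow> u) F"
  shows "uniform_limit UNIV (\<lambda>n. rep_H2 (f n)) (rep_H2 u) F"
    and "uniform_limit UNIV (\<lambda>n. D1 (f n)) (D1 u) F"
proof -
  obtain K where K: "K > 0" "\<And>u t. norm (rep_H2 u t) \<le> K * norm u" "\<And>u t. norm (D1 u t) \<le> K * norm u"
    using H2_sup_bound by blast
  have ev: "\<forall>\<^sub>F n in F. K * norm (f n - u) < e" if "e > 0" for e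
  proof -
    have "\<forall>\<^sub>F n in F. dist (f n) u < e / K"
      using tendstoD[OF assms, of "e / K"] that K(1) by simp
    then show ?thesis
      by eventually_elim (simp add: dist_norm pos_less_divide_eq[OF K(1)] mult.commute)
  qed
  show "uniform_limit UNIV (\<lambda>n. rep_H2 (f n)) (rep_H2 u) F"
  proof (rule uniform_limitI)
    fix e :: real assume "e > 0"
    from ev[OF this] show "\<forall>\<^sub>F n in F. \<forall>x\<in>UNIV. dist (rep_H2 (f n) x) (rep_H2 u x) < e"
    proof eventually_elim
      case (elim n)
      have "norm (rep_H2 (f n) x - rep_H2 u x) \<le> K * norm (f n - u)" for x
        using K(2)[of "f n - u" x] by (simp add: minus_H2.rep_eq)
      with elim show ?case by (auto simp: dist_norm intro: order.strict_trans1)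
    qed
  qed
  show "uniform_limit UNIV (\<lambda>n. D1 (f n)) (D1 u) F"
  proof (rule uniform_limitI)
    fix e :: real assume "e > 0"
    from ev[OF this] show "\<forall>\<^sub>F n in F. \<forall>x\<in>UNIV. dist (D1 (f n) x) (D1 u x) < e"
    proof eventually_elim
      case (elim n)
      have "norm (D1 (f n) x - D1 u x) \<le> K * norm (f n - u)" for x
        using K(3)[of "f n - u" x] by (simp add: D1_minus)
      with elim show ?case by (auto simp: dist_norm intro: order.strict_trans1)
    qed
  qed
qed

section \<open>Zeros are classical solutions\<close>

interpretation cross3: bounded_bilinear cross3
  using bilinear_cross by (simp add: bilinear_conv_bounded_bilinear)

lemma norm_cross3_le: "norm (cross3 x y) \<le> norm x * norm y"
proof -
  have "(norm (cross3 x y))\<^sup>2 \<le> (norm x * norm y)\<^sup>2"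
    using norm_cross_dot[of x y] by (smt (verit) zero_le_power2)
  then show ?thesis by (rule power2_le_imp_le) simp
qed

text \<open>The factor \<open>v\<close> is only absolutely continuous, but the product rule holds at every point because
  the almost everywhere defined term has a continuous representative: \<open>x t \<times> (v y - v t)\<close> differs from the integral
  of \<open>G\<close> by at most \<open>L \<bar>y - t\<bar>\<close> times the integral of \<open>norm g\<close>.\<close>

lemma has_vector_derivative_cross3_AC:
  fixes x v g G :: "real \<Rightarrow> real^3"
  assumes x: "(x has_vector_derivative x') (at t within {a..b})"
    and lip: "\<And>s. s \<in> {a..b} \<Longrightarrow> norm (x t - x s) \<le> L * \<bar>s - t\<bar>" and L: "0 \<le> L"
    and v: "\<And>t. t \<in> {a..b} \<Longrightarrow> v t = v a + integral {a..t} g"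
    and g: "g integrable_on {a..b}" "(\<lambda>t. norm (g t)) integrable_on {a..b}"
    and G: "continuous_on {a..b} G"
    and ae: "AE t in lborel. t \<in> {a..b} \<longrightarrow> cross3 (x t) (g t) = G t"
    and t: "t \<in> {a..b}"
  shows "((\<lambda>s. cross3 (x s) (v s)) has_vector_derivative cross3 x' (v t) + G t) (at t within {a..b})"
proof -
  obtain N where N: "N \<in> null_sets lborel" "{s \<in> space lborel. \<not> (s \<in> {a..b} \<longrightarrow> cross3 (x s) (g s) = G s)} \<subseteq> N"
    using ae by (auto simp: eventually_ae_filter)
  have negl: "negligible N"
    using N(1) by (simp add: negligible_iff_null_sets null_sets_completionI)
  have GN: "cross3 (x s) (g s) = G s" if "s \<in> {a..b} - N" for s
    using that N(2) by auto
  define J where "J y = integral {a..y} G" for y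
  define V where "V y = integral {a..y} (\<lambda>s. norm (g s))" for y
  \<comment> \<open>\<open>K\<close> is \<open>x t \<times> v\<close> with a primitive of
    \<open>G\<close> subtracted, the base point \<open>t\<close> being frozen in the first factor.
    Its derivative at \<open>t\<close> will turn out to be zero.\<close>
  define K where "K y = cross3 (x t) (v y) - J y" for y
  have Gi: "G integrable_on {a..b}" by (rule integrable_continuous_real[OF G])
  have vc: "continuous_on {a..b} v"
  proof -
    have "continuous_on {a..b} (\<lambda>y. v a + integral {a..y} g)"
      by (intro continuous_intros indefinite_integral_continuous_1 g)
    then show ?thesis by (rule continuous_on_eq) (rule v[symmetric])
  qed
  \<comment> \<open>Off a null set \<open>G s = x s \<times> g s\<close>, so the increment of
    \<open>K\<close> is the integral of \<open>(x t - x s) \<times> g s\<close>. Bracketing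
    \<open>t\<close> between \<open>m\<close> and \<open>M\<close> lets one estimate serve the left
    and the right difference quotients.\<close>
  have bound: "norm (K M - K m) \<le> L * (M - m) * (V M - V m)"
    if m: "a \<le> m" "m \<le> t" "t \<le> M" "M \<le> b" for m M
  proof -
    have sub: "{m..M} \<subseteq> {a..b}" using m by auto
    have comb: "integral {m..M} f = integral {a..M} f - integral {a..m} f"
      if "f integrable_on {a..b}" for f :: "real \<Rightarrow> 'b::euclidean_space"
      using Henstock_Kurzweil_Integration.integral_combine[of a m M f]
        integrable_on_subinterval[OF that, of a M] m by (auto simp: algebra_simps)
    have gi: "g integrable_on {m..M}" "(\<lambda>t. norm (g t)) integrable_on {m..M}" "G integrable_on {m..M}"
      by (rule integrable_on_subinterval[OF _ sub], fact)+
    have ci: "(\<lambda>s. cross3 (x t) (g s)) integrable_on {m..M}"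
      using integrable_linear[OF gi(1) cross3.bounded_linear_right[of "x t"]] by (simp add: o_def)
    have "cross3 (x t) (integral {m..M} g) = integral {m..M} (\<lambda>s. cross3 (x t) (g s))"
      using integral_linear[OF gi(1) cross3.bounded_linear_right[of "x t"]] by (simp add: o_def)
    moreover have "K M - K m = cross3 (x t) (v M - v m) - (J M - J m)"
      by (simp add: K_def cross3.diff_right)
    moreover have "v M - v m = integral {m..M} g" "J M - J m = integral {m..M} G"
      using v[of M] v[of m] m comb[OF g(1)] comb[OF Gi] by (simp_all add: J_def)
    ultimately have "K M - K m = integral {m..M} (\<lambda>s. cross3 (x t) (g s)) - integral {m..M} G"
      by simp
    also have "\<dots> = integral {m..M} (\<lambda>s. cross3 (x t) (g s) - G s)"
      by (rule integral_diff[symmetric]) fact+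
    finally have KM: "K M - K m = integral {m..M} (\<lambda>s. cross3 (x t) (g s) - G s)" .
    have sp: "cross3 (x t - x s) (g s) = cross3 (x t) (g s) - G s" if "s \<in> {m..M} - N" for s
      using GN[of s] that sub by (auto simp: cross3.diff_left)
    have ii: "(\<lambda>s. cross3 (x t - x s) (g s)) integrable_on {m..M}"
      by (rule integrable_spike[OF integrable_diff[OF ci gi(3)] negl]) (rule sp)
    have "integral {m..M} (\<lambda>s. cross3 (x t) (g s) - G s) = integral {m..M} (\<lambda>s. cross3 (x t - x s) (g s))"
      by (rule integral_spike[OF negl]) (rule sp)
    then have "norm (K M - K m) = norm (integral {m..M} (\<lambda>s. cross3 (x t - x s) (g s)))"
      using KM by simp
    also have "\<dots> \<le> integral {m..M} (\<lambda>s. L * (M - m) * norm (g s))"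
    proof (rule integral_norm_bound_integral[OF ii])
      show "(\<lambda>s. L * (M - m) * norm (g s)) integrable_on {m..M}"
        using integrable_on_cmult_left[OF gi(2), of "L * (M - m)"] by simp
      fix s assume s: "s \<in> {m..M}"
      have "norm (cross3 (x t - x s) (g s)) \<le> norm (x t - x s) * norm (g s)" by (rule norm_cross3_le)
      also have "\<dots> \<le> L * \<bar>s - t\<bar> * norm (g s)"
        using lip[of s] s sub by (intro mult_right_mono) auto
      also have "\<dots> \<le> L * (M - m) * norm (g s)"
        using s m L by (intro mult_right_mono mult_left_mono) auto
      finally show "norm (cross3 (x t - x s) (g s)) \<le> L * (M - m) * norm (g s)" .
    qed
    also have "\<dots> = L * (M - m) * (V M - V m)" by (simp add: V_def comb[OF g(2)])
    finally show ?thesis .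
  qed
  have Vc: "(V \<longlongrightarrow> V t) (at t within {a..b})"
    using indefinite_integral_continuous_1[OF g(2)] t
    unfolding V_def continuous_on_def by blast
  have bound2: "norm ((K y - K t) /\<^sub>R (y - t)) \<le> L * \<bar>V y - V t\<bar>" if y: "y \<in> {a..b}" "y \<noteq> t" for y
  proof (cases "t \<le> y")
    case True
    then have "norm (K y - K t) \<le> L * (y - t) * (V y - V t)" using bound[of t y] t y by auto
    also have "\<dots> \<le> L * (y - t) * \<bar>V y - V t\<bar>" using L True by (intro mult_left_mono) auto
    finally have "norm (K y - K t) \<le> (L * \<bar>V y - V t\<bar>) * (y - t)" by (simp add: ac_simps)
    then show ?thesis using True y(2)
      by (simp add: divide_inverse[symmetric] mult.commute[of "inverse _"] pos_divide_le_eq)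
  next
    case False
    then have "norm (K t - K y) \<le> L * (t - y) * (V t - V y)" using bound[of y t] t y by auto
    also have "\<dots> \<le> L * (t - y) * \<bar>V y - V t\<bar>" using L False by (intro mult_left_mono) auto
    finally have "norm (K y - K t) \<le> (L * \<bar>V y - V t\<bar>) * (t - y)"
      by (simp add: ac_simps norm_minus_commute)
    then show ?thesis using False
      by (simp add: divide_inverse[symmetric] mult.commute[of "inverse _"] pos_divide_le_eq)
  qed
  have K0: "(K has_vector_derivative 0) (at t within {a..b})"
    unfolding has_vector_derivative_quotient
  proof (rule Lim_null_comparison)
    show "\<forall>\<^sub>F y in at t within {a..b}. norm ((K y - K t) /\<^sub>R (y - t)) \<le> L * \<bar>V y - V t\<bar>"
      using bound2 by (auto simp: eventually_at_filter)
    show "((\<lambda>y. L * \<bar>V y - V t\<bar>) \<longlongrightarrow> 0) (at t within {a..b})"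
      using tendsto_mult_right_zero[OF tendsto_rabs_zero[OF LIM_zero[OF Vc]]] by simp
  qed
  have J': "(J has_vector_derivative G t) (at t within {a..b})"
    unfolding J_def by (rule integral_has_vector_derivative[OF G t])
  have P: "((\<lambda>y. cross3 (x y - x t) (v y)) has_vector_derivative cross3 x' (v t)) (at t within {a..b})"
    unfolding has_vector_derivative_quotient
  proof -
    have "(v \<longlongrightarrow> v t) (at t within {a..b})" using vc t by (simp add: continuous_on_def)
    with x have "((\<lambda>y. cross3 ((x y - x t) /\<^sub>R (y - t)) (v y)) \<longlongrightarrow> cross3 x' (v t)) (at t within {a..b})"
      unfolding has_vector_derivative_quotient by (rule cross3.tendsto)
    then show "((\<lambda>y. (cross3 (x y - x t) (v y) - cross3 (x t - x t) (v t)) /\<^sub>R (y - t)) \<longlongrightarrow> cross3 x' (v t)) (at t within {a..b})"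
      by (simp add: cross3.scaleR_left)
  qed
  have "((\<lambda>y. cross3 (x y - x t) (v y) + (K y + J y)) has_vector_derivative cross3 x' (v t) + (0 + G t)) (at t within {a..b})"
    by (intro has_vector_derivative_add P K0 J')
  then show ?thesis by (simp add: K_def cross3.diff_left)
qed

section \<open>The equation for the orbit and its solution for the acceleration\<close>

definition x0' :: "real \<Rightarrow> real \<Rightarrow> real^3" where
  "x0' R \<eta> = vector [- (R * sin \<eta>), R * cos \<eta>, 0]"

lemma x0_has_vector_derivative: "(x0 R has_vector_derivative x0' R t) (at t)"
  unfolding x0_def[abs_def] x0'_def
  by (rule has_vector_derivative_vector_3) (auto intro!: derivative_eq_intros)

lemma x0'_has_vector_derivative: "(x0' R has_vector_derivative - x0 R t) (at t)"
proof -
  have "((\<lambda>s. vector [- (R * sin s), R * cos s, 0] :: real^3) has_vector_derivative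
      vector [- (R * cos t), - (R * sin t), 0]) (at t)"
    by (rule has_vector_derivative_vector_3) (auto intro!: derivative_eq_intros)
  moreover have "vector [- (R * cos t), - (R * sin t), 0] = - x0 R t"
    by (simp add: x0_def vec_eq_iff forall_3)
  ultimately show ?thesis by (simp add: x0'_def[abs_def])
qed

lemma x0_periodic: "x0 R (t + 2*pi) = x0 R t" "x0' R (t + 2*pi) = x0' R t"
  by (simp_all add: x0_def x0'_def)

lemma orbit_has_vector_derivative: "(orbit R u has_vector_derivative x0' R t + D1 u t) (at t)"
  unfolding orbit_def[abs_def]
  by (intro has_vector_derivative_add x0_has_vector_derivative has_vector_derivative_D1)

lemma orbit'_eq: "orbit' R u t = x0' R t + D1 u t"
  unfolding orbit'_def by (rule vector_derivative_at[OF orbit_has_vector_derivative])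

lemma orbit_deriv: "(orbit R u has_vector_derivative orbit' R u t) (at t)"
  unfolding orbit'_eq by (rule orbit_has_vector_derivative)

lemma orbit_periodic: "orbit R u (t + 2*pi) = orbit R u t"
  by (simp add: orbit_def x0_periodic rep_H2_periodic)

lemma orbit'_periodic: "orbit' R u (t + 2*pi) = orbit' R u t"
  by (simp add: orbit'_eq x0_periodic D1_periodic)

lemma continuous_on_orbit: "continuous_on S (orbit R u)"
  by (rule continuous_at_imp_continuous_on)
    (auto intro: has_vector_derivative_continuous[OF orbit_deriv])

lemma continuous_on_x0': "continuous_on S (x0' R)"
  by (rule continuous_at_imp_continuous_on)
    (auto intro: has_vector_derivative_continuous[OF x0'_has_vector_derivative])

lemma orbit'_eq_integral:
  assumes "t \<in> {0..2*pi}"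
  shows "orbit' R u t = orbit' R u 0 + integral {0..t} (\<lambda>s. - x0 R s + D2 u s)"
proof -
  have "((\<lambda>s. - x0 R s) has_integral (x0' R t - x0' R 0)) {0..t}"
    using assms by (intro fundamental_theorem_of_calculus)
      (auto intro: has_vector_derivative_at_within[OF x0'_has_vector_derivative])
  moreover have "(D2 u has_integral integral {0..t} (D2 u)) {0..t}"
    using assms by (intro integrable_integral integrable_on_subinterval[OF D2_integrable_on(1)]) auto
  ultimately have "((\<lambda>s. - x0 R s + D2 u s) has_integral
      (x0' R t - x0' R 0 + integral {0..t} (D2 u))) {0..t}"
    by (rule has_integral_add)
  then show ?thesis
    using D1_eq_Henstock_integral[OF assms, of u] by (simp add: orbit'_eq integral_unique)
qed

lemma C_map_orbit: "(orbit R u t) \<bullet> (orbit R u t) = R\<^sup>2 + 2 * C_map R u t"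
proof -
  have "x0 R t \<bullet> x0 R t = R\<^sup>2"
  proof -
    have "x0 R t \<bullet> x0 R t = R\<^sup>2 * ((cos t)\<^sup>2 + (sin t)\<^sup>2)"
      by (simp add: x0_def inner_vec_def sum_3 power2_eq_square distrib_left ac_simps
          del: sin_cos_squared_add sin_cos_squared_add2 sin_cos_squared_add3)
    then show ?thesis by simp
  qed
  then show ?thesis
    by (simp add: orbit_def C_map_def power2_norm_eq_inner inner_add_left inner_add_right inner_commute)
qed

text \<open>The terms missing from \<open>F_map\<close> vanish: \<open>x0 \<times> x0'' = 0\<close>
  because \<open>x0'' = - x0\<close>, and \<open>x0' = e3 \<times> x0\<close> balances the two terms
  with the factor \<open>lam\<close>.\<close>

lemma F_map_orbit:
  "F_map R lam u t = cross3 (orbit R u t) (- x0 R t + D2 u t)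
     - lam *\<^sub>R cross3 e3 (orbit R u t) + lam *\<^sub>R orbit' R u t"
  by (simp add: F_map_def orbit_def orbit'_eq x0''_eq x0_def x0'_def e3_def
      cross_components vec_eq_iff forall_3 algebra_simps)

text \<open>The value of \<open>x''\<close> forced by the equation and the constraint. It arises by
  differentiating \<open>v = (x \<times> v) \<times> x / R^2\<close>, valid for
  \<open>norm x = R\<close> and \<open>x\<close> orthogonal to \<open>v\<close>. Being polynomial in
  \<open>(lam, x, v)\<close>, it is jointly continuous.\<close>

definition accel :: "real \<Rightarrow> real \<Rightarrow> real^3 \<Rightarrow> real^3 \<Rightarrow> real^3" where
  "accel R lam x v = ((lam * x $ 3 - v \<bullet> v) *\<^sub>R x + lam *\<^sub>R cross3 x v - (lam * R\<^sup>2) *\<^sub>R e3) /\<^sub>R R\<^sup>2"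

lemma zero_set_sphere:
  assumes "(lam, u) \<in> zero_set R"
  shows "0 < lam" "orbit R u t \<bullet> orbit R u t = R\<^sup>2" "orbit R u t \<bullet> orbit' R u t = 0"
proof -
  show "0 < lam" using assms by (simp add: zero_set_def)
  show sq: "orbit R u t \<bullet> orbit R u t = R\<^sup>2" for t
    using assms by (simp add: zero_set_def C_map_orbit)
  have "((\<lambda>t. orbit R u t \<bullet> orbit R u t) has_vector_derivative
      (orbit R u t \<bullet> orbit' R u t + orbit' R u t \<bullet> orbit R u t)) (at t)"
    by (rule bounded_bilinear.has_vector_derivative[OF bounded_bilinear_inner orbit_deriv orbit_deriv])
  then have "orbit R u t \<bullet> orbit' R u t + orbit' R u t \<bullet> orbit R u t = 0"
    unfolding sq using vector_derivative_unique_at[OF has_vector_derivative_const] by metis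
  then show "orbit R u t \<bullet> orbit' R u t = 0" by (simp add: inner_commute)
qed

text \<open>By the product rule the derivative should be \<open>x \<times> x''\<close>, and the
  equation identifies this almost everywhere with a continuous function. That is the situation of
  \<open>has_vector_derivative_cross3_AC\<close>, with a bound on the speed over one period as the
  Lipschitz constant.\<close>

lemma orbit_cross_deriv:
  assumes z: "(lam, u) \<in> zero_set R"
  shows "((\<lambda>t. cross3 (orbit R u t) (orbit' R u t)) has_vector_derivative
    lam *\<^sub>R cross3 e3 (orbit R u t) - lam *\<^sub>R orbit' R u t) (at t)"
proof (rule has_vector_derivative_periodic)
  let ?G = "\<lambda>t. lam *\<^sub>R cross3 e3 (orbit R u t) - lam *\<^sub>R orbit' R u t"
  have c': "continuous_on {0..2*pi} (orbit' R u)"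
    unfolding orbit'_eq by (intro continuous_intros continuous_on_D1 continuous_on_x0')
  obtain B where B: "\<And>s. s \<in> {0..2*pi} \<Longrightarrow> norm (orbit' R u s) \<le> B"
    using compact_imp_bounded[OF compact_continuous_image[OF c' compact_Icc]]
    unfolding bounded_iff by (meson image_eqI)
  fix t :: real assume t: "t \<in> {0..2*pi}"
  have "((\<lambda>s. cross3 (orbit R u s) (orbit' R u s)) has_vector_derivative
      cross3 (orbit' R u t) (orbit' R u t) + ?G t) (at t within {0..2*pi})"
  proof (rule has_vector_derivative_cross3_AC[where L = B])
    show "(orbit R u has_vector_derivative orbit' R u t) (at t within {0..2*pi})"
      by (rule has_vector_derivative_at_within[OF orbit_deriv])
    show "0 \<le> B" using B[OF t] norm_ge_zero order_trans by blast
    show "norm (orbit R u t - orbit R u s) \<le> B * \<bar>s - t\<bar>" if "s \<in> {0..2*pi}" for s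
    proof -
      have "norm (orbit R u t - orbit R u s) \<le> B * norm (t - s)"
        by (rule differentiable_bound[of "{0..2*pi}" _ "\<lambda>s h. h *\<^sub>R orbit' R u s"])
          (use that t B orbit_deriv[unfolded has_vector_derivative_def, THEN has_derivative_at_withinI]
            in \<open>auto simp: onorm_scaleR_left onorm_id\<close>)
      then show ?thesis by (simp add: abs_minus_commute)
    qed
    show "orbit' R u s = orbit' R u 0 + integral {0..s} (\<lambda>s. - x0 R s + D2 u s)"
      if "s \<in> {0..2*pi}" for s by (rule orbit'_eq_integral[OF that])
    have L: "set_integrable lborel {0..2*pi} (\<lambda>s. - x0 R s + D2 u s)"
    proof (rule set_integral_add(1))
      have "continuous_on {0..2*pi} (x0 R)"
        by (rule continuous_at_imp_continuous_on)
          (auto intro: has_vector_derivative_continuous[OF x0_has_vector_derivative])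
      then show "set_integrable lborel {0..2*pi} (\<lambda>s. - x0 R s)"
        by (intro borel_integrable_atLeastAtMost' continuous_intros)
    qed (rule L2_2pi_set_integrable[OF L2_2pi_D2 order_refl])
    show "(\<lambda>s. - x0 R s + D2 u s) integrable_on {0..2*pi}"
      by (rule set_borel_integral_eq_integral(1)[OF L])
    show "(\<lambda>s. norm (- x0 R s + D2 u s)) integrable_on {0..2*pi}"
      by (rule set_borel_integral_eq_integral(1)[OF set_integrable_norm[OF L]])
    show "continuous_on {0..2*pi} ?G"
      by (intro continuous_intros c' continuous_on_cross continuous_on_orbit)
    show "AE s in lborel. s \<in> {0..2*pi} \<longrightarrow> cross3 (orbit R u s) (- x0 R s + D2 u s) = ?G s"
    proof -
      have "AE s in lborel. s \<in> {0..2*pi} \<longrightarrow> F_map R lam u s = 0"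
        using z by (simp add: zero_set_def)
      then show ?thesis
        by eventually_elim (auto simp: F_map_orbit algebra_simps)
    qed
  qed (rule t)
  then show "((\<lambda>s. cross3 (orbit R u s) (orbit' R u s)) has_vector_derivative ?G t) (at t within {0..2*pi})"
    by simp
qed (simp_all add: orbit_periodic orbit'_periodic)

lemma cross3_cross3_left: "cross3 (cross3 x v) y = (x \<bullet> y) *\<^sub>R v - (v \<bullet> y) *\<^sub>R x"
  by (simp add: vec_eq_iff forall_3 cross_components inner_vec_def sum_3 algebra_simps)

lemma inner_e3: "e3 \<bullet> x = x $ 3" "x \<bullet> e3 = x $ 3"
  by (simp_all add: e3_def inner_vec_def sum_3)

text \<open>On the sphere the velocity is recovered as
  \<open>(x \<times> x') \<times> x / R^2\<close>, a product of two functions already known to be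
  differentiable at every point.\<close>

lemma orbit'_deriv:
  assumes R: "R > 0" and z: "(lam, u) \<in> zero_set R"
  shows "(orbit' R u has_vector_derivative accel R lam (orbit R u t) (orbit' R u t)) (at t)"
proof -
  let ?x = "orbit R u" and ?v = "orbit' R u"
  note s = zero_set_sphere[OF z]
  have v: "?v = (\<lambda>t. cross3 (cross3 (?x t) (?v t)) (?x t) /\<^sub>R R\<^sup>2)"
    using R by (simp add: fun_eq_iff cross3_cross3_left s inner_commute[of "?v _"])
  have "((\<lambda>t. cross3 (cross3 (?x t) (?v t)) (?x t)) has_vector_derivative
      cross3 (cross3 (?x t) (?v t)) (?v t) +
      cross3 (lam *\<^sub>R cross3 e3 (?x t) - lam *\<^sub>R ?v t) (?x t)) (at t)"
    by (rule cross3.has_vector_derivative[OF orbit_cross_deriv[OF z] orbit_deriv])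
  also have "cross3 (cross3 (?x t) (?v t)) (?v t) +
      cross3 (lam *\<^sub>R cross3 e3 (?x t) - lam *\<^sub>R ?v t) (?x t) =
      (lam * ?x t $ 3 - ?v t \<bullet> ?v t) *\<^sub>R ?x t + lam *\<^sub>R cross3 (?x t) (?v t) - (lam * R\<^sup>2) *\<^sub>R e3"
    using cross_skew[of "?v t" "?x t"]
    by (simp add: cross3_cross3_left s inner_e3 cross3.diff_left cross3.scaleR_left algebra_simps)
  finally have "((\<lambda>t. cross3 (cross3 (?x t) (?v t)) (?x t) /\<^sub>R R\<^sup>2) has_vector_derivative
      accel R lam (?x t) (?v t)) (at t)"
    unfolding accel_def by (rule bounded_linear.has_vector_derivative[OF bounded_linear_scaleR_right])
  then show ?thesis unfolding v[symmetric] .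
qed

section \<open>Conserved quantities and the cubic equation\<close>

lemma has_real_derivative_nth:
  fixes f :: "real \<Rightarrow> real^'n"
  assumes "(f has_vector_derivative f') F"
  shows "((\<lambda>t. f t $ i) has_real_derivative f' $ i) F"
  unfolding has_real_derivative_iff_has_vector_derivative
  by (rule bounded_linear.has_vector_derivative[OF bounded_linear_vec_nth assms])

text \<open>The third component of \<open>e3 \<times> x\<close> is zero, so the vertical angular
  momentum changes at rate \<open>- lam * x3'\<close>, which the second summand cancels.\<close>

lemma conserved_C_const:
  assumes z: "(lam, u) \<in> zero_set R"
  shows "conserved_C R lam u t = conserved_C R lam u 0"
proof (rule DERIV_isconst_all[of "conserved_C R lam u"], rule allI)
  fix t
  have "((\<lambda>t. cross3 (orbit R u t) (orbit' R u t) $ 3 + lam * orbit R u t $ 3) has_real_derivative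
      (lam *\<^sub>R cross3 e3 (orbit R u t) - lam *\<^sub>R orbit' R u t) $ 3 + lam * orbit' R u t $ 3) (at t)"
    by (intro DERIV_add DERIV_cmult has_real_derivative_nth orbit_cross_deriv[OF z] orbit_deriv)
  then show "(conserved_C R lam u has_real_derivative 0) (at t)"
    by (simp add: conserved_C_def[abs_def] cross_components e3_def)
qed

lemma conserved_E_alt:
  "conserved_E R lam u t = lam / 2 * (orbit' R u t \<bullet> orbit' R u t)
     - lam * cross3 (orbit R u t) (orbit' R u t) $ 3"
  by (simp add: conserved_E_def power2_norm_eq_inner cross_components algebra_simps)

lemma orbit'_inner_accel:
  assumes R: "R > 0" and z: "(lam, u) \<in> zero_set R"
  shows "orbit' R u t \<bullet> accel R lam (orbit R u t) (orbit' R u t) = - lam * orbit' R u t $ 3"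
  using R zero_set_sphere(3)[OF z, of t] dot_cross_self(2)[of "orbit' R u t" "orbit R u t"]
  by (simp add: accel_def inner_diff_right inner_add_right inner_e3 inner_commute field_simps)

text \<open>In \<open>v \<bullet> accel\<close> only the \<open>e3\<close> term survives, as
  \<open>v\<close> is orthogonal to \<open>x\<close> and to \<open>x \<times> v\<close>. The kinetic
  part therefore contributes \<open>- lam^2 * v3\<close>, and the angular momentum part contributes
  the opposite.\<close>

lemma conserved_E_const:
  assumes R: "R > 0" and z: "(lam, u) \<in> zero_set R"
  shows "conserved_E R lam u t = conserved_E R lam u 0"
proof (rule DERIV_isconst_all[of "conserved_E R lam u"], rule allI)
  fix t
  let ?x = "orbit R u" and ?v = "orbit' R u"
  let ?a = "accel R lam (?x t) (?v t)"
  have "((\<lambda>t. ?v t \<bullet> ?v t) has_real_derivative (?v t \<bullet> ?a + ?a \<bullet> ?v t)) (at t)"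
    unfolding has_real_derivative_iff_has_vector_derivative
    by (intro bounded_bilinear.has_vector_derivative[OF bounded_bilinear_inner] orbit'_deriv[OF R z])
  then have "((\<lambda>t. lam / 2 * (?v t \<bullet> ?v t) - lam * cross3 (?x t) (?v t) $ 3) has_real_derivative
      (lam / 2 * (?v t \<bullet> ?a + ?a \<bullet> ?v t) - lam * (lam *\<^sub>R cross3 e3 (?x t) - lam *\<^sub>R ?v t) $ 3)) (at t)"
    by (intro DERIV_diff DERIV_cmult has_real_derivative_nth orbit_cross_deriv[OF z])
  also have "lam / 2 * (?v t \<bullet> ?a + ?a \<bullet> ?v t) - lam * (lam *\<^sub>R cross3 e3 (?x t) - lam *\<^sub>R ?v t) $ 3 = 0"
    using orbit'_inner_accel[OF R z, of t]
    by (simp add: inner_commute[of ?a] cross_components e3_def)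
  finally show "(conserved_E R lam u has_real_derivative 0) (at t)"
    by (simp only: conserved_E_alt[abs_def])
qed

text \<open>The coefficient \<open>a2\<close> of \<open>vertical_poly\<close>, kept separate for two
  reasons: it controls the speed, and by Vieta it carries the sum of the three roots without
  reference to the roots themselves.\<close>

definition cubic_a2 :: "real \<Rightarrow> real \<Rightarrow> H2 \<Rightarrow> real" where
  "cubic_a2 R lam u = (2 * conserved_E R lam u 0 + lam^3 + 2 * lam * conserved_C R lam u 0) / (lam * R\<^sup>2)"

text \<open>The energy expresses the squared speed through the vertical angular momentum, and
  \<open>conserved_C\<close> makes the latter affine in \<open>x3\<close>. A bound on
  \<open>cubic_a2\<close> thus becomes a bound on the speed.\<close>

lemma orbit'_norm2:
  assumes R: "R > 0" and z: "(lam, u) \<in> zero_set R"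
  shows "orbit' R u t \<bullet> orbit' R u t = R\<^sup>2 * cubic_a2 R lam u - lam\<^sup>2 - 2 * lam * x3 R u t"
proof -
  have "lam > 0" by (rule zero_set_sphere(1)[OF z])
  have E: "conserved_E R lam u 0 = lam / 2 * (orbit' R u t \<bullet> orbit' R u t)
      - lam * cross3 (orbit R u t) (orbit' R u t) $ 3"
    using conserved_E_const[OF R z, of t] by (simp only: conserved_E_alt[of R lam u t])
  have C: "conserved_C R lam u 0 = cross3 (orbit R u t) (orbit' R u t) $ 3 + lam * x3 R u t"
    using conserved_C_const[OF z, of t] by (simp only: conserved_C_def[of R lam u t] x3_def)
  show ?thesis
    using R \<open>lam > 0\<close> unfolding cubic_a2_def E C
    by (simp add: field_simps power2_eq_square power3_eq_cube)
qed

lemma x3_deriv: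
  "(x3 R u has_real_derivative orbit' R u t $ 3) (at t)"
  unfolding x3_def[abs_def] by (rule has_real_derivative_nth[OF orbit_deriv])

lemma x3_periodic: "x3 R u (t + 2*pi) = x3 R u t"
  by (simp add: x3_def orbit_periodic)

text \<open>Lagrange's identity in the horizontal plane:
  \<open>(x1^2 + x2^2) * (v1^2 + v2^2)\<close> is the sum of the squares of the inner product and of
  the determinant. Tangency replaces the inner product by \<open>- x3 * v3\<close>.\<close>

lemma tangent_sphere_identity:
  fixes x1 x2 x3 v1 v2 v3 :: real
  assumes "x1 * v1 + x2 * v2 + x3 * v3 = 0"
  shows "(x1\<^sup>2 + x2\<^sup>2 + x3\<^sup>2) * v3\<^sup>2 = (v1\<^sup>2 + v2\<^sup>2 + v3\<^sup>2) * (x1\<^sup>2 + x2\<^sup>2) - (x1 * v2 - x2 * v1)\<^sup>2"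
proof -
  have "(x1 * v1 + x2 * v2)\<^sup>2 = (x3 * v3)\<^sup>2"
    using assms by (metis add_eq_0_iff power2_minus)
  then show ?thesis by (simp add: power2_eq_square algebra_simps)
qed

text \<open>With \<open>s = x3\<close>, the squared horizontal distance is \<open>R^2 - s^2\<close>,
  the angular momentum is \<open>C - lam * s\<close>, and the squared speed is affine in
  \<open>s\<close>. The preceding identity then leaves a cubic in \<open>s\<close>.\<close>

lemma x3_first_integral:
  assumes R: "R > 0" and z: "(lam, u) \<in> zero_set R"
  shows "(orbit' R u t $ 3)\<^sup>2 = vertical_poly R lam u (x3 R u t)"
proof -
  let ?x = "orbit R u t" and ?v = "orbit' R u t" and ?s = "x3 R u t"
  define C where "C = conserved_C R lam u 0"
  define E where "E = conserved_E R lam u 0"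
  have lam: "lam > 0" by (rule zero_set_sphere(1)[OF z])
  have x: "(?x $ 1)\<^sup>2 + (?x $ 2)\<^sup>2 + ?s\<^sup>2 = R\<^sup>2" "?x $ 1 * ?v $ 1 + ?x $ 2 * ?v $ 2 + ?s * ?v $ 3 = 0"
    using zero_set_sphere(2,3)[OF z, of t] by (simp_all add: inner_vec_def sum_3 power2_eq_square x3_def)
  have M: "?x $ 1 * ?v $ 2 - ?x $ 2 * ?v $ 1 = C - lam * ?s"
    using conserved_C_const[OF z, of t] unfolding conserved_C_def[of R lam u t] C_def[symmetric]
    by (simp add: cross_components x3_def algebra_simps)
  have S: "(?v $ 1)\<^sup>2 + (?v $ 2)\<^sup>2 + (?v $ 3)\<^sup>2 = 2 * E / lam + 2 * C - 2 * lam * ?s"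
  proof -
    have "R\<^sup>2 * cubic_a2 R lam u = 2 * E / lam + lam\<^sup>2 + 2 * C"
      using R lam by (simp add: cubic_a2_def C_def E_def field_simps power2_eq_square power3_eq_cube)
    then show ?thesis
      using orbit'_norm2[OF R z, of t] by (simp add: inner_vec_def sum_3 power2_eq_square)
  qed
  have h: "(?x $ 1)\<^sup>2 + (?x $ 2)\<^sup>2 = R\<^sup>2 - ?s\<^sup>2" using x(1) by simp
  have "R\<^sup>2 * (?v $ 3)\<^sup>2 = (2 * E / lam + 2 * C - 2 * lam * ?s) * (R\<^sup>2 - ?s\<^sup>2) - (C - lam * ?s)\<^sup>2"
    using tangent_sphere_identity[OF x(2)] unfolding h M S by simp
  moreover have "\<dots> = R\<^sup>2 * vertical_poly R lam u ?s"
    using R lam unfolding vertical_poly_def Let_def C_def[symmetric] E_def[symmetric]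
    by (simp add: field_simps power2_eq_square power3_eq_cube)
  ultimately show ?thesis using R by simp
qed

text \<open>The right side is half the derivative of the cubic at \<open>x3\<close>. It is computed
  from \<open>accel\<close>, because differentiating the first integral would require division by
  the velocity of \<open>x3\<close>, which vanishes at the turning points.\<close>

lemma accel_nth_3:
  assumes R: "R > 0" and z: "(lam, u) \<in> zero_set R"
  shows "accel R lam (orbit R u t) (orbit' R u t) $ 3 =
    (3 * (2 * lam / R\<^sup>2) * (x3 R u t)\<^sup>2 - 2 * cubic_a2 R lam u * x3 R u t
      + (2 * lam * conserved_C R lam u 0 - 2 * lam * R\<^sup>2) / R\<^sup>2) / 2"
proof -
  let ?s = "x3 R u t" and ?C = "conserved_C R lam u 0" and ?A = "cubic_a2 R lam u"
  have M: "cross3 (orbit R u t) (orbit' R u t) $ 3 = ?C - lam * ?s"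
    using conserved_C_const[OF z, of t] unfolding conserved_C_def[of R lam u t] by (simp add: x3_def)
  have "accel R lam (orbit R u t) (orbit' R u t) $ 3 =
     ((lam * ?s - (R\<^sup>2 * ?A - lam\<^sup>2 - 2 * lam * ?s)) * ?s + lam * (?C - lam * ?s) - lam * R\<^sup>2) / R\<^sup>2"
    unfolding accel_def orbit'_norm2[OF R z] using M
    by (simp add: x3_def e3_def divide_inverse mult.commute)
  also have "\<dots> = (3 * (2 * lam / R\<^sup>2) * ?s\<^sup>2 - 2 * ?A * ?s + (2 * lam * ?C - 2 * lam * R\<^sup>2) / R\<^sup>2) / 2"
    using R by (simp add: field_simps power2_eq_square)
  finally show ?thesis .
qed

text \<open>Vieta's formulas; three sample points suffice because the leading coefficients agree
  already.\<close>

lemma cubic_coefficients: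
  fixes a b c d r1 r2 r3 :: real
  assumes "\<And>s. a * s^3 - b * s\<^sup>2 + c * s + d = a * (s - r1) * (s - r2) * (s - r3)"
  shows "b = a * (r1 + r2 + r3)" "c = a * (r1 * r2 + r1 * r3 + r2 * r3)"
  using assms[of 0] assms[of 1] assms[of "-1"] by (simp_all add: algebra_simps)

lemma Z_reg_cubic:
  assumes R: "R > 0" and z: "(lam, u) \<in> Z_reg R"
  obtains r1 r2 r3 where
    "is_minimum (x3 R u) r1" "is_maximum (x3 R u) r2" "- R < r1" "r1 < r2" "r2 < R" "r2 < r3"
    "cubic_a2 R lam u = 2 * lam / R\<^sup>2 * (r1 + r2 + r3)"
    "\<And>t. (orbit' R u t $ 3)\<^sup>2 = 2 * lam / R\<^sup>2 * (x3 R u t - r1) * (x3 R u t - r2) * (x3 R u t - r3)"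
    "\<And>t. accel R lam (orbit R u t) (orbit' R u t) $ 3 = 2 * lam / R\<^sup>2 / 2 *
       ((x3 R u t - r1) * (x3 R u t - r2) + (x3 R u t - r1) * (x3 R u t - r3) + (x3 R u t - r2) * (x3 R u t - r3))"
proof -
  have z0: "(lam, u) \<in> zero_set R" using z by (simp add: Z_reg_def)
  obtain r1 r2 r3 where r: "is_minimum (x3 R u) r1" "is_maximum (x3 R u) r2" "- R < r1" "r1 < r2" "r2 < R" "r2 < r3"
    and P: "\<And>s. vertical_poly R lam u s = 2 * lam / R\<^sup>2 * (s - r1) * (s - r2) * (s - r3)"
    using z by (auto simp: Z_reg_def)
  define d where "d = (2 * conserved_E R lam u 0 * R\<^sup>2 - lam * (conserved_C R lam u 0)\<^sup>2
    + 2 * lam * conserved_C R lam u 0 * R\<^sup>2) / (lam * R\<^sup>2)"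
  define c where "c = (2 * lam * conserved_C R lam u 0 - 2 * lam * R\<^sup>2) / R\<^sup>2"
  have "2 * lam / R\<^sup>2 * s^3 - cubic_a2 R lam u * s\<^sup>2 + c * s + d
      = 2 * lam / R\<^sup>2 * (s - r1) * (s - r2) * (s - r3)" for s
    using P[of s] by (simp add: vertical_poly_def Let_def cubic_a2_def c_def d_def)
  note co = cubic_coefficients[OF this]
  define A where "A = 2 * lam / R\<^sup>2"
  show ?thesis
  proof (rule that[OF r co(1)])
    fix t
    show "(orbit' R u t $ 3)\<^sup>2 = 2 * lam / R\<^sup>2 * (x3 R u t - r1) * (x3 R u t - r2) * (x3 R u t - r3)"
      using x3_first_integral[OF R z0] P by simp
    show "accel R lam (orbit R u t) (orbit' R u t) $ 3 = 2 * lam / R\<^sup>2 / 2 *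
       ((x3 R u t - r1) * (x3 R u t - r2) + (x3 R u t - r1) * (x3 R u t - r3) + (x3 R u t - r2) * (x3 R u t - r3))"
      unfolding accel_nth_3[OF R z0] c_def[symmetric] co
      unfolding A_def[symmetric] by (simp add: field_simps power2_eq_square)
  qed
qed

section \<open>Counting oscillations\<close>

lemma has_real_antiderivative:
  fixes h :: "real \<Rightarrow> real"
  assumes "continuous_on UNIV h"
  obtains F where "\<And>t. (F has_real_derivative h t) (at t)"
proof -
  have "\<exists>F. \<forall>x::real. - \<infinity> < ereal x \<longrightarrow> ereal x < \<infinity> \<longrightarrow> (F has_vector_derivative h x) (at x)"
    by (rule einterval_antiderivative) (use assms in \<open>auto simp: continuous_on_eq_continuous_at\<close>)
  then show ?thesis using that by (auto simp: has_real_derivative_iff_has_vector_derivative)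
qed

text \<open>On the curve \<open>y\<^sup>2 = c (s - r1) (s - r2) (s - r3)\<close> the point \<open>(f - m, f' / h)\<close>,
  with \<open>m = (r1 + r2) / 2\<close> and \<open>h = sqrt (c (r3 - f))\<close>, rotates clockwise on a circle with angular
  speed \<open>h\<close>, and \<open>h\<close> is a function of the angle. Hence the periods of \<open>f\<close> are the times at which the
  angle is a multiple of \<open>2\<pi>\<close>.\<close>

lemma oscillation_count:
  fixes f f' :: "real \<Rightarrow> real" and c r1 r2 r3 :: real
  assumes f: "\<And>t. (f has_real_derivative f' t) (at t)"
    and f': "\<And>t. (f' has_real_derivative c / 2 * ((f t - r1) * (f t - r2)
      + (f t - r1) * (f t - r3) + (f t - r2) * (f t - r3))) (at t)"
    and e: "\<And>t. (f' t)\<^sup>2 = c * (f t - r1) * (f t - r2) * (f t - r3)"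
    and c: "c > 0" and r: "r1 < r2" "r2 < r3"
    and b: "\<And>t. r1 \<le> f t" "\<And>t. f t \<le> r2"
    and per: "\<And>t. f (t + 2*pi) = f t"
  obtains q :: nat where "q \<ge> 1" "minimal_period f (2*pi / real q)"
    "((\<lambda>t. sqrt (c * (r3 - f t))) has_integral 2*pi * real q) {0..2*pi}"
proof -
  define m where "m = (r1 + r2) / 2"
  define \<rho> where "\<rho> = (r2 - r1) / 2"
  define h where "h t = sqrt (c * (r3 - f t))" for t
  define U where "U t = f t - m" for t
  define w where "w t = f' t / h t" for t
  have pos: "r3 - f t > 0" for t using b(2)[of t] r by simp
  have h0: "h t > 0" for t using pos[of t] c by (simp add: h_def)
  have h2: "h t * h t = c * (r3 - f t)" for t using pos[of t] c by (simp add: h_def)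
  have hd: "(h has_real_derivative - (c * f' t / (2 * h t))) (at t)" for t
  proof -
    have "((\<lambda>t. sqrt (c * (r3 - f t))) has_real_derivative
        (inverse (sqrt (c * (r3 - f t))) / 2) * (c * (0 - f' t))) (at t)"
      by (rule DERIV_chain2[OF DERIV_real_sqrt]) (use pos[of t] c in \<open>auto intro!: derivative_eq_intros f\<close>)
    then show ?thesis by (simp add: h_def[abs_def] field_simps)
  qed
  have Ud: "(U has_real_derivative h t * w t) (at t)" for t
  proof -
    have "(U has_real_derivative f' t - 0) (at t)"
      unfolding U_def by (intro DERIV_diff f DERIV_const)
    then show ?thesis using h0[of t] by (simp add: w_def)
  qed
  have wd: "(w has_real_derivative - (h t * U t)) (at t)" for t
  proof -
    define S where "S = (f t - r1) * (f t - r2) + (f t - r1) * (f t - r3) + (f t - r2) * (f t - r3)"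
    have "((\<lambda>t. f' t / h t) has_real_derivative
        ((c / 2 * S) * h t - f' t * - (c * f' t / (2 * h t))) / (h t * h t)) (at t)"
      unfolding S_def by (intro DERIV_divide f' hd) (use h0[of t] in simp)
    moreover have "((c / 2 * S) * h t - f' t * - (c * f' t / (2 * h t))) / (h t * h t) = - (h t * U t)"
    proof -
      \<comment> \<open>Since \<open>f'^2 = - (f - r1) * (f - r2) * h^2\<close>, the summand
        \<open>(f - r1) * (f - r2)\<close> of \<open>S\<close> cancels. The other two summands add
        up to \<open>2 * U * (f - r3)\<close>, which is why \<open>m\<close> is the midpoint of
        \<open>r1\<close> and \<open>r2\<close>.\<close>
      have k: "2 * (c / 2 * S) * (h t * h t) + c * (f' t)\<^sup>2 = - 2 * (h t * h t) * (h t * h t) * U t"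
        unfolding h2 e S_def U_def m_def by (simp add: field_simps)
      have "(c / 2 * S) * h t - f' t * - (c * f' t / (2 * h t))
          = (2 * (c / 2 * S) * (h t * h t) + c * (f' t)\<^sup>2) / (2 * h t)"
        using h0[of t] by (simp add: field_simps power2_eq_square)
      also have "\<dots> / (h t * h t) = - (h t * U t)"
        unfolding k using h0[of t] by (simp add: field_simps)
      finally show ?thesis .
    qed
    ultimately show ?thesis by (simp add: w_def[abs_def])
  qed
  have hc: "continuous_on UNIV h"
    by (rule DERIV_continuous_on) (use hd in \<open>auto\<close>)
  obtain \<theta>0 where \<theta>0: "\<And>t. (\<theta>0 has_real_derivative h t) (at t)"
    using has_real_antiderivative[OF hc] by blast
  define \<theta> where "\<theta> t = \<theta>0 t - \<theta>0 0" for t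
  have \<theta>: "(\<theta> has_real_derivative h t) (at t)" for t
    unfolding \<theta>_def using DERIV_diff[OF \<theta>0[of t] DERIV_const] by simp
  have [simp]: "\<theta> 0 = 0" by (simp add: \<theta>_def)
  define A where "A = U 0"
  define B where "B = w 0"
  \<comment> \<open>Undoing the rotation by \<open>\<theta>\<close> turns the moving point
    \<open>(U, w)\<close> into the constant \<open>(A, B)\<close>, its position at time
    \<open>0\<close>.\<close>
  have A: "U t * cos (\<theta> t) - w t * sin (\<theta> t) = A" for t
  proof -
    have "((\<lambda>t. U t * cos (\<theta> t) - w t * sin (\<theta> t)) has_real_derivative 0) (at t)" for t
      by (rule derivative_eq_intros Ud wd \<theta> refl | simp add: algebra_simps)+
    then have "U t * cos (\<theta> t) - w t * sin (\<theta> t) = U 0 * cos (\<theta> 0) - w 0 * sin (\<theta> 0)"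
      by (intro DERIV_isconst_all[of "\<lambda>t. U t * cos (\<theta> t) - w t * sin (\<theta> t)"]) blast
    then show ?thesis by (simp add: A_def)
  qed
  have B: "U t * sin (\<theta> t) + w t * cos (\<theta> t) = B" for t
  proof -
    have "((\<lambda>t. U t * sin (\<theta> t) + w t * cos (\<theta> t)) has_real_derivative 0) (at t)" for t
      by (rule derivative_eq_intros Ud wd \<theta> refl | simp add: algebra_simps)+
    then have "U t * sin (\<theta> t) + w t * cos (\<theta> t) = U 0 * sin (\<theta> 0) + w 0 * cos (\<theta> 0)"
      by (intro DERIV_isconst_all[of "\<lambda>t. U t * sin (\<theta> t) + w t * cos (\<theta> t)"]) blast
    then show ?thesis by (simp add: B_def)
  qed
  have rot: "x = (x * C - y * S) * C + (x * S + y * C) * S" "y = (x * S + y * C) * C - (x * C - y * S) * S"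
    if "C\<^sup>2 + S\<^sup>2 = 1" for x y C S :: real
  proof -
    have "(x * C - y * S) * C + (x * S + y * C) * S = x * (C\<^sup>2 + S\<^sup>2)"
      "(x * S + y * C) * C - (x * C - y * S) * S = y * (C\<^sup>2 + S\<^sup>2)"
      by (simp_all add: algebra_simps power2_eq_square)
    then show "x = (x * C - y * S) * C + (x * S + y * C) * S" "y = (x * S + y * C) * C - (x * C - y * S) * S"
      using that by simp_all
  qed
  have Uw: "U t = A * cos (\<theta> t) + B * sin (\<theta> t)" "w t = B * cos (\<theta> t) - A * sin (\<theta> t)" for t
    using rot(1)[of "cos (\<theta> t)" "sin (\<theta> t)" "U t" "w t"] rot(2)[of "cos (\<theta> t)" "sin (\<theta> t)" "w t" "U t"]
    unfolding A B by (simp_all only: sin_cos_squared_add2 simp_thms)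
  \<comment> \<open>The first integral says \<open>w^2 = (f - r1) * (r2 - f)\<close>, so the radius
    of the circle is half the amplitude.\<close>
  have AB: "A\<^sup>2 + B\<^sup>2 = \<rho>\<^sup>2"
  proof -
    have "(f' 0)\<^sup>2 = (h 0 * h 0) * ((f 0 - r1) * (r2 - f 0))"
      unfolding h2 e by (simp add: algebra_simps)
    then have "B\<^sup>2 = (f 0 - r1) * (r2 - f 0)"
      using h0[of 0] by (simp add: B_def w_def power_divide power2_eq_square)
    then show ?thesis by (simp add: A_def U_def m_def \<rho>_def field_simps power2_eq_square)
  qed
  have \<rho>: "\<rho> > 0" using r by (simp add: \<rho>_def)
  \<comment> \<open>The angular speed as a function of the angle alone, which makes the motion
    autonomous: \<open>\<theta>' = H \<theta>\<close>. It is positive at every angle since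
    \<open>r2 < r3\<close>. A primitive \<open>G\<close> of \<open>1 / H\<close> is therefore time
    as a function of the angle, and \<open>T\<close> is the duration of one full turn.\<close>
  define H where "H s = sqrt (c * (r3 - m - (A * cos s + B * sin s)))" for s
  have AB_le: "A * cos s + B * sin s \<le> \<rho>" for s
  proof -
    have "(A * cos s + B * sin s)\<^sup>2 + (B * cos s - A * sin s)\<^sup>2 = (A\<^sup>2 + B\<^sup>2) * ((cos s)\<^sup>2 + (sin s)\<^sup>2)"
      by (simp add: power2_eq_square algebra_simps del: sin_cos_squared_add sin_cos_squared_add2 sin_cos_squared_add3)
    then have "(A * cos s + B * sin s)\<^sup>2 \<le> \<rho>\<^sup>2"
      using zero_le_power2[of "B * cos s - A * sin s"] unfolding AB sin_cos_squared_add2 by linarith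
    then show ?thesis by (rule power2_le_imp_le) (use \<rho> in simp)
  qed
  have gap: "0 < r3 - m - (A * cos s + B * sin s)" for s
    using AB_le[of s] r by (simp add: m_def \<rho>_def field_simps)
  have H0: "H s > 0" for s using gap[of s] c by (simp add: H_def)
  have Hh: "h t = H (\<theta> t)" for t
    using Uw(1)[of t] by (simp add: h_def H_def U_def)
  have Hper: "H (s + 2*pi) = H s" for s by (simp add: H_def)
  have "continuous_on UNIV (\<lambda>s. 1 / H s)"
  proof (intro continuous_on_divide continuous_on_const ballI)
    show "continuous_on UNIV H" unfolding H_def[abs_def] by (intro continuous_intros)
    show "H s \<noteq> 0" for s using H0[of s] by simp
  qed
  then obtain G where G: "\<And>s. (G has_real_derivative 1 / H s) (at s)"
    using has_real_antiderivative by blast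
  have Gmono: "G s < G t" if "s < t" for s t
    by (rule DERIV_pos_imp_increasing[OF that]) (use G H0 in \<open>auto intro!: exI[of _ "1 / H _"]\<close>)
  have Ginj: "s = t" if "G s = G t" for s t
    using Gmono[of s t] Gmono[of t s] that by (metis less_irrefl linorder_less_linear)
  have \<theta>mono: "\<theta> s < \<theta> t" if "s < t" for s t
    by (rule DERIV_pos_imp_increasing[OF that]) (use \<theta> h0 in blast)
  have G\<theta>: "G (\<theta> t) = t + G 0" for t
  proof -
    have "((\<lambda>t. G (\<theta> t) - t) has_real_derivative 0) (at t)" for t
    proof -
      have "((\<lambda>t. G (\<theta> t)) has_real_derivative (1 / H (\<theta> t)) * h t) (at t)"
        using DERIV_chain[OF G \<theta>, of t] by (simp add: o_def)
      from DERIV_diff[OF this DERIV_ident] show ?thesis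
        using H0[of "\<theta> t"] by (simp add: Hh)
    qed
    then have "G (\<theta> t) - t = G (\<theta> 0) - 0"
      by (intro DERIV_isconst_all[of "\<lambda>t. G (\<theta> t) - t"]) blast
    then show ?thesis by simp
  qed
  define T where "T = G (2*pi) - G 0"
  have T0: "T > 0" using Gmono[of 0 "2*pi"] by (simp add: T_def)
  have GT: "G (s + 2*pi) = G s + T" for s
  proof -
    have "((\<lambda>s. G (s + 2*pi) - G s) has_real_derivative 0) (at s)" for s
      using DERIV_diff[OF DERIV_shift[THEN iffD1, OF G[of "s + 2*pi"]] G[of s]] by (simp add: Hper)
    then have "G (s + 2*pi) - G s = G (0 + 2*pi) - G 0"
      by (intro DERIV_isconst_all[of "\<lambda>s. G (s + 2*pi) - G s"]) blast
    then show ?thesis by (simp add: T_def)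
  qed
  have GnT: "G (real n * (2*pi)) = G 0 + real n * T" for n
  proof (induction n)
    case (Suc n)
    then show ?case using GT[of "real n * (2*pi)"] by (simp add: algebra_simps)
  qed simp
  have fT: "f (t + T) = f t" for t
  proof -
    have "\<theta> (t + T) = \<theta> t + 2*pi"
      by (rule Ginj) (simp add: G\<theta> GT)
    then have "U (t + T) = U t" by (simp add: Uw)
    then show ?thesis by (simp add: U_def)
  qed
  \<comment> \<open>A period of \<open>f\<close> also restores \<open>f'\<close>, hence the point on
    the circle. Since the radius is positive, the accumulated angle must have cosine
    \<open>1\<close>, and \<open>G\<close> converts whole turns into multiples of
    \<open>T\<close>.\<close>
  have period: "\<exists>n::nat. n \<ge> 1 \<and> T' = real n * T \<and> \<theta> T' = real n * (2*pi)"
    if T': "T' > 0" "\<And>t. f (t + T') = f t" for T'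
  proof -
    have "f' (0 + T') = f' 0"
    proof (rule DERIV_unique)
      show "((\<lambda>t. f (t + T')) has_real_derivative f' (0 + T')) (at 0)"
        using DERIV_shift[THEN iffD1, OF f[of "0 + T'"]] .
      show "((\<lambda>t. f (t + T')) has_real_derivative f' 0) (at 0)"
        unfolding T'(2) by (rule f)
    qed
    moreover have "f T' = f 0" using T'(2)[of 0] by simp
    ultimately have "U T' = A" "w T' = B" by (simp_all add: A_def B_def U_def w_def h_def)
    then have "A * cos (\<theta> T') + B * sin (\<theta> T') = A" "B * cos (\<theta> T') - A * sin (\<theta> T') = B"
      using Uw[of T'] by simp_all
    then have "A * (A * cos (\<theta> T') + B * sin (\<theta> T')) + B * (B * cos (\<theta> T') - A * sin (\<theta> T')) = A\<^sup>2 + B\<^sup>2"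
      by (simp add: power2_eq_square)
    then have "(A\<^sup>2 + B\<^sup>2) * cos (\<theta> T') = A\<^sup>2 + B\<^sup>2"
      by (simp add: power2_eq_square algebra_simps)
    then have "cos (\<theta> T') = 1" using AB \<rho> by simp
    moreover have "\<theta> T' > 0" using \<theta>mono[OF T'(1)] by simp
    ultimately obtain n :: nat where n: "\<theta> T' = real n * (2*pi)"
    proof -
      assume pos: "\<theta> T' > 0" and c: "cos (\<theta> T') = 1"
      have "\<theta> T' \<noteq> - (real n * 2 * pi)" for n :: nat
      proof -
        have "real n * 2 * pi \<ge> 0" by simp
        with pos show ?thesis by linarith
      qed
      then obtain n :: nat where "\<theta> T' = real n * 2 * pi" using c unfolding cos_one_2pi by blast
      then show ?thesis by (intro that[of n]) simp
    qed
    have "n \<ge> 1" using n \<theta>mono[OF T'(1)] by (cases n) auto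
    moreover have "T' = real n * T" using G\<theta>[of T'] GnT[of n] n by simp
    ultimately show ?thesis using n by blast
  qed
  obtain q :: nat where q: "q \<ge> 1" "2*pi = real q * T" "\<theta> (2*pi) = real q * (2*pi)"
    using period[of "2*pi"] per by auto
  have Tq: "T = 2*pi / real q" using q by (simp add: field_simps)
  show ?thesis
  proof (rule that[OF q(1)])
    have "T \<le> T'" if T': "T' > 0" "\<forall>t. f (t + T') = f t" for T'
    proof -
      obtain n :: nat where "n \<ge> 1" "T' = real n * T" using period[OF T'(1) T'(2)[rule_format]] by auto
      then show ?thesis using T0 by simp
    qed
    then show "minimal_period f (2*pi / real q)"
      unfolding Tq[symmetric] minimal_period_def using T0 fT by blast
    have "(h has_integral (\<theta> (2*pi) - \<theta> 0)) {0..2*pi}"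
      by (rule fundamental_theorem_of_calculus)
        (auto intro: has_vector_derivative_at_within[OF \<theta>[unfolded has_real_derivative_iff_has_vector_derivative]])
    then show "((\<lambda>t. sqrt (c * (r3 - f t))) has_integral 2*pi * real q) {0..2*pi}"
      unfolding q(3) by (simp add: h_def[abs_def] mult.commute)
  qed
qed

section \<open>The invariants as integrals\<close>

text \<open>Projected to the unit circle, the curve turns with angular speed
  \<open>\<omega>\<close>. Rotating it back by the primitive \<open>\<phi>\<close> gives a constant
  unit vector; as the curve closes up, rotation by \<open>\<phi> (2*pi)\<close> fixes that
  vector.\<close>

lemma winding_integral_int:
  fixes f g f' g' :: "real \<Rightarrow> real"
  assumes f: "\<And>t. (f has_real_derivative f' t) (at t)" and g: "\<And>t. (g has_real_derivative g' t) (at t)"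
    and c: "continuous_on UNIV f'" "continuous_on UNIV g'"
    and nz: "\<And>t. (f t)\<^sup>2 + (g t)\<^sup>2 > 0" and per: "f (2*pi) = f 0" "g (2*pi) = g 0"
  obtains n :: int where
    "((\<lambda>t. (f t * g' t - g t * f' t) / ((f t)\<^sup>2 + (g t)\<^sup>2)) has_integral 2*pi * of_int n) {0..2*pi}"
proof -
  define \<omega> where "\<omega> t = (f t * g' t - g t * f' t) / ((f t)\<^sup>2 + (g t)\<^sup>2)" for t
  have cf: "continuous_on UNIV f" "continuous_on UNIV g"
    by (rule DERIV_continuous_on; use f g in auto)+
  have "continuous_on UNIV \<omega>"
    unfolding \<omega>_def by (intro continuous_intros c cf ballI less_imp_neq[OF nz, symmetric])
  then obtain \<phi>0 where \<phi>0: "\<And>t. (\<phi>0 has_real_derivative \<omega> t) (at t)"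
    using has_real_antiderivative by blast
  define \<phi> where "\<phi> t = \<phi>0 t - \<phi>0 0" for t
  have \<phi>: "(\<phi> has_real_derivative \<omega> t) (at t)" for t
    unfolding \<phi>_def using DERIV_diff[OF \<phi>0[of t] DERIV_const] by simp
  have [simp]: "\<phi> 0 = 0" by (simp add: \<phi>_def)
  define \<rho> where "\<rho> t = sqrt ((f t)\<^sup>2 + (g t)\<^sup>2)" for t
  have \<rho>0: "\<rho> t > 0" for t using nz[of t] by (simp add: \<rho>_def)
  have \<rho>2: "\<rho> t * \<rho> t = f t * f t + g t * g t" for t
    using nz[of t] by (simp add: \<rho>_def power2_eq_square)
  have \<rho>d: "(\<rho> has_real_derivative (f t * f' t + g t * g' t) / \<rho> t) (at t)" for t
  proof -
    have "((\<lambda>t. sqrt ((f t)\<^sup>2 + (g t)\<^sup>2)) has_real_derivative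
        (inverse (sqrt ((f t)\<^sup>2 + (g t)\<^sup>2)) / 2) * (2 * (f t * f' t + g t * g' t))) (at t)"
      by (rule DERIV_chain2[OF DERIV_real_sqrt])
        (use nz[of t] f g in \<open>auto intro!: derivative_eq_intros simp: power2_eq_square algebra_simps\<close>)
    moreover have "(inverse s / 2) * (2 * y) = y / s" for s y :: real by (simp add: field_simps)
    ultimately show ?thesis by (simp only: \<rho>_def[abs_def])
  qed
  define a where "a t = f t / \<rho> t" for t
  define b where "b t = g t / \<rho> t" for t
  have \<omega>: "\<omega> t = (f t * g' t - g t * f' t) / (\<rho> t * \<rho> t)" for t
    by (simp add: \<omega>_def \<rho>2 power2_eq_square)
  \<comment> \<open>One quotient computation serves both coordinates: \<open>b\<close> is obtained
    by exchanging the roles of \<open>f\<close> and \<open>g\<close>, which reverses the sign of the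
    determinant.\<close>
  have quot: "(x' * r - x * ((x * x' + y * y') / r)) / (r * r) = - ((x * y' - y * x') / (r * r)) * (y / r)"
    if "r > 0" "r * r = x * x + y * y" for x y x' y' r :: real
  proof -
    have "x' * r - x * ((x * x' + y * y') / r) = (x' * (r * r) - x * (x * x' + y * y')) / r"
      using that(1) by (simp add: field_simps)
    also have "x' * (r * r) - x * (x * x' + y * y') = - (x * y' - y * x') * y"
      unfolding that(2) by (simp add: algebra_simps)
    finally have E: "x' * r - x * ((x * x' + y * y') / r) = - (x * y' - y * x') * y / r" .
    have "- K * y / r / (r * r) = - (K / (r * r)) * (y / r)" for K :: real by (simp add: ac_simps)
    then show ?thesis unfolding E .
  qed
  have ad: "(a has_real_derivative - \<omega> t * b t) (at t)" for t
  proof -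
    have "(a has_real_derivative (f' t * \<rho> t - f t * ((f t * f' t + g t * g' t) / \<rho> t)) / (\<rho> t * \<rho> t)) (at t)"
      unfolding a_def by (intro DERIV_divide f \<rho>d) (use \<rho>0[of t] in simp)
    then show ?thesis unfolding quot[OF \<rho>0 \<rho>2] \<omega> b_def .
  qed
  have bd: "(b has_real_derivative \<omega> t * a t) (at t)" for t
  proof -
    have "(b has_real_derivative (g' t * \<rho> t - g t * ((g t * g' t + f t * f' t) / \<rho> t)) / (\<rho> t * \<rho> t)) (at t)"
      unfolding b_def
      by (rule DERIV_divide[OF g, OF _]) (use \<rho>0[of t] \<rho>d[of t] in \<open>simp_all add: add.commute\<close>)
    moreover have "\<rho> t * \<rho> t = g t * g t + f t * f t" by (simp add: \<rho>2)
    ultimately have "(b has_real_derivative - ((g t * f' t - f t * g' t) / (\<rho> t * \<rho> t)) * (f t / \<rho> t)) (at t)"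
      using quot[OF \<rho>0[of t]] by metis
    then show ?thesis by (simp add: \<omega> a_def minus_divide_left)
  qed
  have A: "a t * cos (\<phi> t) + b t * sin (\<phi> t) = a 0" for t
  proof -
    have "((\<lambda>t. a t * cos (\<phi> t) + b t * sin (\<phi> t)) has_real_derivative 0) (at t)" for t
      by (rule derivative_eq_intros ad bd \<phi> refl | simp add: algebra_simps)+
    then have "a t * cos (\<phi> t) + b t * sin (\<phi> t) = a 0 * cos (\<phi> 0) + b 0 * sin (\<phi> 0)"
      by (intro DERIV_isconst_all[of "\<lambda>t. a t * cos (\<phi> t) + b t * sin (\<phi> t)"]) blast
    then show ?thesis by simp
  qed
  have B: "b t * cos (\<phi> t) - a t * sin (\<phi> t) = b 0" for t
  proof -
    have "((\<lambda>t. b t * cos (\<phi> t) - a t * sin (\<phi> t)) has_real_derivative 0) (at t)" for t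
      by (rule derivative_eq_intros ad bd \<phi> refl | simp add: algebra_simps)+
    then have "b t * cos (\<phi> t) - a t * sin (\<phi> t) = b 0 * cos (\<phi> 0) - a 0 * sin (\<phi> 0)"
      by (intro DERIV_isconst_all[of "\<lambda>t. b t * cos (\<phi> t) - a t * sin (\<phi> t)"]) blast
    then show ?thesis by simp
  qed
  have "\<rho> (2*pi) = \<rho> 0" by (simp add: \<rho>_def per)
  then have p: "a (2*pi) = a 0" "b (2*pi) = b 0" by (simp_all add: a_def b_def per)
  have "a 0 * (a 0 * cos (\<phi> (2*pi)) + b 0 * sin (\<phi> (2*pi)))
      + b 0 * (b 0 * cos (\<phi> (2*pi)) - a 0 * sin (\<phi> (2*pi))) = (a 0)\<^sup>2 + (b 0)\<^sup>2"
    using A[of "2*pi"] B[of "2*pi"] unfolding p by (simp add: power2_eq_square)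
  then have "((a 0)\<^sup>2 + (b 0)\<^sup>2) * cos (\<phi> (2*pi)) = (a 0)\<^sup>2 + (b 0)\<^sup>2"
    by (simp add: power2_eq_square algebra_simps)
  moreover have "(a 0)\<^sup>2 + (b 0)\<^sup>2 = 1"
    using \<rho>0[of 0]
    by (simp add: a_def b_def power_divide power2_eq_square add_divide_distrib[symmetric] \<rho>2[of 0, symmetric])
  ultimately have "cos (\<phi> (2*pi)) = 1" by simp
  then obtain n :: int where n: "\<phi> (2*pi) = of_int n * 2 * pi" by (auto simp: cos_one_2pi_int)
  have "(\<omega> has_integral (\<phi> (2*pi) - \<phi> 0)) {0..2*pi}"
    by (rule fundamental_theorem_of_calculus)
      (auto intro: has_vector_derivative_at_within[OF \<phi>[unfolded has_real_derivative_iff_has_vector_derivative]])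
  then show ?thesis
    using n by (intro that[of n]) (simp add: \<omega>_def[abs_def] ac_simps)
qed

lemma continuous_on_orbit':
  assumes "R > 0" "(lam, u) \<in> zero_set R"
  shows "continuous_on S (orbit' R u)"
  by (rule continuous_at_imp_continuous_on)
    (auto intro: has_vector_derivative_continuous[OF orbit'_deriv[OF assms]])

lemma continuous_on_x3: "continuous_on S (x3 R u)"
  unfolding x3_def[abs_def] by (intro continuous_intros continuous_on_orbit)

text \<open>The degree with its integrand reduced by the sphere constraint and conservation of
  \<open>C\<close>. The velocity enters only through the constant \<open>C\<close>, which simplifies
  passage to the limit.\<close>

definition turning_integral :: "real \<Rightarrow> real \<Rightarrow> H2 \<Rightarrow> real" where
  "turning_integral R lam u =
     integral {0..2*pi} (\<lambda>t. (conserved_C R lam u 0 - lam * x3 R u t) / (R\<^sup>2 - (x3 R u t)\<^sup>2)) / (2*pi)"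

lemma horizontal_degree_eq_turning_integral:
  assumes R: "R > 0" and z: "(lam, u) \<in> zero_set R" and b: "\<And>t. \<bar>x3 R u t\<bar> < R"
  shows "horizontal_degree R u = turning_integral R lam u" "turning_integral R lam u \<in> \<int>"
proof -
  let ?x = "orbit R u" and ?v = "orbit' R u"
  let ?f = "\<lambda>t. (?x t $ 1 * ?v t $ 2 - ?x t $ 2 * ?v t $ 1) / ((?x t $ 1)\<^sup>2 + (?x t $ 2)\<^sup>2)"
  have sq: "(?x t $ 1)\<^sup>2 + (?x t $ 2)\<^sup>2 = R\<^sup>2 - (x3 R u t)\<^sup>2" for t
    using zero_set_sphere(2)[OF z, of t] by (simp add: inner_vec_def sum_3 power2_eq_square x3_def)
  have M: "?x t $ 1 * ?v t $ 2 - ?x t $ 2 * ?v t $ 1 = conserved_C R lam u 0 - lam * x3 R u t" for t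
    using conserved_C_const[OF z, of t] unfolding conserved_C_def[of R lam u t]
    by (simp add: cross_components x3_def algebra_simps)
  have pos: "(?x t $ 1)\<^sup>2 + (?x t $ 2)\<^sup>2 > 0" for t
    unfolding sq using power_strict_mono[OF b[of t] abs_ge_zero, of 2] by simp
  have c: "continuous_on UNIV (\<lambda>t. ?v t $ i)" for i
    by (intro continuous_intros continuous_on_orbit'[OF R z])
  obtain n where n: "(?f has_integral 2*pi * of_int n) {0..2*pi}"
  proof (rule winding_integral_int[of "\<lambda>t. ?x t $ 1" "\<lambda>t. ?v t $ 1" "\<lambda>t. ?x t $ 2" "\<lambda>t. ?v t $ 2"])
    show "?x (2*pi) $ 1 = ?x 0 $ 1" "?x (2*pi) $ 2 = ?x 0 $ 2"
      using orbit_periodic[of R u 0] by simp_all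
  qed (use pos c has_real_derivative_nth[OF orbit_deriv] in auto)
  have t: "turning_integral R lam u = integral {0..2*pi} ?f / (2*pi)"
    unfolding turning_integral_def M sq ..
  then show "turning_integral R lam u \<in> \<int>" using integral_unique[OF n] by simp
  have "set_integrable lborel {0..2*pi} ?f"
    by (intro borel_integrable_atLeastAtMost' continuous_intros continuous_on_orbit
        continuous_on_orbit'[OF R z] ballI less_imp_neq[OF pos, symmetric])
  from set_borel_integral_eq_integral(2)[OF this]
  show "horizontal_degree R u = turning_integral R lam u"
    unfolding horizontal_degree_def t by simp
qed

text \<open>Total functions in place of the relations \<open>is_minimum\<close> and
  \<open>is_maximum\<close>, so that limits can be stated, including limits where \<open>x3\<close>
  becomes constant.\<close>

definition x3_min :: "real \<Rightarrow> H2 \<Rightarrow> real" where "x3_min R u = Inf (range (x3 R u))"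
definition x3_max :: "real \<Rightarrow> H2 \<Rightarrow> real" where "x3_max R u = Sup (range (x3 R u))"

lemma is_minimum_Inf: "is_minimum f m \<Longrightarrow> Inf (range f) = m"
  unfolding is_minimum_def by (intro cInf_eq_minimum) auto

lemma is_maximum_Sup: "is_maximum f m \<Longrightarrow> Sup (range f) = m"
  unfolding is_maximum_def by (intro cSup_eq_maximum) auto

text \<open>The mean of the angular speed \<open>sqrt (c * (r3 - x3))\<close> with
  \<open>c = 2 * lam / R^2\<close>. Vieta gives \<open>c * r3 = cubic_a2 - c * (r1 + r2)\<close>, so
  the third root need not be mentioned and the formula remains meaningful at solutions with constant
  \<open>x3\<close>.\<close>

definition swing_integral :: "real \<Rightarrow> real \<Rightarrow> H2 \<Rightarrow> real" where
  "swing_integral R lam u = integral {0..2*pi} (\<lambda>t. sqrt (cubic_a2 R lam u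
     - 2 * lam / R\<^sup>2 * (x3_min R u + x3_max R u + x3 R u t))) / (2*pi)"

lemma Z_reg_nodal_number:
  assumes R: "R > 0" and z: "(lam, u) \<in> Z_reg R"
  obtains q where "vertical_nodal_number R u q" "swing_integral R lam u = real q"
proof -
  have z0: "(lam, u) \<in> zero_set R" using z by (simp add: Z_reg_def)
  have lam: "lam > 0" by (rule zero_set_sphere(1)[OF z0])
  obtain r1 r2 r3 where r: "is_minimum (x3 R u) r1" "is_maximum (x3 R u) r2" "r1 < r2" "r2 < r3"
    "cubic_a2 R lam u = 2 * lam / R\<^sup>2 * (r1 + r2 + r3)"
    and e: "\<And>t. (orbit' R u t $ 3)\<^sup>2 = 2 * lam / R\<^sup>2 * (x3 R u t - r1) * (x3 R u t - r2) * (x3 R u t - r3)"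
    and a: "\<And>t. accel R lam (orbit R u t) (orbit' R u t) $ 3 = 2 * lam / R\<^sup>2 / 2 *
       ((x3 R u t - r1) * (x3 R u t - r2) + (x3 R u t - r1) * (x3 R u t - r3) + (x3 R u t - r2) * (x3 R u t - r3))"
    using Z_reg_cubic[OF R z] by metis
  have "2 * lam / R\<^sup>2 > 0" using R lam by simp
  moreover have "r1 \<le> x3 R u t" "x3 R u t \<le> r2" for t
    using r(1,2) by (auto simp: is_minimum_def is_maximum_def)
  moreover note x3_deriv has_real_derivative_nth[OF orbit'_deriv[OF R z0], of 3, unfolded a] e r(3,4) x3_periodic
  ultimately obtain q :: nat where q: "q \<ge> 1" "minimal_period (x3 R u) (2*pi / real q)"
    "((\<lambda>t. sqrt (2 * lam / R\<^sup>2 * (r3 - x3 R u t))) has_integral 2*pi * real q) {0..2*pi}"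
    using oscillation_count[of "x3 R u" "\<lambda>t. orbit' R u t $ 3" "2 * lam / R\<^sup>2" r1 r2 r3] by metis
  show ?thesis
  proof (rule that)
    show "vertical_nodal_number R u q" using q by (simp add: vertical_nodal_number_def)
    have "cubic_a2 R lam u - 2 * lam / R\<^sup>2 * (x3_min R u + x3_max R u + x3 R u t)
        = 2 * lam / R\<^sup>2 * (r3 - x3 R u t)" for t
      unfolding r(5) x3_min_def x3_max_def is_minimum_Inf[OF r(1)] is_maximum_Sup[OF r(2)]
      unfolding right_diff_distrib[symmetric] by simp
    then show "swing_integral R lam u = real q"
      unfolding swing_integral_def by (simp only: integral_unique[OF q(3)]) simp
  qed
qed

section \<open>Continuity of the invariants\<close>

text \<open>The invariants depend on position and velocity only. Requiring no convergence of second
  derivatives makes it easy to treat phase translates with varying angles.\<close>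

definition C1_convergent_to :: "(nat \<Rightarrow> H2) \<Rightarrow> H2 \<Rightarrow> bool" where
  "C1_convergent_to v u \<longleftrightarrow> uniform_limit UNIV (\<lambda>n. rep_H2 (v n)) (rep_H2 u) sequentially \<and>
     uniform_limit UNIV (\<lambda>n. D1 (v n)) (D1 u) sequentially"

lemma C1_convergent_pointwise:
  assumes "C1_convergent_to v u"
  shows "(\<lambda>n. rep_H2 (v n) t) \<longlonglongrightarrow> rep_H2 u t" "(\<lambda>n. D1 (v n) t) \<longlonglongrightarrow> D1 u t"
  using assms by (auto simp: C1_convergent_to_def intro: tendsto_uniform_limitI)

lemma conserved_C_tendsto:
  assumes "C1_convergent_to v u" "l \<longlonglongrightarrow> lam"
  shows "(\<lambda>n. conserved_C R (l n) (v n) 0) \<longlonglongrightarrow> conserved_C R lam u 0"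
  unfolding conserved_C_def orbit_def orbit'_eq cross_components
  by (intro tendsto_intros C1_convergent_pointwise assms)

lemma conserved_E_tendsto:
  assumes "C1_convergent_to v u" "l \<longlonglongrightarrow> lam"
  shows "(\<lambda>n. conserved_E R (l n) (v n) 0) \<longlonglongrightarrow> conserved_E R lam u 0"
  unfolding conserved_E_def orbit_def orbit'_eq
  by (intro tendsto_intros C1_convergent_pointwise assms) simp_all

lemma cubic_a2_tendsto:
  assumes "C1_convergent_to v u" "l \<longlonglongrightarrow> lam" "lam > 0" "R > 0"
  shows "(\<lambda>n. cubic_a2 R (l n) (v n)) \<longlonglongrightarrow> cubic_a2 R lam u"
  unfolding cubic_a2_def
  by (intro tendsto_intros conserved_C_tendsto conserved_E_tendsto assms) (use assms in simp)

text \<open>The supremum is 1-Lipschitz for the uniform distance; the common bound \<open>M\<close>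
  guarantees that all suprema exist.\<close>

lemma Sup_range_tendsto:
  fixes f :: "nat \<Rightarrow> 'a \<Rightarrow> real"
  assumes lim: "uniform_limit UNIV f g sequentially"
    and f: "\<And>n t. \<bar>f n t\<bar> \<le> M" and g: "\<And>t. \<bar>g t\<bar> \<le> M"
  shows "(\<lambda>n. Sup (range (f n))) \<longlonglongrightarrow> Sup (range g)"
proof (rule LIMSEQ_I)
  have le: "Sup (range h) \<le> Sup (range k) + e"
    if "\<And>t. \<bar>k t\<bar> \<le> M" "\<And>t. h t \<le> k t + e" for h k :: "'a \<Rightarrow> real" and e
  proof (rule cSUP_least)
    fix t
    have "k t \<le> Sup (range k)"
      by (rule cSUP_upper) (use that(1) in \<open>auto intro!: bdd_aboveI[of _ M] dest: abs_le_D1\<close>)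
    then show "h t \<le> Sup (range k) + e" using that(2)[of t] by simp
  qed simp
  fix r :: real assume "r > 0"
  then have "\<forall>\<^sub>F n in sequentially. \<forall>t\<in>UNIV. dist (f n t) (g t) < r / 2"
    by (intro uniform_limitD[OF lim]) simp
  then obtain N where N: "\<And>n t. n \<ge> N \<Longrightarrow> \<bar>f n t - g t\<bar> < r / 2"
    unfolding eventually_sequentially dist_real_def by blast
  have "norm (Sup (range (f n)) - Sup (range g)) < r" if n: "n \<ge> N" for n
  proof -
    have "f n t \<le> g t + r / 2" "g t \<le> f n t + r / 2" for t
      using N[OF n, of t] by linarith+
    then have "Sup (range (f n)) \<le> Sup (range g) + r / 2" "Sup (range g) \<le> Sup (range (f n)) + r / 2"
      using le[of g "f n"] le[of "f n" g] f g by blast+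
    then show ?thesis using \<open>r > 0\<close> by (simp add: abs_less_iff)
  qed
  then show "\<exists>N. \<forall>n\<ge>N. norm (Sup (range (f n)) - Sup (range g)) < r" by blast
qed

lemma x3_eq: "x3 R u t = rep_H2 u t $ 3"
  by (simp add: x3_def orbit_def x0_def)

lemma abs_x3_le:
  assumes "R > 0" "(lam, u) \<in> zero_set R"
  shows "\<bar>x3 R u t\<bar> \<le> R" "\<bar>x3_min R u\<bar> \<le> R" "\<bar>x3_max R u\<bar> \<le> R"
    "x3_min R u \<le> x3 R u t" "x3 R u t \<le> x3_max R u"
proof -
  have a: "\<bar>x3 R u t\<bar> \<le> R" for t
  proof -
    have "norm (orbit R u t) = R"
      using zero_set_sphere(2)[OF assms(2), of t] assms(1) by (simp add: norm_eq_sqrt_inner)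
    then show ?thesis using component_le_norm_cart[of "orbit R u t" 3] by (simp add: x3_def)
  qed
  then have b: "- R \<le> x3 R u t" "x3 R u t \<le> R" for t by (simp_all add: abs_le_iff minus_le_iff)
  have bdd: "bdd_above (range (x3 R u))" "bdd_below (range (x3 R u))"
    using b by (auto intro!: bdd_aboveI[of _ R] bdd_belowI[of _ "- R"])
  show mn: "x3_min R u \<le> x3 R u t" "x3 R u t \<le> x3_max R u" for t
    unfolding x3_min_def x3_max_def using bdd by (auto intro: cINF_lower cSUP_upper)
  have "- R \<le> x3_min R u" "x3_max R u \<le> R"
    unfolding x3_min_def x3_max_def using b by (auto intro!: cINF_greatest cSUP_least)
  then show "\<bar>x3_min R u\<bar> \<le> R" "\<bar>x3_max R u\<bar> \<le> R"
    using mn[of 0] b[of 0] by (auto simp: abs_le_iff)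
  show "\<bar>x3 R u t\<bar> \<le> R" by (rule a)
qed

context
  fixes R lam :: real and u :: H2 and l :: "nat \<Rightarrow> real" and v :: "nat \<Rightarrow> H2"
  assumes R: "R > 0" and z: "(lam, u) \<in> zero_set R" and zn: "\<And>n. (l n, v n) \<in> zero_set R"
    and l: "l \<longlonglongrightarrow> lam" and v: "C1_convergent_to v u"
begin

lemma x3_uniform_limit: "uniform_limit UNIV (\<lambda>n. x3 R (v n)) (x3 R u) sequentially"
  unfolding x3_eq[abs_def]
  by (rule bounded_linear.uniform_limit[OF bounded_linear_vec_nth])
    (use v in \<open>simp add: C1_convergent_to_def\<close>)

lemma x3_tendsto: "(\<lambda>n. x3 R (v n) t) \<longlonglongrightarrow> x3 R u t"
  by (rule tendsto_uniform_limitI[OF x3_uniform_limit]) simp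

lemma x3_max_tendsto: "(\<lambda>n. x3_max R (v n)) \<longlonglongrightarrow> x3_max R u"
  unfolding x3_max_def
  by (rule Sup_range_tendsto[OF x3_uniform_limit]) (rule abs_x3_le[OF R zn] abs_x3_le[OF R z])+

lemma x3_min_tendsto: "(\<lambda>n. x3_min R (v n)) \<longlonglongrightarrow> x3_min R u"
proof -
  have "(\<lambda>n. Sup (range (\<lambda>t. - x3 R (v n) t))) \<longlonglongrightarrow> Sup (range (\<lambda>t. - x3 R u t))"
    by (rule Sup_range_tendsto[where M = R])
      (use uniform_limit_uminus[OF x3_uniform_limit] abs_x3_le[OF R zn] abs_x3_le[OF R z] in auto)
  then have "(\<lambda>n. - Sup (range (\<lambda>t. - x3 R (v n) t))) \<longlonglongrightarrow> - Sup (range (\<lambda>t. - x3 R u t))"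
    by (rule tendsto_minus)
  then show ?thesis by (simp add: x3_min_def Inf_real_def image_image)
qed

lemma swing_integral_tendsto: "(\<lambda>n. swing_integral R (l n) (v n)) \<longlonglongrightarrow> swing_integral R lam u"
proof -
  have lam: "lam > 0" "l n > 0" for n using zero_set_sphere(1)[OF z] zero_set_sphere(1)[OF zn] by auto
  \<comment> \<open>A bound for the absolute value of the radicand that is uniform in
    \<open>t\<close>; the factor \<open>3 * R\<close> bounds the three heights. It converges, so a
    single constant dominates all integrands. As \<open>sqrt\<close> is odd and defined everywhere,
    the sign of the radicand is irrelevant.\<close>
  define \<kappa> where "\<kappa> n = \<bar>cubic_a2 R (l n) (v n)\<bar> + 2 * l n / R\<^sup>2 * (3 * R)" for n
  have "\<kappa> \<longlonglongrightarrow> \<bar>cubic_a2 R lam u\<bar> + 2 * lam / R\<^sup>2 * (3 * R)"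
    unfolding \<kappa>_def by (intro tendsto_intros cubic_a2_tendsto l v lam R) (use R in simp)
  then have "Bseq \<kappa>" using convergent_imp_Bseq convergentI by blast
  then obtain K where K: "\<And>n. \<bar>\<kappa> n\<bar> \<le> K" unfolding Bseq_def by auto
  let ?h = "\<lambda>lam u t. sqrt (cubic_a2 R lam u - 2 * lam / R\<^sup>2 * (x3_min R u + x3_max R u + x3 R u t))"
  have "(\<lambda>n. integral {0..2*pi} (?h (l n) (v n))) \<longlonglongrightarrow> integral {0..2*pi} (?h lam u)"
  proof (rule dominated_convergence(2)[where h = "\<lambda>t. sqrt K"])
    show "?h (l n) (v n) integrable_on {0..2*pi}" for n
      by (intro integrable_continuous_real continuous_intros continuous_on_x3)
    show "(\<lambda>t. sqrt K) integrable_on {0..2*pi}" by (rule integrable_const_ivl)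
    show "norm (?h (l n) (v n) t) \<le> sqrt K" for n t
    proof -
      have "\<bar>x3_min R (v n) + x3_max R (v n) + x3 R (v n) t\<bar> \<le> 3 * R"
        using abs_x3_le(1)[OF R zn, of n t] abs_x3_le(2,3)[OF R zn, of n] by linarith
      then have "\<bar>2 * l n / R\<^sup>2 * (x3_min R (v n) + x3_max R (v n) + x3 R (v n) t)\<bar> \<le> 2 * l n / R\<^sup>2 * (3 * R)"
        unfolding abs_mult using lam(2)[of n] by (intro mult_mono) auto
      then have "\<bar>cubic_a2 R (l n) (v n) - 2 * l n / R\<^sup>2 * (x3_min R (v n) + x3_max R (v n) + x3 R (v n) t)\<bar> \<le> \<kappa> n"
        unfolding \<kappa>_def by linarith
      also have "\<kappa> n \<le> K" using K[of n] by linarith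
      finally show ?thesis by (simp add: real_sqrt_abs' flip: real_sqrt_abs2)
    qed
    show "(\<lambda>n. ?h (l n) (v n) t) \<longlonglongrightarrow> ?h lam u t" for t
      by (intro tendsto_intros cubic_a2_tendsto l v lam R x3_tendsto x3_min_tendsto x3_max_tendsto)
        (use R in simp)
  qed
  then show ?thesis unfolding swing_integral_def by (intro tendsto_divide tendsto_const) auto
qed

lemma turning_integral_tendsto:
  assumes b: "- R < x3_min R u" "x3_max R u < R" and bn: "\<And>n. - R < x3_min R (v n)" "\<And>n. x3_max R (v n) < R"
  shows "(\<lambda>n. turning_integral R (l n) (v n)) \<longlonglongrightarrow> turning_integral R lam u"
proof -
  have lam: "lam > 0" "l n > 0" for n using zero_set_sphere(1)[OF z] zero_set_sphere(1)[OF zn] by auto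
  \<comment> \<open>The denominators must stay away from zero uniformly. The largest height
    \<open>s\<close> attained in absolute value gives the lower bound \<open>R^2 - (s w)^2\<close>,
    and this bound converges to a positive number.\<close>
  define s where "s w = max \<bar>x3_min R w\<bar> \<bar>x3_max R w\<bar>" for w
  have s: "0 < R\<^sup>2 - (s w)\<^sup>2 \<and> (\<forall>t. R\<^sup>2 - (s w)\<^sup>2 \<le> R\<^sup>2 - (x3 R w t)\<^sup>2)"
    if "(m, w) \<in> zero_set R" "- R < x3_min R w" "x3_max R w < R" for w m
  proof
    note a = abs_x3_le[OF R that(1)]
    have "s w < R" "0 \<le> s w" using that(2,3) a(4,5)[of 0] by (auto simp: s_def)
    then show "0 < R\<^sup>2 - (s w)\<^sup>2" using power_strict_mono[of "s w" R 2] by simp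
    have "\<bar>x3 R w t\<bar> \<le> s w" for t using a(4,5)[of t] by (auto simp: s_def)
    then have "(x3 R w t)\<^sup>2 \<le> (s w)\<^sup>2" for t by (metis abs_ge_zero power2_abs power_mono)
    then show "\<forall>t. R\<^sup>2 - (s w)\<^sup>2 \<le> R\<^sup>2 - (x3 R w t)\<^sup>2" by simp
  qed
  note su = s[OF z b] and sn = s[OF zn bn]
  define \<kappa> where "\<kappa> n = (\<bar>conserved_C R (l n) (v n) 0\<bar> + l n * R) / (R\<^sup>2 - (s (v n))\<^sup>2)" for n
  have "\<kappa> \<longlonglongrightarrow> (\<bar>conserved_C R lam u 0\<bar> + lam * R) / (R\<^sup>2 - (s u)\<^sup>2)"
    unfolding \<kappa>_def s_def
    by (intro tendsto_intros conserved_C_tendsto l v x3_min_tendsto x3_max_tendsto)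
      (use su in \<open>simp add: s_def\<close>)
  then have "Bseq \<kappa>" using convergent_imp_Bseq convergentI by blast
  then obtain K where K: "\<And>n. \<bar>\<kappa> n\<bar> \<le> K" unfolding Bseq_def by auto
  let ?h = "\<lambda>lam u t. (conserved_C R lam u 0 - lam * x3 R u t) / (R\<^sup>2 - (x3 R u t)\<^sup>2)"
  have "(\<lambda>n. integral {0..2*pi} (?h (l n) (v n))) \<longlonglongrightarrow> integral {0..2*pi} (?h lam u)"
  proof (rule dominated_convergence(2)[where h = "\<lambda>t. K"])
    have p: "0 < R\<^sup>2 - (x3 R (v n) t)\<^sup>2" for n t using sn[of n] by (meson less_le_trans)
    show "?h (l n) (v n) integrable_on {0..2*pi}" for n
      by (intro integrable_continuous_real continuous_intros continuous_on_x3 ballI less_imp_neq[OF p, symmetric])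
    show "(\<lambda>t. K) integrable_on {0..2*pi}" by (rule integrable_const_ivl)
    show "norm (?h (l n) (v n) t) \<le> K" for n t
    proof -
      have "\<bar>l n * x3 R (v n) t\<bar> \<le> l n * R"
        unfolding abs_mult using lam(2)[of n] abs_x3_le(1)[OF R zn, of n t] by (intro mult_mono) auto
      then have "\<bar>conserved_C R (l n) (v n) 0 - l n * x3 R (v n) t\<bar> \<le> \<bar>conserved_C R (l n) (v n) 0\<bar> + l n * R"
        by linarith
      moreover have "0 < R\<^sup>2 - (s (v n))\<^sup>2" "R\<^sup>2 - (s (v n))\<^sup>2 \<le> R\<^sup>2 - (x3 R (v n) t)\<^sup>2" using sn[of n] by auto
      ultimately have "\<bar>?h (l n) (v n) t\<bar> \<le> \<kappa> n"
        unfolding \<kappa>_def abs_divide by (intro frac_le) auto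
      then show ?thesis using K[of n] by simp
    qed
    show "(\<lambda>n. ?h (l n) (v n) t) \<longlonglongrightarrow> ?h lam u t" for t
    proof (intro tendsto_intros conserved_C_tendsto l v x3_tendsto)
      show "R\<^sup>2 - (x3 R u t)\<^sup>2 \<noteq> 0" using su by (metis less_le_trans less_irrefl)
    qed
  qed
  then show ?thesis unfolding turning_integral_def by (intro tendsto_divide tendsto_const) auto
qed

end

section \<open>Values at the bifurcation point and constancy on components\<close>

lemma rep_H2_zero: "rep_H2 0 t = 0" by (simp add: zero_H2.rep_eq)

lemma D1_zero: "D1 0 t = 0" using D1_scaleR[of 0 0 t] by simp

lemma trivial_zero:
  assumes "lam > 0"
  shows "(lam, 0) \<in> zero_set R"
proof -
  have "weak_second_deriv (rep_H2 0) (\<lambda>t. 0)"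
    using weak_second_deriv_zero by (simp add: zero_H2.rep_eq)
  from weak_second_deriv_unique[OF weak_second_deriv_D2 this]
  have "AE t in lborel. t \<in> {0..2*pi} \<longrightarrow> F_map R lam 0 t = 0"
    by eventually_elim (simp add: F_map_def rep_H2_zero D1_zero)
  then show ?thesis using assms by (simp add: zero_set_def C_map_def rep_H2_zero)
qed

lemma trivial_x3: "x3 R 0 t = 0" "x3_min R 0 = 0" "x3_max R 0 = 0"
  by (simp_all add: x3_eq[abs_def] x3_min_def x3_max_def rep_H2_zero)

lemma trivial_conserved_C: "conserved_C R lam 0 0 = R\<^sup>2"
  by (simp add: conserved_C_def orbit_def orbit'_eq rep_H2_zero D1_zero x0_def x0'_def cross_components
      power2_eq_square)

lemma trivial_cubic_a2:
  assumes "lam > 0" "R > 0"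
  shows "cubic_a2 R lam 0 = 1 + lam\<^sup>2 / R\<^sup>2"
proof -
  have "conserved_E R lam 0 0 = - (lam * R\<^sup>2 / 2)"
    by (simp add: conserved_E_alt orbit_def orbit'_eq rep_H2_zero D1_zero x0_def x0'_def
        cross_components inner_vec_def sum_3 power2_eq_square)
  then show ?thesis
    using assms by (simp add: cubic_a2_def trivial_conserved_C field_simps power2_eq_square power3_eq_cube)
qed

lemma trivial_turning_integral: "R > 0 \<Longrightarrow> turning_integral R lam 0 = 1"
  by (simp add: turning_integral_def trivial_x3 trivial_conserved_C)

lemma bif_value_pos: "R > 0 \<Longrightarrow> k \<ge> 2 \<Longrightarrow> bif_value R k > 0"
proof -
  assume "R > 0" "k \<ge> 2"
  then have "1 < (real k)\<^sup>2" by (intro one_less_power) auto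
  with \<open>R > 0\<close> show ?thesis by (simp add: bif_value_def)
qed

text \<open>The radicand at the trivial solution is the constant \<open>1 + lam^2 / R^2\<close>;
  \<open>bif_value R k\<close> is the positive parameter for which it equals
  \<open>k^2\<close>.\<close>

lemma trivial_swing_integral:
  assumes "R > 0" "k \<ge> 2"
  shows "swing_integral R (bif_value R k) 0 = real k"
proof -
  have "1 \<le> (real k)\<^sup>2" using assms by (intro one_le_power) auto
  then have "cubic_a2 R (bif_value R k) 0 = (real k)\<^sup>2"
    unfolding trivial_cubic_a2[OF bif_value_pos[OF assms] assms(1)]
    using assms by (simp add: bif_value_def power_mult_distrib)
  then show ?thesis by (simp add: swing_integral_def trivial_x3)
qed

lemma Z_reg_bounds:
  assumes "(lam, u) \<in> Z_reg R"
  shows "(lam, u) \<in> zero_set R" "- R < x3_min R u" "x3_max R u < R" "\<bar>x3 R u t\<bar> < R"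
proof -
  obtain r1 r2 where "is_minimum (x3 R u) r1" "is_maximum (x3 R u) r2" "- R < r1" "r2 < R"
    using assms by (auto simp: Z_reg_def)
  then show "- R < x3_min R u" "x3_max R u < R"
    by (simp_all add: x3_min_def x3_max_def is_minimum_Inf is_maximum_Sup)
  have "- R < x3 R u t \<and> x3 R u t < R" using assms by (simp add: Z_reg_def)
  then show "\<bar>x3 R u t\<bar> < R" by (simp add: abs_less_iff)
  show "(lam, u) \<in> zero_set R" using assms by (simp add: Z_reg_def)
qed

lemma Z_reg_invariants:
  assumes R: "R > 0" and z: "(lam, u) \<in> Z_reg R"
  shows "horizontal_degree R u = turning_integral R lam u" "turning_integral R lam u \<in> \<int>"
    "swing_integral R lam u \<in> \<int>"
    "swing_integral R lam u = real k \<Longrightarrow> vertical_nodal_number R u k"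
proof -
  show "horizontal_degree R u = turning_integral R lam u" "turning_integral R lam u \<in> \<int>"
    using horizontal_degree_eq_turning_integral[OF R Z_reg_bounds(1,4)[OF z]] .
  obtain q where "vertical_nodal_number R u q" "swing_integral R lam u = real q"
    by (rule Z_reg_nodal_number[OF R z])
  then show "swing_integral R lam u \<in> \<int>"
    "swing_integral R lam u = real k \<Longrightarrow> vertical_nodal_number R u k" by simp_all
qed

section \<open>Local constancy of the invariants\<close>

lemma H2_tendsto_C1: "v \<longlonglongrightarrow> u \<Longrightarrow> C1_convergent_to v u"
  unfolding C1_convergent_to_def using H2_tendsto_uniform[of v u sequentially] by blast

lemma continuous_on_invariants:
  assumes R: "R > 0"
  shows "continuous_on (Z_reg R) (\<lambda>z. turning_integral R (fst z) (snd z))"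
    and "continuous_on (Z_reg R) (\<lambda>z. swing_integral R (fst z) (snd z))"
  unfolding continuous_on_sequentially o_def
proof safe
  fix x :: "nat \<Rightarrow> real \<times> H2" and lam u
  assume a: "(lam, u) \<in> Z_reg R" and "\<forall>n. x n \<in> Z_reg R" and lim: "x \<longlonglongrightarrow> (lam, u)"
  then have x: "(fst (x n), snd (x n)) \<in> Z_reg R" for n by simp
  have l: "(\<lambda>n. fst (x n)) \<longlonglongrightarrow> lam" "C1_convergent_to (\<lambda>n. snd (x n)) u"
    using tendsto_fst[OF lim] H2_tendsto_C1[OF tendsto_snd[OF lim]] by simp_all
  show "(\<lambda>n. turning_integral R (fst (x n)) (snd (x n))) \<longlonglongrightarrow> turning_integral R (fst (lam, u)) (snd (lam, u))"
    using turning_integral_tendsto[OF R Z_reg_bounds(1)[OF a] Z_reg_bounds(1)[OF x] l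
        Z_reg_bounds(2,3)[OF a] Z_reg_bounds(2,3)[OF x]] by simp
  show "(\<lambda>n. swing_integral R (fst (x n)) (snd (x n))) \<longlonglongrightarrow> swing_integral R (fst (lam, u)) (snd (lam, u))"
    using swing_integral_tendsto[OF R Z_reg_bounds(1)[OF a] Z_reg_bounds(1)[OF x] l] by simp
qed

lemma continuous_Ints_constant:
  fixes f :: "'a::topological_space \<Rightarrow> real"
  assumes "connected S" "continuous_on S f" "\<And>x. x \<in> S \<Longrightarrow> f x \<in> \<int>" "a \<in> S" "b \<in> S"
  shows "f a = f b"
proof -
  have "f constant_on S"
  proof (rule continuous_discrete_range_constant[OF assms(1,2)])
    fix x assume x: "x \<in> S"
    have "1 \<le> norm (f y - f x)" if "y \<in> S" "f y \<noteq> f x" for y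
      using Ints_eq_abs_less1[OF assms(3)[OF that(1)] assms(3)[OF x]] that(2) by simp
    then show "\<exists>e>0. \<forall>y. y \<in> S \<and> f y \<noteq> f x \<longrightarrow> e \<le> norm (f y - f x)"
      by (intro exI[of _ 1]) auto
  qed
  then show ?thesis using assms(4,5) by (auto simp: constant_on_def)
qed

text \<open>Continuity on the regular class does not reach the limit point, where \<open>x3\<close>
  is constant. The convergence lemmas ask only for a limit in \<open>zero_set\<close>, and an
  integer at distance less than \<open>1\<close> from an integer equals it.\<close>

lemma invariants_near_bifurcation:
  assumes R: "R > 0" and k: "k \<ge> 2"
    and z: "\<And>n. (l n, v n) \<in> Z_reg R" and l: "l \<longlonglongrightarrow> bif_value R k" and v: "C1_convergent_to v 0"
  shows "\<forall>\<^sub>F n in sequentially. turning_integral R (l n) (v n) = 1 \<and> swing_integral R (l n) (v n) = real k"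
proof -
  note t = trivial_zero[OF bif_value_pos[OF R k]]
  have "(\<lambda>n. turning_integral R (l n) (v n)) \<longlonglongrightarrow> 1"
    using turning_integral_tendsto[OF R t Z_reg_bounds(1)[OF z] l v _ _ Z_reg_bounds(2,3)[OF z]] R
    by (simp add: trivial_x3 trivial_turning_integral)
  moreover have "(\<lambda>n. swing_integral R (l n) (v n)) \<longlonglongrightarrow> real k"
    using swing_integral_tendsto[OF R t Z_reg_bounds(1)[OF z] l v]
    by (simp add: trivial_swing_integral[OF R k])
  ultimately have "\<forall>\<^sub>F n in sequentially. dist (turning_integral R (l n) (v n)) 1 < 1"
    "\<forall>\<^sub>F n in sequentially. dist (swing_integral R (l n) (v n)) (real k) < 1"
    by (auto intro: tendstoD)
  then show ?thesis
  proof eventually_elim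
    case (elim n)
    then show ?case
      using Ints_eq_abs_less1[OF Z_reg_invariants(2)[OF R z, of n], of 1]
        Ints_eq_abs_less1[OF Z_reg_invariants(3)[OF R z, of n], of "real k"]
      by (simp add: dist_real_def)
  qed
qed

section \<open>Phase translates of the local branch\<close>

lemma rot3_bounded_linear: "bounded_linear (rot3 \<phi>)"
proof -
  have "linear (rot3 \<phi>)"
    by (rule linearI) (simp_all add: rot3_def vec_eq_iff forall_3 algebra_simps)
  then show ?thesis by (simp add: linear_conv_bounded_linear)
qed

lemma norm_rot3: "norm (rot3 \<phi> v) = norm v"
proof -
  have "(cos \<phi> * a - sin \<phi> * b)\<^sup>2 + (sin \<phi> * a + cos \<phi> * b)\<^sup>2 = ((cos \<phi>)\<^sup>2 + (sin \<phi>)\<^sup>2) * (a\<^sup>2 + b\<^sup>2)" for a b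
    by (simp add: power2_eq_square algebra_simps del: sin_cos_squared_add sin_cos_squared_add2 sin_cos_squared_add3)
  from this[of "v $ 1" "v $ 2"] have "rot3 \<phi> v \<bullet> rot3 \<phi> v = v \<bullet> v"
    by (simp add: rot3_def inner_vec_def sum_3 power2_eq_square)
  then show ?thesis by (simp add: norm_eq_sqrt_inner)
qed

lemma phase_translate_refl: "phase_translate 0 u u"
  by (simp add: phase_translate_def rot3_def vec_eq_iff forall_3)

lemma phase_translate_norms:
  assumes "phase_translate \<phi> u w"
  shows "norm (rep_H2 w t) = norm (rep_H2 u (t - \<phi>))" "norm (D1 w t) = norm (D1 u (t - \<phi>))"
proof -
  have w: "rep_H2 w = (\<lambda>t. rot3 \<phi> (rep_H2 u (t - \<phi>)))"
    using assms by (auto simp: phase_translate_def)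
  show "norm (rep_H2 w t) = norm (rep_H2 u (t - \<phi>))" by (simp add: w norm_rot3)
  have "((\<lambda>s. rep_H2 u (s + - \<phi>)) has_vector_derivative D1 u (t + - \<phi>)) (at t)"
    by (rule has_vector_derivative_shift_const)
      (rule has_vector_derivative_at_within[OF has_vector_derivative_D1])
  then have "(rep_H2 w has_vector_derivative rot3 \<phi> (D1 u (t - \<phi>))) (at t)"
    unfolding w by (intro bounded_linear.has_vector_derivative[OF rot3_bounded_linear]) simp
  then have "D1 w t = rot3 \<phi> (D1 u (t - \<phi>))"
    using has_vector_derivative_D1 vector_derivative_unique_at by blast
  then show "norm (D1 w t) = norm (D1 u (t - \<phi>))" by (simp add: norm_rot3)
qed

text \<open>A rotation is an isometry and a shift does not change a supremum over the line, so the
  angles may vary with \<open>n\<close> without any control.\<close>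

lemma phase_translate_C1_null:
  assumes b: "b \<longlonglongrightarrow> (0::H2)" and w: "\<And>n. phase_translate (\<phi> n) (b n) (w n)"
  shows "C1_convergent_to w 0"
proof -
  obtain K where K: "K > 0" "\<And>u t. norm (rep_H2 u t) \<le> K * norm u" "\<And>u t. norm (D1 u t) \<le> K * norm u"
    using H2_sup_bound by blast
  have ev: "\<forall>\<^sub>F n in sequentially. K * norm (b n) < e" if "e > 0" for e
  proof -
    have "(\<lambda>n. K * norm (b n)) \<longlonglongrightarrow> K * norm (0::H2)" by (intro tendsto_intros b)
    then show ?thesis using order_tendstoD(2)[of _ "K * norm (0::H2)" sequentially e] that by simp
  qed
  show ?thesis
    unfolding C1_convergent_to_def
  proof (intro conjI uniform_limitI)
    fix e :: real assume "e > 0"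
    from ev[OF this] show "\<forall>\<^sub>F n in sequentially. \<forall>x\<in>UNIV. dist (rep_H2 (w n) x) (rep_H2 0 x) < e"
      by eventually_elim
        (simp add: rep_H2_zero phase_translate_norms(1)[OF w] order.strict_trans1[OF K(2)])
    from ev[OF \<open>e > 0\<close>] show "\<forall>\<^sub>F n in sequentially. \<forall>x\<in>UNIV. dist (D1 (w n) x) (D1 0 x) < e"
      by eventually_elim
        (simp add: D1_zero phase_translate_norms(2)[OF w] order.strict_trans1[OF K(3)])
  qed
qed

lemma smooth_curve_isCont:
  assumes "smooth_curve_on I f" "t \<in> I"
  shows "isCont f t"
  using assms unfolding smooth_curve_on_def by (metis has_vector_derivative_continuous)

text \<open>The threshold has to be independent of the phase. If none existed, choosing a
  counterexample below \<open>\<delta> / Suc n\<close> for each \<open>n\<close> would give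
  parameters tending to \<open>0\<close>, and their translates would converge to the trivial
  solution whatever the angles.\<close>

lemma local_branch_invariants:
  assumes R: "R > 0" and k: "k \<ge> 2" and lb: "local_branch R k \<delta> \<Lambda> \<Gamma>"
  obtains \<epsilon> where "0 < \<epsilon>" "\<epsilon> \<le> \<delta>"
    "\<And>t \<phi> w. \<bar>t\<bar> < \<epsilon> \<Longrightarrow> phase_translate \<phi> (branch k \<Gamma> t) w \<Longrightarrow> (\<Lambda> t, w) \<in> Z_reg R \<Longrightarrow>
      turning_integral R (\<Lambda> t) w = 1 \<and> swing_integral R (\<Lambda> t) w = real k"
proof -
  have d: "\<delta> > 0" and L: "isCont \<Lambda> 0" "\<Lambda> 0 = bif_value R k" and G: "isCont \<Gamma> 0"
    using lb by (auto simp: local_branch_def intro: smooth_curve_isCont)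
  have "\<exists>n. \<forall>t \<phi> w. \<bar>t\<bar> < \<delta> / real (Suc n) \<longrightarrow> phase_translate \<phi> (branch k \<Gamma> t) w \<longrightarrow> (\<Lambda> t, w) \<in> Z_reg R \<longrightarrow>
      turning_integral R (\<Lambda> t) w = 1 \<and> swing_integral R (\<Lambda> t) w = real k"
  proof (rule ccontr)
    assume "\<not> ?thesis"
    then obtain t \<phi> w where t: "\<And>n. \<bar>t n\<bar> < \<delta> / real (Suc n)"
      and w: "\<And>n. phase_translate (\<phi> n) (branch k \<Gamma> (t n)) (w n)"
      and z: "\<And>n. (\<Lambda> (t n), w n) \<in> Z_reg R"
      and bad: "\<And>n. \<not> (turning_integral R (\<Lambda> (t n)) (w n) = 1 \<and> swing_integral R (\<Lambda> (t n)) (w n) = real k)"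
      by metis
    have "(\<lambda>n. \<delta> / real (Suc n)) \<longlonglongrightarrow> 0"
      using LIMSEQ_ignore_initial_segment[OF lim_const_over_n[of \<delta>], of 1] by simp
    then have t0: "t \<longlonglongrightarrow> 0"
      by (rule Lim_null_comparison[rotated]) (use t in \<open>auto intro!: always_eventually less_imp_le\<close>)
    have "(\<lambda>n. \<Lambda> (t n)) \<longlonglongrightarrow> bif_value R k"
      using isCont_tendsto_compose[OF L(1) t0] L(2) by simp
    moreover have "(\<lambda>n. branch k \<Gamma> (t n)) \<longlonglongrightarrow> 0 *\<^sub>R (kernel_mode k + \<Gamma> 0)"
      unfolding branch_def by (intro tendsto_intros t0 isCont_tendsto_compose[OF G t0])
    then have "C1_convergent_to w 0" by (intro phase_translate_C1_null[OF _ w]) simp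
    ultimately have "\<forall>\<^sub>F n in sequentially. False"
      using invariants_near_bifurcation[OF R k z] bad by simp
    then show False by simp
  qed
  then obtain n where "\<And>t \<phi> w. \<bar>t\<bar> < \<delta> / real (Suc n) \<Longrightarrow> phase_translate \<phi> (branch k \<Gamma> t) w \<Longrightarrow> (\<Lambda> t, w) \<in> Z_reg R \<Longrightarrow>
      turning_integral R (\<Lambda> t) w = 1 \<and> swing_integral R (\<Lambda> t) w = real k" by blast
  moreover have "0 < \<delta> / real (Suc n)" "\<delta> / real (Suc n) \<le> \<delta>"
    using d by (auto simp: field_simps)
  ultimately show ?thesis using that by blast
qed

section \<open>Compactness\<close>

lemma norm_diff_le_of_derivative_bound:
  fixes f :: "real \<Rightarrow> 'a::real_normed_vector"
  assumes "\<And>t. (f has_vector_derivative f' t) (at t)" "\<And>t. norm (f' t) \<le> B"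
  shows "norm (f s - f t) \<le> B * \<bar>s - t\<bar>"
proof -
  have "norm (f s - f t) \<le> B * norm (s - t)"
    by (rule differentiable_bound[of UNIV _ "\<lambda>t h. h *\<^sub>R f' t"])
      (use assms in \<open>auto simp: has_vector_derivative_def onorm_scaleR_left onorm_id\<close>)
  then show ?thesis by simp
qed

text \<open>All three heights are at most \<open>R\<close>, so the radicand is at least
  \<open>cubic_a2 - 6 * lam / R\<close>, and the mean of its square root is at least the root of
  this constant.\<close>

lemma cubic_a2_le_swing_integral:
  assumes R: "R > 0" and z: "(lam, u) \<in> zero_set R"
  shows "cubic_a2 R lam u \<le> (swing_integral R lam u)\<^sup>2 + 6 * lam / R"
proof -
  have lam: "lam > 0" by (rule zero_set_sphere(1)[OF z])
  define c where "c = cubic_a2 R lam u - 6 * lam / R"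
  let ?g = "\<lambda>t. cubic_a2 R lam u - 2 * lam / R\<^sup>2 * (x3_min R u + x3_max R u + x3 R u t)"
  have c: "c \<le> ?g t" for t
  proof -
    have "x3_min R u + x3_max R u + x3 R u t \<le> 3 * R"
      using abs_x3_le(1)[OF R z, of t] abs_x3_le(2,3)[OF R z] by linarith
    then have "2 * lam / R\<^sup>2 * (x3_min R u + x3_max R u + x3 R u t) \<le> 2 * lam / R\<^sup>2 * (3 * R)"
      using lam by (intro mult_left_mono) auto
    also have "\<dots> = 6 * lam / R" using R by (simp add: field_simps power2_eq_square)
    finally show ?thesis by (simp add: c_def)
  qed
  have "integral {0..2*pi} (\<lambda>t. sqrt c) \<le> integral {0..2*pi} (\<lambda>t. sqrt (?g t))"
    by (intro integral_le integrable_continuous_real continuous_intros continuous_on_x3 real_sqrt_le_mono c)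
  then have "sqrt c \<le> swing_integral R lam u"
    unfolding swing_integral_def by (simp add: field_simps)
  \<comment> \<open>\<open>c\<close> may be negative; its \<open>sqrt\<close> is then negative as
    well and the conclusion still holds.\<close>
  then have "c \<le> (swing_integral R lam u)\<^sup>2" by (rule sqrt_le_D)
  then show ?thesis by (simp add: c_def)
qed

lemma continuous_on_accel:
  "continuous_on S (\<lambda>p. accel R (fst p) (fst (snd p)) (snd (snd p)))"
  unfolding accel_def by (intro continuous_intros continuous_on_cross)

section \<open>Limits of periodic curves and a classical bound for the norm\<close>

text \<open>A limit obtained on one period is unspecified outside it. Transporting each point back
  to the base period defines a limit on the line, and its periodicity follows from uniqueness of
  pointwise limits.\<close>

lemma uniform_limit_periodic:
  fixes f :: "nat \<Rightarrow> real \<Rightarrow> 'a::metric_space"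
  assumes lim: "uniform_limit {0..2*pi} f g sequentially" and per: "\<And>n t. f n (t + 2*pi) = f n t"
  obtains h where "uniform_limit UNIV f h sequentially" "\<And>t. h (t + 2*pi) = h t"
proof -
  define m where "m t = (SOME n::int. t + 2*pi * of_int n \<in> {0..2*pi})" for t :: real
  have m: "t + 2*pi * of_int (m t) \<in> {0..2*pi}" for t
    unfolding m_def using shift_into_period[of t] by (metis someI_ex)
  define h where "h t = g (t + 2*pi * of_int (m t))" for t
  have f: "f n (t + 2*pi * of_int (m t)) = f n t" for n t
    by (rule periodic_shift_int) (rule per)
  have h: "uniform_limit UNIV f h sequentially"
  proof (rule uniform_limitI)
    fix e :: real assume "e > 0"
    from uniform_limitD[OF lim this]
    show "\<forall>\<^sub>F n in sequentially. \<forall>t\<in>UNIV. dist (f n t) (h t) < e"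
    proof eventually_elim
      case (elim n)
      then have "dist (f n (t + 2*pi * of_int (m t))) (h t) < e" for t using m by (simp add: h_def)
      then show ?case by (simp add: f)
    qed
  qed
  have pw: "(\<lambda>n. f n t) \<longlonglongrightarrow> h t" for t by (rule tendsto_uniform_limitI[OF h]) simp
  have "h (t + 2*pi) = h t" for t
    using LIMSEQ_unique[OF pw[of "t + 2*pi", unfolded per] pw] .
  with h show ?thesis by (rule that)
qed

lemma has_vector_derivative_uniform_limit:
  fixes f :: "nat \<Rightarrow> real \<Rightarrow> 'a::banach"
  assumes f: "\<And>n t. (f n has_vector_derivative f' n t) (at t)"
    and lim': "uniform_limit UNIV f' g' sequentially" and lim: "\<And>t. (\<lambda>n. f n t) \<longlonglongrightarrow> g t"
  shows "(g has_vector_derivative g' t) (at t)"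
proof -
  have "\<exists>h. \<forall>x\<in>UNIV. (\<lambda>n. f n x) \<longlonglongrightarrow> h x \<and> (h has_derivative (\<lambda>y. y *\<^sub>R g' x)) (at x within UNIV)"
  proof (rule has_derivative_sequence[OF convex_UNIV _ _ UNIV_I lim])
    show "(f n has_derivative (\<lambda>y. y *\<^sub>R f' n x)) (at x within UNIV)" for n x
      using f by (simp add: has_vector_derivative_def)
    fix e :: real assume "e > 0"
    from uniform_limitD[OF lim' this]
    show "\<forall>\<^sub>F n in sequentially. \<forall>x\<in>UNIV. \<forall>y. norm (y *\<^sub>R f' n x - y *\<^sub>R g' x) \<le> e * norm y"
    proof eventually_elim
      case (elim n)
      have "norm (y *\<^sub>R f' n x - y *\<^sub>R g' x) \<le> e * norm y" for x y
      proof -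
        have "norm (y *\<^sub>R f' n x - y *\<^sub>R g' x) = \<bar>y\<bar> * norm (f' n x - g' x)"
          by (simp flip: scaleR_diff_right)
        also have "\<dots> \<le> \<bar>y\<bar> * e"
          using elim by (intro mult_left_mono) (auto simp: dist_norm less_imp_le)
        finally show ?thesis by (simp add: mult.commute)
      qed
      then show ?case by blast
    qed
  qed
  then obtain h where h: "\<And>x. (\<lambda>n. f n x) \<longlonglongrightarrow> h x" "\<And>x. (h has_vector_derivative g' x) (at x)"
    by (auto simp: has_vector_derivative_def)
  have "h = g" using LIMSEQ_unique[OF h(1) lim] by blast
  with h(2) show ?thesis by simp
qed

lemma weak_second_deriv_C2:
  assumes d: "\<And>t. (f has_vector_derivative f' t) (at t)" "\<And>t. (f' has_vector_derivative f'' t) (at t)"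
    and c: "continuous_on UNIV f''"
  shows "weak_second_deriv f f''"
  unfolding weak_second_deriv_def
proof (intro conjI exI[of _ f'] allI ballI d)
  show "L2_2pi f''"
    unfolding L2_2pi_def
    by (intro conjI borel_measurable_continuous_onI[OF c] borel_integrable_atLeastAtMost'
        continuous_intros continuous_on_subset[OF c]) auto
  fix t assume t: "t \<in> {0..2*pi}"
  have "(LBINT s:{0..t}. f'' s) = f' t - f' 0"
    unfolding set_lebesgue_integral_def
    by (rule integral_FTC_atLeastAtMost)
      (use t continuous_on_subset[OF c] has_vector_derivative_at_within[OF d(2)] in auto)
  then show "f' t = f' 0 + (LBINT s:{0..t}. f'' s)" by simp
qed

text \<open>Three squared terms, each at most \<open>e^2\<close>, are integrated over length
  \<open>2*pi\<close>. The chosen \<open>D2 w\<close> may be replaced by the classical second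
  derivative because the two agree almost everywhere.\<close>

lemma norm_H2_le_C2:
  assumes d: "\<And>t. (rep_H2 w has_vector_derivative w' t) (at t)" "\<And>t. (w' has_vector_derivative w'' t) (at t)"
    and c: "continuous_on UNIV w''"
    and b: "\<And>t. norm (rep_H2 w t) \<le> e" "\<And>t. norm (w' t) \<le> e" "\<And>t. norm (w'' t) \<le> e"
  shows "(norm w)\<^sup>2 \<le> 6 * pi * e\<^sup>2"
proof -
  let ?g = "\<lambda>t. rep_H2 w t \<bullet> rep_H2 w t + w' t \<bullet> w' t + w'' t \<bullet> w'' t"
  have D1: "D1 w t = w' t" for t
    unfolding D1_def by (rule vector_derivative_at[OF d(1)])
  have c': "continuous_on {0..2*pi} w'"
    by (rule continuous_at_imp_continuous_on) (auto intro: has_vector_derivative_continuous[OF d(2)])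
  have i: "set_integrable lborel {0..2*pi} ?g"
    by (intro borel_integrable_atLeastAtMost' continuous_intros continuous_on_rep_H2 c'
        continuous_on_subset[OF c]) auto
  have "(norm w)\<^sup>2 = (LBINT t:{0..2*pi}. rep_H2 w t \<bullet> rep_H2 w t + D1 w t \<bullet> D1 w t + D2 w t \<bullet> D2 w t)"
    by (simp add: power2_norm_eq_inner inner_H2_def)
  also have "\<dots> = (LBINT t:{0..2*pi}. ?g t)"
  proof (rule set_integral_eq_AE[OF H2_inner_integrable i])
    show "AE t in lborel. t \<in> {0..2*pi} \<longrightarrow>
      rep_H2 w t \<bullet> rep_H2 w t + D1 w t \<bullet> D1 w t + D2 w t \<bullet> D2 w t = ?g t"
      using weak_second_deriv_unique[OF weak_second_deriv_D2 weak_second_deriv_C2[OF d c]]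
      by eventually_elim (simp add: D1)
  qed
  also have "\<dots> = integral {0..2*pi} ?g" by (rule set_borel_integral_eq_integral(2)[OF i])
  also have "\<dots> \<le> integral {0..2*pi} (\<lambda>t. 3 * e\<^sup>2)"
  proof (rule integral_le[OF set_borel_integral_eq_integral(1)[OF i]])
    have sq: "x \<bullet> x \<le> e\<^sup>2" if "norm x \<le> e" for x :: "real^3"
      using power_mono[OF that norm_ge_zero, of 2] by (simp add: power2_norm_eq_inner)
    show "?g t \<le> 3 * e\<^sup>2" for t using sq[OF b(1)[of t]] sq[OF b(2)[of t]] sq[OF b(3)[of t]] by linarith
  qed (rule integrable_const_ivl)
  also have "\<dots> = 6 * pi * e\<^sup>2" by simp
  finally show ?thesis .
qed

text \<open>A bound on the parameter and on the nodal number bounds the speed, hence by the differential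
  equation the acceleration; Arzela-Ascoli applies to position and velocity, and the differential
  equation turns their convergence into convergence of the second derivatives.\<close>

lemma zero_set_subsequence_convergent:
  fixes l :: "nat \<Rightarrow> real" and v :: "nat \<Rightarrow> H2"
  assumes R: "R > 0" and z: "\<And>n. (l n, v n) \<in> zero_set R"
    and L: "\<And>n. l n \<le> L" and k: "\<And>n. swing_integral R (l n) (v n) = k"
  obtains r lam u where "strict_mono r" "(\<lambda>n. (l (r n), v (r n))) \<longlonglongrightarrow> (lam, u)"
proof -
  have l0: "l n > 0" for n by (rule zero_set_sphere(1)[OF z])
  \<comment> \<open>The square root of the largest value that \<open>orbit'_norm2\<close> allows:
    \<open>cubic_a2\<close> is bounded through the swing integral, \<open>- lam^2\<close> is
    dropped, and \<open>x3 \<ge> - R\<close> is used in the last term.\<close>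
  define B where "B = sqrt (R\<^sup>2 * (k\<^sup>2 + 6 * L / R) + 2 * L * R)"
  have x: "norm (orbit R (v n) t) \<le> R" for n t
    using zero_set_sphere(2)[OF z, of n t] R by (simp add: norm_eq_sqrt_inner)
  have v: "norm (orbit' R (v n) t) \<le> B" for n t
  proof -
    have "cubic_a2 R (l n) (v n) \<le> k\<^sup>2 + 6 * l n / R"
      using cubic_a2_le_swing_integral[OF R z, of n] k by simp
    also have "\<dots> \<le> k\<^sup>2 + 6 * L / R" using L[of n] R by (simp add: divide_right_mono)
    finally have "R\<^sup>2 * cubic_a2 R (l n) (v n) \<le> R\<^sup>2 * (k\<^sup>2 + 6 * L / R)" by (intro mult_left_mono) auto
    moreover have "- (2 * l n * x3 R (v n) t) \<le> 2 * L * R"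
    proof -
      have "- (2 * l n * x3 R (v n) t) \<le> \<bar>2 * l n\<bar> * \<bar>x3 R (v n) t\<bar>"
        using abs_ge_minus_self[of "2 * l n * x3 R (v n) t"] by (simp add: abs_mult)
      also have "\<dots> \<le> (2 * L) * R"
        using abs_x3_le(1)[OF R z, of n t] L[of n] l0[of n] by (intro mult_mono) auto
      finally show ?thesis .
    qed
    ultimately have "orbit' R (v n) t \<bullet> orbit' R (v n) t \<le> R\<^sup>2 * (k\<^sup>2 + 6 * L / R) + 2 * L * R"
      unfolding orbit'_norm2[OF R z] using zero_le_power2[of "l n"] by linarith
    then show ?thesis unfolding B_def norm_eq_sqrt_inner by (rule real_sqrt_le_mono)
  qed
  \<comment> \<open>A compact region of parameters and states containing all the solutions and,
    being closed, their limits; it includes \<open>lam = 0\<close>. \<open>accel\<close> is bounded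
    and uniformly continuous on it.\<close>
  define \<K> where "\<K> = {0..L} \<times> (cball (0::real^3) R \<times> cball (0::real^3) B)"
  define \<Phi> where "\<Phi> p = accel R (fst p) (fst (snd p)) (snd (snd p))" for p :: "real \<times> (real^3) \<times> (real^3)"
  have comp: "compact \<K>" unfolding \<K>_def by (intro compact_Times compact_Icc compact_cball)
  have \<Phi>c: "continuous_on \<K> \<Phi>" unfolding \<Phi>_def[abs_def] by (rule continuous_on_accel)
  have inK: "(l n, orbit R (v n) t, orbit' R (v n) t) \<in> \<K>" for n t
    using l0[of n] L[of n] x v by (auto simp: \<K>_def)
  have acc: "accel R (l n) (orbit R (v n) t) (orbit' R (v n) t) = \<Phi> (l n, orbit R (v n) t, orbit' R (v n) t)" for n t
    by (simp add: \<Phi>_def)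
  obtain A where A: "\<And>p. p \<in> \<K> \<Longrightarrow> norm (\<Phi> p) \<le> A"
    using compact_imp_bounded[OF compact_continuous_image[OF \<Phi>c comp]]
    unfolding bounded_iff by (meson image_eqI)
  have "\<forall>n. l n \<in> {0..L}" using l0 L by (auto intro: less_imp_le)
  then obtain lam r1 where r1: "strict_mono r1" and lam: "(l \<circ> r1) \<longlonglongrightarrow> lam" "lam \<in> {0..L}"
    using compact_Icc[of 0 L, unfolded compact_def, rule_format, of l] by blast
  \<comment> \<open>Position and velocity are paired so that one subsequence serves both. The
    derivative of the pair is bounded, which gives equicontinuity.\<close>
  define F where "F n t = (orbit R (v (r1 n)) t, orbit' R (v (r1 n)) t)" for n t
  have F': "(F n has_vector_derivative
      (orbit' R (v (r1 n)) t, accel R (l (r1 n)) (orbit R (v (r1 n)) t) (orbit' R (v (r1 n)) t))) (at t)" for n t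
    unfolding F_def by (intro has_vector_derivative_Pair orbit_deriv orbit'_deriv[OF R z])
  have lip: "norm (F n s - F n t) \<le> (B + A) * \<bar>s - t\<bar>" for n s t
  proof (rule norm_diff_le_of_derivative_bound[OF F'])
    show "norm (orbit' R (v (r1 n)) t, accel R (l (r1 n)) (orbit R (v (r1 n)) t) (orbit' R (v (r1 n)) t)) \<le> B + A" for t
      by (rule order_trans[OF norm_Pair_le]) (use v A[OF inK] acc in \<open>auto intro!: add_mono\<close>)
  qed
  have AB: "0 \<le> B + A"
    using v[of 0 0] A[OF inK[of 0 0]] by (meson add_nonneg_nonneg norm_ge_zero order_trans)
  obtain g r2 where r2: "strict_mono (r2 :: nat \<Rightarrow> nat)"
    and g: "\<And>e. 0 < e \<Longrightarrow> \<exists>N. \<forall>n t. n \<ge> N \<and> t \<in> {0..2*pi} \<longrightarrow> norm (F (r2 n) t - g t) < e"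
  proof (rule Arzela_Ascoli[of "{0..2*pi}" F "R + B"])
    show "norm (F n t) \<le> R + B" for n t
      unfolding F_def by (rule order_trans[OF norm_Pair_le]) (intro add_mono x v)
    fix t e :: real assume "0 < e"
    show "\<exists>d>0. \<forall>n s. s \<in> {0..2*pi} \<and> norm (t - s) < d \<longrightarrow> norm (F n t - F n s) < e"
    proof (intro exI[of _ "e / (B + A + 1)"] conjI allI impI)
      show "0 < e / (B + A + 1)" using AB \<open>0 < e\<close> by simp
      fix n s assume "s \<in> {0..2*pi} \<and> norm (t - s) < e / (B + A + 1)"
      then have "(B + A + 1) * \<bar>t - s\<bar> < e" using AB by (simp add: pos_less_divide_eq mult.commute)
      moreover have "norm (F n t - F n s) \<le> (B + A + 1) * \<bar>t - s\<bar>"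
        by (rule order_trans[OF lip]) (intro mult_right_mono; simp)
      ultimately show "norm (F n t - F n s) < e" by simp
    qed
  qed auto
  define r where "r = r1 \<circ> r2"
  have r: "strict_mono r" unfolding r_def by (rule strict_mono_o[OF r1 r2])
  have lr: "(\<lambda>n. l (r n)) \<longlonglongrightarrow> lam"
    using LIMSEQ_subseq_LIMSEQ[OF lam(1) r2] by (simp add: r_def o_def)
  let ?x = "\<lambda>n. orbit R (v (r n))" and ?v = "\<lambda>n. orbit' R (v (r n))"
  have "uniform_limit {0..2*pi} (\<lambda>n t. (?x n t, ?v n t)) g sequentially"
    unfolding uniform_limit_sequentially_iff using g unfolding F_def r_def dist_norm o_def by meson
  then obtain h where h: "uniform_limit UNIV (\<lambda>n t. (?x n t, ?v n t)) h sequentially" "\<And>t. h (t + 2*pi) = h t"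
    by (rule uniform_limit_periodic) (simp_all add: orbit_periodic orbit'_periodic)
  define X where "X t = fst (h t)" for t
  define V where "V t = snd (h t)" for t
  have hXV: "h t = (X t, V t)" for t by (simp add: X_def V_def)
  have Xl: "uniform_limit UNIV ?x X sequentially"
    using bounded_linear.uniform_limit[OF bounded_linear_fst h(1)] by (simp add: X_def[abs_def])
  have Vl: "uniform_limit UNIV ?v V sequentially"
    using bounded_linear.uniform_limit[OF bounded_linear_snd h(1)] by (simp add: V_def[abs_def])
  define Acc where "Acc t = accel R lam (X t) (V t)" for t
  let ?a = "\<lambda>n t. accel R (l (r n)) (?x n t) (?v n t)"
  have pl: "uniform_limit UNIV (\<lambda>n t. (l (r n), ?x n t, ?v n t)) (\<lambda>t. (lam, X t, V t)) sequentially"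
  proof (rule uniform_limitI)
    fix e :: real assume "e > 0"
    have "\<forall>\<^sub>F n in sequentially. dist (l (r n)) lam < e / 2"
      using tendstoD[OF lr, of "e / 2"] \<open>e > 0\<close> by simp
    moreover have "\<forall>\<^sub>F n in sequentially. \<forall>t\<in>UNIV. dist (?x n t, ?v n t) (h t) < e / 2"
      using uniform_limitD[OF h(1), of "e / 2"] \<open>e > 0\<close> by simp
    ultimately show "\<forall>\<^sub>F n in sequentially. \<forall>t\<in>UNIV. dist (l (r n), ?x n t, ?v n t) (lam, X t, V t) < e"
    proof eventually_elim
      case (elim n)
      have "dist (l (r n), ?x n t, ?v n t) (lam, X t, V t) \<le> dist (l (r n)) lam + dist (?x n t, ?v n t) (h t)" for t
        unfolding dist_Pair_Pair[of "l (r n)"] hXV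
        by (rule order_trans[OF sqrt_sum_squares_le_sum]) auto
      with elim show ?case by (smt (verit, best) UNIV_I field_sum_of_halves)
    qed
  qed
  have Al: "uniform_limit UNIV ?a Acc sequentially"
    using uniform_limit_compose_uniformly_continuous_on[OF pl compact_uniformly_continuous[OF \<Phi>c comp] _ compact_imp_closed[OF comp]]
      inK by (simp add: \<Phi>_def Acc_def[abs_def])
  have X': "(X has_vector_derivative V t) (at t)" for t
    by (rule has_vector_derivative_uniform_limit[OF orbit_deriv Vl tendsto_uniform_limitI[OF Xl]]) simp
  have V': "(V has_vector_derivative Acc t) (at t)" for t
    by (rule has_vector_derivative_uniform_limit[OF orbit'_deriv[OF R z] Al tendsto_uniform_limitI[OF Vl]]) simp
  have Ac: "continuous_on UNIV Acc"
  proof -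
    have "isCont X t" "isCont V t" for t
      using X'[of t] V'[of t] by (auto intro: has_vector_derivative_continuous)
    then have "continuous_on UNIV X" "continuous_on UNIV V" by (auto intro: continuous_at_imp_continuous_on)
    then show ?thesis unfolding Acc_def accel_def by (intro continuous_intros continuous_on_cross)
  qed
  have x0c: "continuous_on UNIV (x0 R)"
    by (rule continuous_at_imp_continuous_on) (auto intro: has_vector_derivative_continuous[OF x0_has_vector_derivative])
  define U where "U t = X t - x0 R t" for t
  have "H2_fun U"
  proof (rule H2_fun_C2)
    show "U (t + 2*pi) = U t" for t using h(2)[of t] by (simp add: U_def X_def x0_periodic)
    show "(U has_vector_derivative V t - x0' R t) (at t)" for t
      unfolding U_def by (intro has_vector_derivative_diff X' x0_has_vector_derivative)
    show "((\<lambda>t. V t - x0' R t) has_vector_derivative Acc t - - x0 R t) (at t)" for t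
      by (intro has_vector_derivative_diff V' x0'_has_vector_derivative)
    show "continuous_on UNIV (\<lambda>t. Acc t - - x0 R t)" by (intro continuous_intros Ac x0c)
  qed
  define u where "u = Abs_H2 U"
  have u: "rep_H2 u t = X t - x0 R t" for t
    unfolding u_def using Abs_H2_inverse[of U] \<open>H2_fun U\<close> by (simp add: U_def)
  have rep: "rep_H2 (v (r n) - u) = (\<lambda>t. ?x n t - X t)" for n
    by (simp add: fun_eq_iff minus_H2.rep_eq u orbit_def)
  have vu: "(\<lambda>n. v (r n)) \<longlonglongrightarrow> u"
  proof (rule tendstoI)
    fix e :: real assume "e > 0"
    \<comment> \<open>Uniform errors of at most \<open>e'\<close> give a squared norm of at most
      \<open>6 * pi * e'^2\<close>, which is below \<open>(5 * e')^2\<close> because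
      \<open>pi < 4\<close>.\<close>
    define e' where "e' = e / 5"
    have "e' > 0" using \<open>e > 0\<close> by (simp add: e'_def)
    from uniform_limitD[OF Xl this] uniform_limitD[OF Vl this] uniform_limitD[OF Al this]
    show "\<forall>\<^sub>F n in sequentially. dist (v (r n)) u < e"
    proof eventually_elim
      case (elim n)
      have "(norm (v (r n) - u))\<^sup>2 \<le> 6 * pi * e'\<^sup>2"
      proof (rule norm_H2_le_C2)
        show "(rep_H2 (v (r n) - u) has_vector_derivative ?v n t - V t) (at t)" for t
          unfolding rep by (intro has_vector_derivative_diff orbit_deriv X')
        show "((\<lambda>t. ?v n t - V t) has_vector_derivative ?a n t - Acc t) (at t)" for t
          by (intro has_vector_derivative_diff orbit'_deriv[OF R z] V')
        show "continuous_on UNIV (\<lambda>t. ?a n t - Acc t)"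
          unfolding accel_def[of R "l (r n)"]
          by (intro continuous_intros continuous_on_cross Ac continuous_on_orbit continuous_on_orbit'[OF R z])
        show "norm (rep_H2 (v (r n) - u) t) \<le> e'" "norm (?v n t - V t) \<le> e'" "norm (?a n t - Acc t) \<le> e'" for t
          using elim unfolding rep by (auto simp: dist_norm less_imp_le)
      qed
      also have "\<dots> < 25 * e'\<^sup>2"
        using pi_less_4 \<open>e' > 0\<close> by (intro mult_strict_right_mono) auto
      also have "\<dots> = e\<^sup>2" by (simp add: e'_def power_divide)
      finally show ?case using \<open>e > 0\<close> by (simp add: dist_norm power_less_imp_less_base)
    qed
  qed
  show ?thesis by (rule that[OF r tendsto_Pair[OF lr vu]])
qed

text \<open>A sequence in the closure is shadowed by one in \<open>S\<close> at distance below
  \<open>1 / Suc n\<close>, and both have the same limits along subsequences.\<close>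

lemma compact_closure_sequentially:
  fixes S :: "'a::metric_space set"
  assumes "\<And>f. (\<And>n. f n \<in> S) \<Longrightarrow> \<exists>r l. strict_mono (r :: nat \<Rightarrow> nat) \<and> (\<lambda>n. f (r n)) \<longlonglongrightarrow> l"
  shows "compact (closure S)"
  unfolding compact_def
proof (intro allI impI)
  fix f :: "nat \<Rightarrow> 'a" assume f: "\<forall>n. f n \<in> closure S"
  have "\<forall>n. \<exists>y\<in>S. dist y (f n) < 1 / real (Suc n)"
    using f closure_approachable by (metis of_nat_0_less_iff zero_less_Suc zero_less_divide_1_iff)
  then obtain g where g: "\<And>n. g n \<in> S" "\<And>n. dist (g n) (f n) < 1 / real (Suc n)" by metis
  obtain r l where r: "strict_mono (r :: nat \<Rightarrow> nat)" and l: "(\<lambda>n. g (r n)) \<longlonglongrightarrow> l"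
    using assms[of g] g(1) by blast
  have "(\<lambda>n. 1 / real (Suc n)) \<longlonglongrightarrow> 0" using lim_1_over_n LIMSEQ_Suc[of "\<lambda>n. 1 / real n" 0] by simp
  then have "(\<lambda>n. dist (g n) (f n)) \<longlonglongrightarrow> 0"
    by (rule Lim_null_comparison[rotated]) (use g(2) in \<open>auto intro!: always_eventually less_imp_le\<close>)
  then have d: "(\<lambda>n. dist (g (r n)) (f (r n))) \<longlonglongrightarrow> 0"
    using LIMSEQ_subseq_LIMSEQ[OF _ r] by (fastforce simp: o_def)
  have "(\<lambda>n. f (r n)) \<longlonglongrightarrow> l" 
    unfolding tendsto_dist_iff[of _ l]
  proof (rule Lim_null_comparison)
    show "\<forall>\<^sub>F n in sequentially. norm (dist (f (r n)) l) \<le> dist (g (r n)) (f (r n)) + dist (g (r n)) l"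
      by (simp add: dist_triangle3)
    show "(\<lambda>n. dist (g (r n)) (f (r n)) + dist (g (r n)) l) \<longlonglongrightarrow> 0"
      using tendsto_add[OF d l[unfolded tendsto_dist_iff[of _ l]]] by simp
  qed
  moreover have "l \<in> closure S" using l g(1) closure_sequential by (metis)
  ultimately show "\<exists>l\<in>closure S. \<exists>r. strict_mono r \<and> (f \<circ> r) \<longlonglongrightarrow> l"
    using r by (auto simp: o_def)
qed

section \<open>The alternatives\<close>

lemma Z_reg_alternatives:
  assumes R: "R > 0" and S: "S \<subseteq> Z_reg R"
    and k: "\<And>lam u. (lam, u) \<in> S \<Longrightarrow> swing_integral R lam u = k"
  shows "relatively_compact_in S (Z_reg R \<union> {p}) \<or>
    (\<exists>z :: nat \<Rightarrow> real \<times> H2. range z \<subseteq> S \<and> filterlim (\<lambda>n. fst (z n)) at_top sequentially) \<or>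
    (\<exists>(z :: nat \<Rightarrow> real \<times> H2) l. range z \<subseteq> S \<and> l \<in> ext_boundary R - {p} \<and> z \<longlonglongrightarrow> l)"
proof (rule disjCI, rule ccontr)
  assume nc: "\<not> ((\<exists>z :: nat \<Rightarrow> real \<times> H2. range z \<subseteq> S \<and> filterlim (\<lambda>n. fst (z n)) at_top sequentially) \<or>
    (\<exists>(z :: nat \<Rightarrow> real \<times> H2) l. range z \<subseteq> S \<and> l \<in> ext_boundary R - {p} \<and> z \<longlonglongrightarrow> l))"
    and nr: "\<not> relatively_compact_in S (Z_reg R \<union> {p})"
  have "\<exists>L. \<forall>z\<in>S. fst z \<le> L"
  proof (rule ccontr)
    assume "\<not> ?thesis"
    then have "\<forall>n. \<exists>z\<in>S. real n < fst z" by (metis not_less)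
    then obtain z where z: "\<And>n. z n \<in> S" "\<And>n. real n < fst (z n)" by metis
    have "filterlim (\<lambda>n. fst (z n)) at_top sequentially"
      by (rule filterlim_at_top_mono[OF filterlim_real_sequentially])
        (use z(2) in \<open>auto intro!: always_eventually less_imp_le\<close>)
    with nc z(1) show False by blast
  qed
  then obtain L where L: "\<And>z. z \<in> S \<Longrightarrow> fst z \<le> L" by blast
  have comp: "compact (closure S)"
  proof (rule compact_closure_sequentially)
    fix f :: "nat \<Rightarrow> real \<times> H2" assume f: "\<And>n. f n \<in> S"
    then have f': "(fst (f n), snd (f n)) \<in> S" for n by simp
    then have z: "(fst (f n), snd (f n)) \<in> zero_set R" for n using S Z_reg_bounds(1) by blast
    obtain r lam u where "strict_mono r" "(\<lambda>n. (fst (f (r n)), snd (f (r n)))) \<longlonglongrightarrow> (lam, u)"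
      by (rule zero_set_subsequence_convergent[OF R z L[OF f] k[OF f']])
    then show "\<exists>r l. strict_mono (r :: nat \<Rightarrow> nat) \<and> (\<lambda>n. f (r n)) \<longlonglongrightarrow> l" by auto
  qed
  have cl: "closure S \<subseteq> Z_reg R \<union> {p}"
  proof (rule ccontr)
    assume "\<not> ?thesis"
    then obtain l where l: "l \<in> closure S" "l \<notin> Z_reg R" "l \<noteq> p" by blast
    \<comment> \<open>The half space is closed and contains the regular class, so closures in it
      agree with closures in the whole space and \<open>l\<close> is a point of the extended
      boundary.\<close>
    have "S \<subseteq> {0..} \<times> UNIV"
      using S zero_set_sphere(1)[OF Z_reg_bounds(1)] by (fastforce intro: less_imp_le)
    then have "closure S \<subseteq> {0..} \<times> UNIV"
      by (rule closure_minimal) (intro closed_Times closed_atLeast closed_UNIV)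
    moreover have "{0..} \<times> UNIV \<inter> Z_reg R = Z_reg R"
      using zero_set_sphere(1)[OF Z_reg_bounds(1)] by (fastforce intro: less_imp_le)
    moreover have "l \<in> closure (Z_reg R)" using l(1) closure_mono[OF S] by blast
    ultimately have "l \<in> ext_boundary R"
      using l by (auto simp: ext_boundary_def closure_of_subtopology)
    moreover obtain z where "\<And>n. z n \<in> S" "z \<longlonglongrightarrow> l"
      using l(1) closure_sequential by blast
    ultimately show False using nc l(3) by blast
  qed
  have "S \<subseteq> Z_reg R \<union> {p}" using S by blast
  \<comment> \<open>The whole closure lies in the target set, so the relative closure is the
    ordinary one, and its compactness does not depend on the surrounding set.\<close>
  then have "(top_of_set (Z_reg R \<union> {p})) closure_of S = closure S"
    using cl by (simp add: closure_of_subtopology Int_absorb1 Int_absorb2)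
  then have "relatively_compact_in S (Z_reg R \<union> {p})"
    using comp cl by (simp add: relatively_compact_in_def compactin_subtopology)
  with nr show False ..
qed

text \<open>\<open>\<epsilon>\<close> makes the phrase "sufficiently small" precise: a single
  threshold for the given curve, fixed before the component, the point on the curve and the phase
  are chosen.\<close>

theorem theorem1p2:
  fixes R :: real and k :: nat and \<delta> :: real and \<Lambda> :: "real \<Rightarrow> real" and \<Gamma> :: "real \<Rightarrow> H2"
  assumes "R > 0" and "k \<ge> 2"
    and "local_branch R k \<delta> \<Lambda> \<Gamma>"
  shows "\<exists>\<epsilon>. 0 < \<epsilon> \<and> \<epsilon> \<le> \<delta> \<and>
    (\<forall>\<C> \<in> components (Z_reg R).
      (\<exists>t. 0 < \<bar>t\<bar> \<and> \<bar>t\<bar> < \<epsilon> \<and>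
         ((\<Lambda> t, branch k \<Gamma> t) \<in> \<C> \<or>
          (\<exists>\<phi> w. phase_translate \<phi> (branch k \<Gamma> t) w \<and> (\<Lambda> t, w) \<in> \<C>))) \<longrightarrow>
      (\<forall>(lam, u) \<in> \<C>. horizontal_degree R u = 1 \<and> vertical_nodal_number R u k) \<and>
      (relatively_compact_in \<C> (Z_reg R \<union> {(bif_value R k, 0)}) \<or>
       (\<exists>z :: nat \<Rightarrow> real \<times> H2. range z \<subseteq> \<C> \<and>
          filterlim (\<lambda>n. fst (z n)) at_top sequentially) \<or>
       (\<exists>(z :: nat \<Rightarrow> real \<times> H2) l. range z \<subseteq> \<C> \<and>
          l \<in> ext_boundary R - {(bif_value R k, 0)} \<and> z \<longlonglongrightarrow> l)))"
proof -
  note R = assms(1) and k = assms(2)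
  obtain \<epsilon> where \<epsilon>: "0 < \<epsilon>" "\<epsilon> \<le> \<delta>"
    "\<And>t \<phi> w. \<bar>t\<bar> < \<epsilon> \<Longrightarrow> phase_translate \<phi> (branch k \<Gamma> t) w \<Longrightarrow> (\<Lambda> t, w) \<in> Z_reg R \<Longrightarrow>
      turning_integral R (\<Lambda> t) w = 1 \<and> swing_integral R (\<Lambda> t) w = real k"
    using local_branch_invariants[OF assms] by blast
  show ?thesis
  proof (rule exI[of _ \<epsilon>], intro conjI \<epsilon>(1,2), rule ballI, rule impI, rule conjI)
    fix \<C>
    assume \<C>: "\<C> \<in> components (Z_reg R)"
      and ex: "\<exists>t. 0 < \<bar>t\<bar> \<and> \<bar>t\<bar> < \<epsilon> \<and> ((\<Lambda> t, branch k \<Gamma> t) \<in> \<C> \<or>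
          (\<exists>\<phi> w. phase_translate \<phi> (branch k \<Gamma> t) w \<and> (\<Lambda> t, w) \<in> \<C>))"
    have sub: "\<C> \<subseteq> Z_reg R" and conn: "connected \<C>"
      using \<C> by (auto dest: in_components_subset in_components_connected)
    \<comment> \<open>A point of the curve itself is its own translate with angle \<open>0\<close>,
      so the two cases merge.\<close>
    obtain t \<phi> w where t: "\<bar>t\<bar> < \<epsilon>" "phase_translate \<phi> (branch k \<Gamma> t) w" "(\<Lambda> t, w) \<in> \<C>"
      using ex phase_translate_refl by blast
    have base: "turning_integral R (\<Lambda> t) w = 1" "swing_integral R (\<Lambda> t) w = real k"
      using \<epsilon>(3)[OF t(1,2)] t(3) sub by blast+
    have int: "turning_integral R (fst z) (snd z) \<in> \<int>" "swing_integral R (fst z) (snd z) \<in> \<int>" if "z \<in> \<C>" for z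
      using Z_reg_invariants(2,3)[OF R, of "fst z" "snd z"] sub that by auto
    have inv: "turning_integral R lam u = 1" "swing_integral R lam u = real k" if "(lam, u) \<in> \<C>" for lam u
      using continuous_Ints_constant[OF conn continuous_on_subset[OF continuous_on_invariants(1)[OF R] sub] int(1) that t(3)]
        continuous_Ints_constant[OF conn continuous_on_subset[OF continuous_on_invariants(2)[OF R] sub] int(2) that t(3)]
        base by simp_all
    show "\<forall>(lam, u)\<in>\<C>. horizontal_degree R u = 1 \<and> vertical_nodal_number R u k"
    proof (intro ballI case_prodI2)
      fix z lam u assume "z \<in> \<C>" "z = (lam, u)"
      then have z: "(lam, u) \<in> \<C>" "(lam, u) \<in> Z_reg R" using sub by blast+
      then show "horizontal_degree R u = 1 \<and> vertical_nodal_number R u k"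
        using Z_reg_invariants(1,4)[OF R z(2)] inv[OF z(1)] by simp
    qed
    show "relatively_compact_in \<C> (Z_reg R \<union> {(bif_value R k, 0)}) \<or>
       (\<exists>z :: nat \<Rightarrow> real \<times> H2. range z \<subseteq> \<C> \<and>
          filterlim (\<lambda>n. fst (z n)) at_top sequentially) \<or>
       (\<exists>(z :: nat \<Rightarrow> real \<times> H2) l. range z \<subseteq> \<C> \<and>
          l \<in> ext_boundary R - {(bif_value R k, 0)} \<and> z \<longlonglongrightarrow> l)"
      by (rule Z_reg_alternatives[OF R sub inv(2)])
  qed
qed

end
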